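(* Let $\theta>0$ and let $(\mathbb P_n)_{n\in\mathbb N}$ be any sequence of asymptotically Ewens measures with parameter $\theta$. For a partition $\alpha=(\alpha_1,\ldots,\alpha_n)$ of $n$ and $0\le t\le1$, let $\nu_{n,t}=\alpha_1+\cdots+\alpha_{\lfloor n^t\rfloor}$ be the number of parts of size at most $n^t$. Then, with the partition of $n$ distributed according to $\mathbb P_n$, the process $$\left(\frac{\nu_{n,t}-\theta t\log n}{\sqrt{\theta\log n}}\right)_{0\le t\le1}$$ converges in distribution in $\mathcal D[0,1]$, the Skorohod space of right-continuous functions with left limits on $[0,1]$, as $n\to\infty$, to the standard Brownian motion $(W_t)_{0\le t\le1}$.
   Context: Partitions. $\mathcal P_n$ is the set of partitions of $n$, written $\alpha=(\alpha_1,\ldots,\alpha_n)$, where $\alpha_i\ge0$ is the number of parts of size $i$, so $\alpha_1+2\alpha_2+\cdots+n\alpha_n=n$. A vector $(\alpha_1,\ldots,\alpha_m)$ of nonnegative integers is regarded as a partition of $k=\sum_{i\le m} i\alpha_i$ (discarding or appending zeros as needed; $k=0$ gives the empty partition). Ewens measure. For $\theta>0$, $\mathbb P^\theta_n(\alpha)=\frac{n!}{\theta(\theta+1)\cdots(\theta+n-1)}\prod_{i=1}^n\frac{\theta^{\alpha_i}}{i^{\alpha_i}\alpha_i!}$ for $\alpha\in\mathcal P_n$. Perturbed measures. Given a nonnegative function $\eta$ on the set of all partitions of all integers $k\ge0$, let $\mathbb P^{\theta,\eta}_n(\alpha)=\frac{\eta(\alpha)}{Z^{\theta,\eta}_n}\prod_{i=1}^n\frac{\theta^{\alpha_i}}{i^{\alpha_i}\alpha_i!}$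 for $\alpha\in\mathcal P_n$, where $Z_n^{\theta,\eta}$ is the normalising constant (assumed positive for every $n\in\mathbb N$). Thus $\eta$ restricted to $\mathcal P_n$ is a positive constant multiple of the Radon-Nikodym derivative of $\mathbb P^{\theta,\eta}_n$ with respect to $\mathbb P^\theta_n$. Feller coupling. For a binary sequence $\xi=(\xi_1,\xi_2,\ldots)\in\{0,1\}^{\mathbb N}$ with $\xi_1=1$ and $n\in\mathbb N$, define the partition $(\alpha_1(n),\ldots,\alpha_n(n))\in\mathcal P_n$ by $$\alpha_i(n)=\sum_{j=1}^{n-i}\xi_j(1-\xi_{j+1})\cdots(1-\xi_{j+i-1})\xi_{i+j}+\xi_{n-i+1}(1-\xi_{n-i+2})\cdots(1-\xi_n),$$ i.e. the number of maximal runs of exactly $i-1$ zeros between consecutive $1$s in the string $(\xi_1,\ldots,\xi_n,1)$. Let $\mathbb P^\theta_F$ be the probability measure on $\{0,1\}^{\mathbb N}$ under which the $\xi_i$ are independent Bernoulli with success probability $\theta/(\theta+i-1)$ (so $\xi_1=1$ almost surely); the law of $(\alpha_1(n),\dots,\alpha_n(n))$ under $\mathbb P_F^\theta$ is $\mathbb P^\theta_n$. Expectation under $\mathbb P^\theta_F$ is $\mathbb E^\theta_F$. Asymptotically Ewens. Given a nonnegative function $\eta$ on the set of all partitions of all integers $k\ge0$, for $m\le n$ define the random variables (under $\mathbb P^\theta_F$) $\eta_{n,m}=\eta(\alpha_1(n),\ldots,\alpha_m(n))$. A sequence of measures $\mathbb P_n$ on $\mathcal P_n$, $n\in\mathbb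 N$, is asymptotically Ewens with parameter $\theta$ if it can be written as $\mathbb P_n=\mathbb P_n^{\theta,\eta}$ for some nonnegative function $\eta$ on the set of all partitions of all integers $k\ge0$, with $Z_n^{\theta,\eta}>0$ for every $n\in\mathbb N$, such that (1) the limits $\lim_{n\to\infty}\eta_{n,n}$ and $\lim_{m\to\infty}\lim_{n\to\infty}\eta_{n,m}$ exist and agree in $L^1(\mathbb P^\theta_F)$; and (2) the common limit $\eta_\infty$ satisfies $0<\mathbb E^\theta_F[\eta_\infty]<\infty$. *)

theory Defs
  imports "HOL-Probability.Probability"
begin

text \<open>
  A partition is encoded by its multiplicity function: \<open>\<alpha> i\<close> is the number of parts of size \<open>i\<close>.
  Vectors of different lengths that differ by trailing zeros give the same function; the empty
  partition is the zero function.
\<close>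

definition partitions :: "nat \<Rightarrow> (nat \<Rightarrow> nat) set" where
  "partitions n = {\<alpha>. (\<forall>i. i \<notin> {1..n} \<longrightarrow> \<alpha> i = 0) \<and> (\<Sum>i=1..n. i * \<alpha> i) = n}"

lemma finite_partitions: "finite (partitions n)"
proof (rule finite_subset)
  have le: "\<alpha> i \<le> n" if a: "\<alpha> \<in> partitions n" and i: "i \<in> {1..n}" for \<alpha> i
  proof -
    have "\<alpha> i \<le> i * \<alpha> i" using i by simp
    also have "\<dots> \<le> (\<Sum>i=1..n. i * \<alpha> i)"
      using i by (intro member_le_sum) auto
    also have "\<dots> = n" using a by (simp add: partitions_def)
    finally show ?thesis .
  qed
  show "partitions n \<subseteq> {\<alpha>. \<forall>i. (i \<in> {1..n} \<longrightarrow> \<alpha> i \<in> {..n}) \<and> (i \<notin> {1..n} \<longrightarrow> \<alpha> i = 0)}"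
  proof
    fix \<alpha> assume a: "\<alpha> \<in> partitions n"
    then have "\<alpha> i = 0" if "i \<notin> {1..n}" for i using that by (simp add: partitions_def)
    with le[OF a]
    show "\<alpha> \<in> {\<alpha>. \<forall>i. (i \<in> {1..n} \<longrightarrow> \<alpha> i \<in> {..n}) \<and> (i \<notin> {1..n} \<longrightarrow> \<alpha> i = 0)}"
      by blast
  qed
  show "finite {\<alpha>. \<forall>i. (i \<in> {1..n} \<longrightarrow> \<alpha> i \<in> {..n}) \<and> (i \<notin> {1..n} \<longrightarrow> \<alpha> i = (0::nat))}"
    by (rule finite_set_of_finite_funs) simp_all
qed

definition ewens_weight :: "real \<Rightarrow> nat \<Rightarrow> (nat \<Rightarrow> nat) \<Rightarrow> real" where
  "ewens_weight \<theta> n \<alpha> = (\<Prod>i=1..n. \<theta> ^ \<alpha> i / (real i ^ \<alpha> i * fact (\<alpha> i)))"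

definition perturbed_norm :: "real \<Rightarrow> ((nat \<Rightarrow> nat) \<Rightarrow> real) \<Rightarrow> nat \<Rightarrow> real" where
  "perturbed_norm \<theta> \<eta> n = (\<Sum>\<alpha>\<in>partitions n. \<eta> \<alpha> * ewens_weight \<theta> n \<alpha>)"

definition perturbed_ewens ::
    "real \<Rightarrow> ((nat \<Rightarrow> nat) \<Rightarrow> real) \<Rightarrow> nat \<Rightarrow> (nat \<Rightarrow> nat) measure" where
  "perturbed_ewens \<theta> \<eta> n =
     point_measure (partitions n)
       (\<lambda>\<alpha>. ennreal (\<eta> \<alpha> / perturbed_norm \<theta> \<eta> n * ewens_weight \<theta> n \<alpha>))"

lemma prob_space_perturbed_ewens:
  assumes "\<theta> > 0" and nn: "\<And>\<alpha>. \<alpha> \<in> partitions n \<Longrightarrow> 0 \<le> \<eta> \<alpha>"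
    and Z: "perturbed_norm \<theta> \<eta> n > 0"
  shows "prob_space (perturbed_ewens \<theta> \<eta> n)"
proof
  have w: "ewens_weight \<theta> n \<alpha> \<ge> 0" for \<alpha>
    using \<open>\<theta> > 0\<close> by (auto simp: ewens_weight_def intro!: prod_nonneg)
  have "emeasure (perturbed_ewens \<theta> \<eta> n) (partitions n) =
      (\<Sum>\<alpha>\<in>partitions n. ennreal (\<eta> \<alpha> / perturbed_norm \<theta> \<eta> n * ewens_weight \<theta> n \<alpha>))"
    unfolding perturbed_ewens_def
    by (subst emeasure_point_measure_finite) (auto simp: finite_partitions)
  also have "\<dots> = ennreal (\<Sum>\<alpha>\<in>partitions n. \<eta> \<alpha> / perturbed_norm \<theta> \<eta> n * ewens_weight \<theta> n \<alpha>)"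
    using nn w Z by (intro sum_ennreal) auto
  also have "(\<Sum>\<alpha>\<in>partitions n. \<eta> \<alpha> / perturbed_norm \<theta> \<eta> n * ewens_weight \<theta> n \<alpha>) =
      perturbed_norm \<theta> \<eta> n / perturbed_norm \<theta> \<eta> n"
    by (subst (2) perturbed_norm_def) (simp add: sum_divide_distrib)
  finally show "emeasure (perturbed_ewens \<theta> \<eta> n) (space (perturbed_ewens \<theta> \<eta> n)) = 1"
    using Z by (simp add: perturbed_ewens_def space_point_measure)
qed

text \<open>Binary sequences are indexed by the positive integers, with \<open>True\<close> for 1.\<close>

definition feller_measure :: "real \<Rightarrow> (nat \<Rightarrow> bool) measure" where
  "feller_measure \<theta> = PiM {1..} (\<lambda>i. measure_pmf (bernoulli_pmf (\<theta> / (\<theta> + real i - 1))))"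

definition feller_partition :: "(nat \<Rightarrow> bool) \<Rightarrow> nat \<Rightarrow> (nat \<Rightarrow> nat)" where
  "feller_partition \<xi> n = (\<lambda>i. if i \<in> {1..n} then
       (\<Sum>j=1..n-i. of_bool (\<xi> j) * (\<Prod>l=j+1..j+i-1. 1 - of_bool (\<xi> l)) * of_bool (\<xi> (i + j)))
         + of_bool (\<xi> (n - i + 1)) * (\<Prod>l=n-i+2..n. 1 - of_bool (\<xi> l))
     else 0)"

definition small_parts :: "nat \<Rightarrow> (nat \<Rightarrow> nat) \<Rightarrow> (nat \<Rightarrow> nat)" where
  "small_parts m \<alpha> = (\<lambda>i. if i \<in> {1..m} then \<alpha> i else 0)"

definition eta_trunc :: "((nat \<Rightarrow> nat) \<Rightarrow> real) \<Rightarrow> nat \<Rightarrow> nat \<Rightarrow> (nat \<Rightarrow> bool) \<Rightarrow> real" where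
  "eta_trunc \<eta> n m \<xi> = \<eta> (small_parts m (feller_partition \<xi> n))"

definition tendsto_L1 :: "'a measure \<Rightarrow> (nat \<Rightarrow> 'a \<Rightarrow> real) \<Rightarrow> ('a \<Rightarrow> real) \<Rightarrow> bool" where
  "tendsto_L1 M X Y \<longleftrightarrow> (\<forall>n. integrable M (X n)) \<and> integrable M Y \<and>
     (\<lambda>n. LINT \<omega>|M. \<bar>X n \<omega> - Y \<omega>\<bar>) \<longlonglongrightarrow> 0"

text \<open>
  The iterated limit is taken in \<open>L\<^sup>1\<close> at both stages, \<open>\<zeta> m\<close> being the limit over \<open>n\<close>. Finiteness
  of the expectation of \<open>\<eta>_inf\<close> is contained in its integrability.
\<close>

definition asymptotically_ewens :: "real \<Rightarrow> (nat \<Rightarrow> (nat \<Rightarrow> nat) measure) \<Rightarrow> bool" where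
  "asymptotically_ewens \<theta> P \<longleftrightarrow> (\<exists>\<eta>.
     (\<forall>k. \<forall>\<alpha>\<in>partitions k. 0 \<le> \<eta> \<alpha>) \<and>
     (\<forall>n\<ge>1. perturbed_norm \<theta> \<eta> n > 0) \<and>
     (\<forall>n\<ge>1. P n = perturbed_ewens \<theta> \<eta> n) \<and>
     (\<exists>\<eta>_inf \<zeta>.
        tendsto_L1 (feller_measure \<theta>) (\<lambda>n. eta_trunc \<eta> n n) \<eta>_inf \<and>
        (\<forall>m. tendsto_L1 (feller_measure \<theta>) (\<lambda>n. eta_trunc \<eta> n m) (\<zeta> m)) \<and>
        tendsto_L1 (feller_measure \<theta>) \<zeta> \<eta>_inf \<and>
        0 < (LINT \<xi>|feller_measure \<theta>. \<eta>_inf \<xi>)))"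

text \<open>Elements are functions on the real line that are \<open>undefined\<close> outside \<open>[0,1]\<close>.\<close>

definition D01 :: "(real \<Rightarrow> real) set" where
  "D01 = {x \<in> extensional {0..1}.
     (\<forall>t. 0 \<le> t \<and> t < 1 \<longrightarrow> (x \<longlongrightarrow> x t) (at_right t)) \<and>
     (\<forall>t. 0 < t \<and> t \<le> 1 \<longrightarrow> (\<exists>l. (x \<longlongrightarrow> l) (at_left t)))}"

definition time_changes :: "(real \<Rightarrow> real) set" where
  "time_changes = {l. continuous_on {0..1} l \<and> strict_mono_on {0..1} l \<and> l ` {0..1} = {0..1}}"

definition skorohod_bounds :: "(real \<Rightarrow> real) \<Rightarrow> (real \<Rightarrow> real) \<Rightarrow> real set" where
  "skorohod_bounds x y = {e. 0 \<le> e \<and>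
     (\<exists>l\<in>time_changes. \<forall>t\<in>{0..1}. \<bar>l t - t\<bar> \<le> e \<and> \<bar>x t - y (l t)\<bar> \<le> e)}"

text \<open>
  The value outside \<open>D01\<close> is irrelevant; it is fixed because the locale \<open>Metric_space\<close> demands
  nonnegativity and symmetry for all arguments.
\<close>

definition skorohod_dist :: "(real \<Rightarrow> real) \<Rightarrow> (real \<Rightarrow> real) \<Rightarrow> real" where
  "skorohod_dist x y = (if x \<in> D01 \<and> y \<in> D01 then Inf (skorohod_bounds x y) else 0)"

lemma D01_bounded:
  assumes x: "x \<in> D01"
  shows "\<exists>B. \<forall>t\<in>{0..1}. \<bar>x t\<bar> \<le> B"
proof -
  have loc: "\<exists>d>0. \<exists>B. \<forall>s\<in>{0..1}. \<bar>s - t\<bar> < d \<longrightarrow> \<bar>x s\<bar> \<le> B" if t: "t \<in> {0..1}" for t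
  proof -
    have R: "\<exists>d>0. \<exists>B. \<forall>s\<in>{0..1}. t < s \<and> s < t + d \<longrightarrow> \<bar>x s\<bar> \<le> B"
    proof (cases "t < 1")
      case True
      then have "(x \<longlongrightarrow> x t) (at_right t)" using x t by (auto simp: D01_def)
      then have "eventually (\<lambda>s. dist (x s) (x t) < 1) (at_right t)" by (rule tendstoD) simp
      then obtain b where "b > t" "\<And>s. t < s \<Longrightarrow> s < b \<Longrightarrow> dist (x s) (x t) < 1"
        by (auto simp: eventually_at_right_field)
      then show ?thesis
        by (intro exI[of _ "b - t"] conjI exI[of _ "\<bar>x t\<bar> + 1"]) (force simp: dist_real_def)+
    next
      case False
      then show ?thesis using t by (intro exI[of _ 1]) auto
    qed
    have L: "\<exists>d>0. \<exists>B. \<forall>s\<in>{0..1}. t - d < s \<and> s < t \<longrightarrow> \<bar>x s\<bar> \<le> B"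
    proof (cases "t > 0")
      case True
      then obtain l where "(x \<longlongrightarrow> l) (at_left t)" using x t by (auto simp: D01_def)
      then have "eventually (\<lambda>s. dist (x s) l < 1) (at_left t)" by (rule tendstoD) simp
      then obtain b where "b < t" "\<And>s. b < s \<Longrightarrow> s < t \<Longrightarrow> dist (x s) l < 1"
        by (auto simp: eventually_at_left_field)
      then show ?thesis
        by (intro exI[of _ "t - b"] conjI exI[of _ "\<bar>l\<bar> + 1"]) (force simp: dist_real_def)+
    next
      case False
      then show ?thesis using t by (intro exI[of _ 1]) auto
    qed
    from R obtain d1 B1 where 1: "d1 > 0"
        "\<And>s. s \<in> {0..1} \<Longrightarrow> t < s \<Longrightarrow> s < t + d1 \<Longrightarrow> \<bar>x s\<bar> \<le> B1" by blast
    from L obtain d2 B2 where 2: "d2 > 0"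
        "\<And>s. s \<in> {0..1} \<Longrightarrow> t - d2 < s \<Longrightarrow> s < t \<Longrightarrow> \<bar>x s\<bar> \<le> B2" by blast
    have "\<bar>x s\<bar> \<le> max \<bar>x t\<bar> (max B1 B2)" if "s \<in> {0..1}" "\<bar>s - t\<bar> < min d1 d2" for s
    proof (cases s t rule: linorder_cases)
      case less then show ?thesis using 2(2)[of s] that by auto
    next
      case greater then show ?thesis using 1(2)[of s] that by auto
    qed auto
    then show ?thesis using 1(1) 2(1)
      by (intro exI[of _ "min d1 d2"] conjI exI[of _ "max \<bar>x t\<bar> (max B1 B2)"]) auto
  qed
  then obtain d B where dB: "\<And>t. t \<in> {0..1} \<Longrightarrow> d t > 0"
      "\<And>t s. t \<in> {0..1} \<Longrightarrow> s \<in> {0..1} \<Longrightarrow> \<bar>s - t\<bar> < d t \<Longrightarrow> \<bar>x s\<bar> \<le> B t"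
    by metis
  have cov: "{0..1} \<subseteq> (\<Union>t\<in>{0..1}. ball t (d t))" using dB(1) by force
  obtain C where C: "C \<subseteq> {0..1}" "finite C" "{0..1} \<subseteq> (\<Union>t\<in>C. ball t (d t))"
    by (rule compactE_image[OF compact_Icc _ cov]) auto
  have "\<bar>x s\<bar> \<le> (\<Sum>t\<in>C. \<bar>B t\<bar>)" if s: "s \<in> {0..1}" for s
  proof -
    obtain t where t: "t \<in> C" "s \<in> ball t (d t)" using C(3) s by auto
    have "\<bar>x s\<bar> \<le> \<bar>B t\<bar>" using dB(2)[of t s] t C(1) s by (force simp: dist_real_def abs_minus_commute)
    also have "\<dots> \<le> (\<Sum>t\<in>C. \<bar>B t\<bar>)" using t C(2) by (intro member_le_sum) auto
    finally show ?thesis .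
  qed
  then show ?thesis by blast
qed

lemma time_changes_id: "(\<lambda>t. t) \<in> time_changes"
  by (auto simp: time_changes_def strict_mono_on_def)

lemma time_changes_comp:
  assumes "l \<in> time_changes" "k \<in> time_changes"
  shows "(\<lambda>t. k (l t)) \<in> time_changes"
  unfolding time_changes_def
proof (intro CollectI conjI)
  have l: "continuous_on {0..1} l" "strict_mono_on {0..1} l" "l ` {0..1} = {0..1}"
    and k: "continuous_on {0..1} k" "strict_mono_on {0..1} k" "k ` {0..1} = {0..1}"
    using assms by (auto simp: time_changes_def)
  show "continuous_on {0..1} (\<lambda>t. k (l t))"
    by (rule continuous_on_compose2[OF k(1) l(1)]) (use l in auto)
  show "strict_mono_on {0..1} (\<lambda>t. k (l t))"
    using l k unfolding strict_mono_on_def by (metis imageI)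
  show "(\<lambda>t. k (l t)) ` {0..1} = {0..1}"
    using l k by (metis image_image)
qed

lemma time_changes_inverse:
  assumes "l \<in> time_changes"
  obtains k where "k \<in> time_changes" "\<And>t. t \<in> {0..1} \<Longrightarrow> k t \<in> {0..1}"
    "\<And>t. t \<in> {0..1} \<Longrightarrow> l (k t) = t"
proof -
  have l: "continuous_on {0..1} l" "strict_mono_on {0..1} l" "l ` {0..1} = {0..1}"
    using assms by (auto simp: time_changes_def)
  have inj: "inj_on l {0..1}" using l(2) by (rule strict_mono_on_imp_inj_on)
  define k where "k = the_inv_into {0..1} l"
  have kl: "k (l t) = t" if "t \<in> {0..1}" for t
    using that inj by (simp add: k_def the_inv_into_f_f)
  have lk: "l (k t) = t" if "t \<in> {0..1}" for t
    using that inj l(3) by (simp add: k_def f_the_inv_into_f)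
  have kin: "k t \<in> {0..1}" if "t \<in> {0..1}" for t
    using that inj l(3) kl by (metis imageE)
  have "continuous_on (l ` {0..1}) k"
    using l(1) by (intro continuous_on_inv) (auto simp: kl)
  moreover have "strict_mono_on {0..1} k"
  proof (rule strict_mono_onI)
    fix r s :: real assume rs: "r \<in> {0..1}" "s \<in> {0..1}" "r < s"
    show "k r < k s"
    proof (rule ccontr)
      assume "\<not> k r < k s"
      then have "l (k s) \<le> l (k r)"
        using l(2) kin rs by (metis strict_mono_on_leD linorder_not_less)
      then show False using lk rs by auto
    qed
  qed
  moreover have "k ` {0..1} = {0..1}"
    using kl kin l(3) by (metis (no_types, lifting) image_cong image_ident image_image)
  ultimately have "k \<in> time_changes" using l(3) by (simp add: time_changes_def)
  then show ?thesis using that lk kin by blast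
qed

lemma skorohod_bounds_bdd_below: "bdd_below (skorohod_bounds x y)"
  by (rule bdd_belowI[of _ 0]) (auto simp: skorohod_bounds_def)

lemma skorohod_bounds_nonempty:
  assumes "x \<in> D01" "y \<in> D01"
  shows "skorohod_bounds x y \<noteq> {}"
proof -
  obtain A B where A: "\<And>t. t \<in> {0..1} \<Longrightarrow> \<bar>x t\<bar> \<le> A" and B: "\<And>t. t \<in> {0..1} \<Longrightarrow> \<bar>y t\<bar> \<le> B"
    using D01_bounded assms by meson
  have "\<bar>x t - y t\<bar> \<le> \<bar>A\<bar> + \<bar>B\<bar>" if "t \<in> {0..1}" for t
    using A[OF that] B[OF that] by linarith
  then have "\<bar>A\<bar> + \<bar>B\<bar> \<in> skorohod_bounds x y"
    unfolding skorohod_bounds_def using time_changes_id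
    by (intro CollectI conjI bexI[of _ "\<lambda>t. t"]) auto
  then show ?thesis by blast
qed

lemma skorohod_bounds_sym: "skorohod_bounds x y \<subseteq> skorohod_bounds y x"
proof
  fix e assume "e \<in> skorohod_bounds x y"
  then obtain l where l: "0 \<le> e" "l \<in> time_changes"
      "\<And>t. t \<in> {0..1} \<Longrightarrow> \<bar>l t - t\<bar> \<le> e" "\<And>t. t \<in> {0..1} \<Longrightarrow> \<bar>x t - y (l t)\<bar> \<le> e"
    by (auto simp: skorohod_bounds_def)
  obtain k where k: "k \<in> time_changes" "\<And>t. t \<in> {0..1} \<Longrightarrow> k t \<in> {0..1}"
    "\<And>t. t \<in> {0..1} \<Longrightarrow> l (k t) = t"
    using time_changes_inverse[OF l(2)] by blast
  have "\<bar>k t - t\<bar> \<le> e \<and> \<bar>y t - x (k t)\<bar> \<le> e" if t: "t \<in> {0..1}" for t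
    using l(3)[OF k(2)[OF t]] l(4)[OF k(2)[OF t]] k(3)[OF t] by (simp add: abs_minus_commute)
  then show "e \<in> skorohod_bounds y x"
    unfolding skorohod_bounds_def using l(1) k(1) by blast
qed

lemma skorohod_dist_nonneg: "0 \<le> skorohod_dist x y"
  using skorohod_bounds_nonempty[of x y]
  by (simp add: skorohod_dist_def) (metis (mono_tags, lifting) cInf_greatest mem_Collect_eq skorohod_bounds_def)

lemma skorohod_dist_less:
  assumes "x \<in> D01" "y \<in> D01" "skorohod_dist x y < e"
  obtains l where "l \<in> time_changes"
    "\<And>t. t \<in> {0..1} \<Longrightarrow> \<bar>l t - t\<bar> < e" "\<And>t. t \<in> {0..1} \<Longrightarrow> \<bar>x t - y (l t)\<bar> < e"
proof -
  have "Inf (skorohod_bounds x y) < e" using assms by (simp add: skorohod_dist_def)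
  then obtain e' where "e' \<in> skorohod_bounds x y" "e' < e"
    using skorohod_bounds_nonempty[OF assms(1,2)] by (meson cInf_lessD)
  then obtain l where "l \<in> time_changes" "\<forall>t\<in>{0..1}. \<bar>l t - t\<bar> \<le> e' \<and> \<bar>x t - y (l t)\<bar> \<le> e'"
    by (auto simp: skorohod_bounds_def)
  with \<open>e' < e\<close> show ?thesis by (intro that[of l]) force+
qed

lemma skorohod_dist_le:
  assumes "x \<in> D01" "y \<in> D01" "0 \<le> e" "l \<in> time_changes"
    "\<And>t. t \<in> {0..1} \<Longrightarrow> \<bar>l t - t\<bar> \<le> e" "\<And>t. t \<in> {0..1} \<Longrightarrow> \<bar>x t - y (l t)\<bar> \<le> e"
  shows "skorohod_dist x y \<le> e"
proof -
  have "e \<in> skorohod_bounds x y" unfolding skorohod_bounds_def using assms(3-6) by blast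
  then show ?thesis
    using assms(1,2) skorohod_bounds_bdd_below by (simp add: skorohod_dist_def cInf_lower)
qed

lemma skorohod_dist_zero_imp_eq:
  assumes x: "x \<in> D01" and y: "y \<in> D01" and 0: "skorohod_dist x y = 0"
  shows "x = y"
proof
  fix t
  have less1: "x t = y t" if t: "0 \<le> t" "t < 1"
  proof (rule ccontr)
    assume "x t \<noteq> y t"
    define e where "e = \<bar>x t - y t\<bar> / 3"
    have e: "e > 0" using \<open>x t \<noteq> y t\<close> by (simp add: e_def)
    have "(x \<longlongrightarrow> x t) (at_right t)" "(y \<longlongrightarrow> y t) (at_right t)"
      using x y t by (auto simp: D01_def)
    then have "eventually (\<lambda>s. dist (x s) (x t) < e) (at_right t)"
        "eventually (\<lambda>s. dist (y s) (y t) < e) (at_right t)"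
      using e by (auto dest: tendstoD)
    then obtain b c where b: "b > t" "\<And>s. t < s \<Longrightarrow> s < b \<Longrightarrow> dist (x s) (x t) < e"
      and c: "c > t" "\<And>s. t < s \<Longrightarrow> s < c \<Longrightarrow> dist (y s) (y t) < e"
      by (auto simp: eventually_at_right_field)
    define d where "d = Min {b, c, 1} - t"
    define s where "s = t + d / 2"
    have d: "d > 0" "t + d \<le> b" "t + d \<le> c" "t + d \<le> 1"
      using b(1) c(1) t by (auto simp: d_def)
    have s: "s \<in> {0..1}" using d t by (auto simp: s_def)
    have "skorohod_dist x y < min e (d / 2)" using e d 0 by simp
    then obtain l where l: "\<And>t. t \<in> {0..1} \<Longrightarrow> \<bar>l t - t\<bar> < min e (d / 2)"
        "\<And>t. t \<in> {0..1} \<Longrightarrow> \<bar>x t - y (l t)\<bar> < min e (d / 2)"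
      using skorohod_dist_less[OF x y] by metis
    have "\<bar>l s - s\<bar> < d / 2" "\<bar>x s - y (l s)\<bar> < e" using l s by auto
    moreover from this have "dist (y (l s)) (y t) < e"
      using d by (intro c(2)) (simp_all only: s_def abs_less_iff, linarith+)
    moreover have "dist (x s) (x t) < e"
      using d by (intro b(2)) (auto simp: s_def)
    ultimately have "\<bar>x t - y t\<bar> < 3 * e" by (auto simp: dist_real_def)
    then show False by (simp add: e_def)
  qed
  have at1: "x 1 = y 1"
  proof (rule ccontr)
    assume "x 1 \<noteq> y 1"
    then have "skorohod_dist x y < \<bar>x 1 - y 1\<bar>" using 0 by simp
    then obtain l where l: "l \<in> time_changes"
        "\<And>t. t \<in> {0..1} \<Longrightarrow> \<bar>x t - y (l t)\<bar> < \<bar>x 1 - y 1\<bar>"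
      using skorohod_dist_less[OF x y] by metis
    have "l 1 = 1"
    proof (rule antisym)
      show "l 1 \<le> 1" using l(1) by (force simp: time_changes_def)
      obtain u where u: "u \<in> {0..1}" "l u = 1"
      proof -
        have "1 \<in> l ` {0..1}" using l(1) by (simp add: time_changes_def)
        then show ?thesis using that by force
      qed
      have "strict_mono_on {0..1} l" using l(1) by (simp add: time_changes_def)
      then show "1 \<le> l 1" using u strict_mono_on_leD[of "{0..1}" l u 1] by auto
    qed
    then show False using l(2)[of 1] by simp
  qed
  show "x t = y t"
  proof (cases "t \<in> {0..1}")
    case True
    then show ?thesis using less1 at1 by (cases "t = 1") auto
  next
    case False
    then have "x t = undefined" "y t = undefined"
      using x y by (auto simp: D01_def extensional_def)
    then show ?thesis by simp
  qed
qed

global_interpretation skorohod: Metric_space D01 skorohod_dist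
proof
  fix x y :: "real \<Rightarrow> real"
  show "0 \<le> skorohod_dist x y" by (rule skorohod_dist_nonneg)
  show "skorohod_dist x y = skorohod_dist y x"
    using skorohod_bounds_sym[of x y] skorohod_bounds_sym[of y x]
    by (auto simp: skorohod_dist_def)
next
  fix x y assume xy: "x \<in> D01" "y \<in> D01"
  have "skorohod_dist x x \<le> 0"
    by (rule skorohod_dist_le[OF _ _ _ time_changes_id]) (use xy in auto)
  then show "(skorohod_dist x y = 0) = (x = y)"
    using skorohod_dist_nonneg[of x x] skorohod_dist_zero_imp_eq[OF xy] by force
next
  fix x y z assume xyz: "x \<in> D01" "y \<in> D01" "z \<in> D01"
  show "skorohod_dist x z \<le> skorohod_dist x y + skorohod_dist y z"
  proof (rule field_le_epsilon)
    fix e :: real assume e: "e > 0"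
    define a where "a = skorohod_dist x y + e / 2"
    define b where "b = skorohod_dist y z + e / 2"
    have "skorohod_dist x y < a" "skorohod_dist y z < b" using e by (auto simp: a_def b_def)
    from skorohod_dist_less[OF xyz(1,2) this(1)] skorohod_dist_less[OF xyz(2,3) this(2)]
    obtain l k where l: "l \<in> time_changes"
        "\<And>t. t \<in> {0..1} \<Longrightarrow> \<bar>l t - t\<bar> < a" "\<And>t. t \<in> {0..1} \<Longrightarrow> \<bar>x t - y (l t)\<bar> < a"
      and k: "k \<in> time_changes"
        "\<And>t. t \<in> {0..1} \<Longrightarrow> \<bar>k t - t\<bar> < b" "\<And>t. t \<in> {0..1} \<Longrightarrow> \<bar>y t - z (k t)\<bar> < b"
      by metis
    have lin: "l t \<in> {0..1}" if "t \<in> {0..1}" for t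
      using l(1) that by (auto simp: time_changes_def)
    have "skorohod_dist x z \<le> a + b"
    proof (rule skorohod_dist_le[OF xyz(1,3) _ time_changes_comp[OF l(1) k(1)]])
      show "0 \<le> a + b" using e skorohod_dist_nonneg[of x y] skorohod_dist_nonneg[of y z]
        by (simp add: a_def b_def)
    next
      fix t :: real assume t: "t \<in> {0..1}"
      show "\<bar>k (l t) - t\<bar> \<le> a + b" using l(2)[OF t] k(2)[OF lin[OF t]] by linarith
      show "\<bar>x t - z (k (l t))\<bar> \<le> a + b" using l(3)[OF t] k(3)[OF lin[OF t]] by linarith
    qed
    then show "skorohod_dist x z \<le> skorohod_dist x y + skorohod_dist y z + e"
      by (simp add: a_def b_def)
  qed
qed

abbreviation skorohod_topology :: "(real \<Rightarrow> real) topology" where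
  "skorohod_topology \<equiv> skorohod.mtopology"

definition borel_of :: "'a topology \<Rightarrow> 'a measure" where
  "borel_of T = sigma (topspace T) {U. openin T U}"

definition weak_conv_on :: "'a topology \<Rightarrow> (nat \<Rightarrow> 'a measure) \<Rightarrow> 'a measure \<Rightarrow> bool" where
  "weak_conv_on T \<mu> \<nu> \<longleftrightarrow>
     (\<forall>f. continuous_map T euclideanreal f \<and> bounded (f ` topspace T) \<longrightarrow>
        (\<lambda>n. LINT x|\<mu> n. f x) \<longlonglongrightarrow> (LINT x|\<nu>. f x))"

text \<open>
  Measurability is demanded only eventually, so that finitely many initial terms of the sequence
  (such as a meaningless term of index 0) play no role.
\<close>

definition converges_in_distribution ::
    "'c topology \<Rightarrow> (nat \<Rightarrow> 'a measure) \<Rightarrow> (nat \<Rightarrow> 'a \<Rightarrow> 'c) \<Rightarrow> 'b measure \<Rightarrow> ('b \<Rightarrow> 'c) \<Rightarrow> bool" where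
  "converges_in_distribution T P X M Y \<longleftrightarrow>
     (\<forall>\<^sub>F n in sequentially. X n \<in> P n \<rightarrow>\<^sub>M borel_of T) \<and> Y \<in> M \<rightarrow>\<^sub>M borel_of T \<and>
     weak_conv_on T (\<lambda>n. distr (P n) (borel_of T) (X n)) (distr M (borel_of T) Y)"

text \<open>Brownian motion on the time interval \<open>[0,1]\<close>; only \<open>W t\<close> with \<open>0 \<le> t \<le> 1\<close> is constrained.\<close>

definition standard_brownian_motion :: "'a measure \<Rightarrow> (real \<Rightarrow> 'a \<Rightarrow> real) \<Rightarrow> bool" where
  "standard_brownian_motion M W \<longleftrightarrow>
     prob_space M \<and>
     (\<forall>t\<in>{0..1}. W t \<in> borel_measurable M) \<and>
     (AE \<omega> in M. W 0 \<omega> = 0) \<and>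
     (\<forall>k. \<forall>t :: nat \<Rightarrow> real.
        0 \<le> t 0 \<and> (\<forall>i<k. t i < t (Suc i)) \<and> t k \<le> 1 \<longrightarrow>
        prob_space.indep_vars M (\<lambda>_. borel) (\<lambda>i \<omega>. W (t (Suc i)) \<omega> - W (t i) \<omega>) {..<k}) \<and>
     (\<forall>s t. 0 \<le> s \<and> s < t \<and> t \<le> 1 \<longrightarrow>
        distributed M lborel (\<lambda>\<omega>. W t \<omega> - W s \<omega>) (normal_density 0 (sqrt (t - s)))) \<and>
     (\<forall>\<omega>\<in>space M. continuous_on {0..1} (\<lambda>t. W t \<omega>))"

definition num_parts_upto :: "nat \<Rightarrow> real \<Rightarrow> (nat \<Rightarrow> nat) \<Rightarrow> nat" where
  "num_parts_upto n t \<alpha> = (\<Sum>i=1..nat \<lfloor>real n powr t\<rfloor>. \<alpha> i)"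

definition parts_process :: "real \<Rightarrow> nat \<Rightarrow> (nat \<Rightarrow> nat) \<Rightarrow> (real \<Rightarrow> real)" where
  "parts_process \<theta> n \<alpha> = (\<lambda>t\<in>{0..1}.
     (real (num_parts_upto n t \<alpha>) - \<theta> * t * ln (real n)) / sqrt (\<theta> * ln (real n)))"

end

theory Submission
  imports Defs "HOL-Real_Asymp.Real_Asymp"
begin

text \<open>
  Under the Feller coupling, gaps between consecutive ones are the parts. With high probability every
  gap starting at \<open>j \<le> n\<close> is longer than \<open>j / c\<close>, where \<open>c\<close> is about \<open>(ln n)\<^sup>2\<close>; then the number of parts
  of size at most \<open>m\<close> lies, up to a constant, between the numbers of ones among the first \<open>m\<close> and the
  first \<open>c m\<close> positions. Since \<open>ln c\<close> is negligible against \<open>sqrt (ln n)\<close>, the process is uniformly close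
  to a normalised sum of independent centred indicators. For that sum, the central limit theorem on a
  grid of times and Ottaviani's maximal inequality give convergence to Brownian motion, and the limit
  is independent of any finite set of coordinates. The density \<open>\<eta>\<close> evaluated at the partition of \<open>n\<close>
  converges in \<open>L\<^sup>1\<close>, hence is close to its value for a fixed \<open>N\<close>, a function of the first \<open>N\<close>
  coordinates; so reweighting by \<open>\<eta>\<close> does not change the limit.
\<close>

section \<open>The Skorohod space\<close>

text \<open>The limit has continuous paths, so Skorohod distances are bounded by sup distances. One
  grid of \<open>k\<close> cells, fixed before \<open>n\<close> grows, serves both sides:
  \<open>W\<close> is uniformly near its step path for large \<open>k\<close>, and Ottaviani's
  inequality controls the discrete path inside the cells. That control must survive a union over
  \<open>k\<close> cells: a variance bound of order \<open>1/k\<close> per cell would not, but the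
  fourth moment of the Gaussian limit is of order \<open>1/k^2\<close>.

  Times are exponents. A one at position \<open>j\<close> has probability about
  \<open>\<theta>/j\<close>, so the block between \<open>n^(i/k)\<close> and
  \<open>n^((i+1)/k)\<close> contributes mean and variance about \<open>\<theta> (ln n)/k\<close>,
  and multiplying a position by \<open>c\<close> shifts time by \<open>ln c / ln n\<close>,
  eventually at most one cell.

  The density at size \<open>n\<close> involves all \<open>n\<close> positions and cannot be
  separated from the path. At a fixed \<open>N\<close> it can: skipping the first \<open>N\<close>
  positions changes the sums by at most \<open>N\<close>, which vanishes after normalisation.
  Expectations under the perturbed measure are quotients of expectations under the coupling, and
  positivity of the mean of the limiting density keeps the denominators away from 0.\<close>

lemma sets_borel_of: "sets (borel_of T) = sigma_sets (topspace T) {U. openin T U}"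
  unfolding borel_of_def by (rule sets_measure_of) (auto dest: openin_subset)

lemma space_borel_of [simp]: "space (borel_of T) = topspace T"
  unfolding borel_of_def by (rule space_measure_of) (auto dest: openin_subset)

lemma measurable_continuous_map_borel_of:
  assumes "continuous_map T euclideanreal f"
  shows "f \<in> borel_measurable (borel_of T)"
proof (rule borel_measurableI)
  fix S :: "real set" assume "open S"
  then have "openin T {x \<in> topspace T. f x \<in> S}"
    using assms by (auto simp: continuous_map_def)
  moreover have "f -` S \<inter> space (borel_of T) = {x \<in> topspace T. f x \<in> S}" by auto
  ultimately show "f -` S \<inter> space (borel_of T) \<in> sets (borel_of T)"
    by (auto simp: sets_borel_of)
qed

section \<open>Test functions and Borel measurability in metric spaces\<close>

context Metric_space
begin

lemma continuous_map_real_iff: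
  "continuous_map mtopology euclideanreal f \<longleftrightarrow>
    (\<forall>x\<in>M. \<forall>e>0. \<exists>r>0. \<forall>y\<in>M. d x y < r \<longrightarrow> \<bar>f y - f x\<bar> < e)"
proof
  assume c: "continuous_map mtopology euclideanreal f"
  show "\<forall>x\<in>M. \<forall>e>0. \<exists>r>0. \<forall>y\<in>M. d x y < r \<longrightarrow> \<bar>f y - f x\<bar> < e"
  proof (intro ballI allI impI)
    fix x and e :: real assume x: "x \<in> M" "e > 0"
    have "openin mtopology {y \<in> topspace mtopology. f y \<in> ball (f x) e}"
      using c by (auto simp: continuous_map_def)
    moreover have "x \<in> {y \<in> topspace mtopology. f y \<in> ball (f x) e}" using x by auto
    ultimately obtain r where "r > 0" "mball x r \<subseteq> {y \<in> topspace mtopology. f y \<in> ball (f x) e}"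
      unfolding openin_mtopology by blast
    then show "\<exists>r>0. \<forall>y\<in>M. d x y < r \<longrightarrow> \<bar>f y - f x\<bar> < e"
      using x by (intro exI[of _ r]) (auto simp: subset_iff dist_real_def abs_minus_commute)
  qed
next
  assume r: "\<forall>x\<in>M. \<forall>e>0. \<exists>r>0. \<forall>y\<in>M. d x y < r \<longrightarrow> \<bar>f y - f x\<bar> < e"
  show "continuous_map mtopology euclideanreal f"
    unfolding continuous_map_def
  proof (intro conjI allI impI)
    fix U :: "real set" assume "openin euclideanreal U"
    then have U: "open U" by simp
    show "openin mtopology {x \<in> topspace mtopology. f x \<in> U}"
      unfolding openin_mtopology
    proof (intro conjI allI impI)
      fix x assume x: "x \<in> {x \<in> topspace mtopology. f x \<in> U}"
      then obtain e where e: "e > 0" "ball (f x) e \<subseteq> U" using U by (auto simp: open_contains_ball)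
      obtain s where "s > 0" "\<forall>y\<in>M. d x y < s \<longrightarrow> \<bar>f y - f x\<bar> < e" using r x e(1) by force
      then show "\<exists>r>0. mball x r \<subseteq> {x \<in> topspace mtopology. f x \<in> U}"
        using e(2) by (intro exI[of _ s]) (auto simp: subset_iff dist_real_def abs_minus_commute)
    qed auto
  qed auto
qed

lemma continuous_map_Lipschitz_real:
  assumes "\<And>x y. x \<in> M \<Longrightarrow> y \<in> M \<Longrightarrow> \<bar>f x - f y\<bar> \<le> K * d x y"
  shows "continuous_map mtopology euclideanreal f"
  unfolding continuous_map_real_iff
proof (intro ballI allI impI)
  fix x and e :: real assume x: "x \<in> M" "e > 0"
  show "\<exists>r>0. \<forall>y\<in>M. d x y < r \<longrightarrow> \<bar>f y - f x\<bar> < e"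
  proof (intro exI[of _ "e / (\<bar>K\<bar> + 1)"] conjI ballI impI)
    show "e / (\<bar>K\<bar> + 1) > 0" using x by simp
    fix y assume y: "y \<in> M" "d x y < e / (\<bar>K\<bar> + 1)"
    have "\<bar>f y - f x\<bar> \<le> K * d y x" using assms x y by blast
    also have "\<dots> \<le> (\<bar>K\<bar> + 1) * d x y" 
      using nonneg[of x y] by (intro mult_mono) (auto simp: commute)
    also have "\<dots> < e" using y by (simp add: field_simps)
    finally show "\<bar>f y - f x\<bar> < e" .
  qed
qed

text \<open>Lipschitz functions increase to a continuous one through the inf-convolutions
  \<open>x \<mapsto> inf\<^sub>y (f y + j d(x,y))\<close>, so the liminf half of the portmanteau argument applies to \<open>f\<close> and \<open>- f\<close>.\<close>

lemma Lipschitz_approx_below: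
  assumes c: "continuous_map mtopology euclideanreal f" and B: "\<And>x. x \<in> M \<Longrightarrow> \<bar>f x\<bar> \<le> B"
  obtains g :: "nat \<Rightarrow> 'a \<Rightarrow> real" where
    "\<And>j x y. x \<in> M \<Longrightarrow> y \<in> M \<Longrightarrow> \<bar>g j x - g j y\<bar> \<le> real j * d x y"
    "\<And>j x. x \<in> M \<Longrightarrow> \<bar>g j x\<bar> \<le> B"
    "\<And>j x. x \<in> M \<Longrightarrow> g j x \<le> f x"
    "\<And>x. x \<in> M \<Longrightarrow> (\<lambda>j. g j x) \<longlonglongrightarrow> f x"
proof -
  define g where "g j x = (INF y\<in>M. f y + real j * d x y)" for j :: nat and x
  have bdd: "bdd_below ((\<lambda>y. f y + real j * d x y) ` M)" for j :: nat and x
  proof (intro bdd_belowI2[of _ "-B"])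
    fix y assume "y \<in> M"
    then show "- B \<le> f y + real j * d x y"
      using B[of y] mult_nonneg_nonneg[OF of_nat_0_le_iff nonneg, of j x y] by linarith
  qed
  have le: "g j x \<le> f y + real j * d x y" if "y \<in> M" for j x y
    unfolding g_def by (intro cINF_lower bdd that)
  have ge: "c \<le> g j x" if "\<And>y. y \<in> M \<Longrightarrow> c \<le> f y + real j * d x y" "x \<in> M" for j x c
    unfolding g_def using that by (intro cINF_greatest) auto
  have gf: "g j x \<le> f x" if "x \<in> M" for j x using le[of x j x] that by simp
  have gB: "-B \<le> g j x" if "x \<in> M" for j x
  proof (rule ge[OF _ that])
    fix y assume "y \<in> M"
    then show "- B \<le> f y + real j * d x y"
      using B[of y] mult_nonneg_nonneg[OF of_nat_0_le_iff nonneg, of j x y] by linarith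
  qed
  have half: "g j x - real j * d x z \<le> g j z" if xz: "x \<in> M" "z \<in> M" for j x z
  proof (rule ge[OF _ xz(2)])
    fix y assume y: "y \<in> M"
    have "g j x \<le> f y + real j * d x y" by (rule le[OF y])
    also have "\<dots> \<le> f y + real j * (d x z + d z y)"
      using triangle[OF xz(1,2) y] by (intro add_left_mono mult_left_mono) auto
    finally show "g j x - real j * d x z \<le> f y + real j * d z y" by (simp add: algebra_simps)
  qed
  show ?thesis
  proof (rule that[of g])
    show "\<bar>g j x - g j y\<bar> \<le> real j * d x y" if "x \<in> M" "y \<in> M" for j x y
      using half[OF that, of j] half[OF that(2,1), of j] by (auto simp: commute)
    show "\<bar>g j x\<bar> \<le> B" if "x \<in> M" for j x
      using gf[OF that, of j] gB[OF that, of j] B[OF that] by auto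
    show "g j x \<le> f x" if "x \<in> M" for j x by (rule gf[OF that])
    show "(\<lambda>j. g j x) \<longlonglongrightarrow> f x" if x: "x \<in> M" for x
    proof (rule LIMSEQ_I)
      fix e :: real assume e: "e > 0"
      obtain r where r: "r > 0" "\<And>y. y \<in> M \<Longrightarrow> d x y < r \<Longrightarrow> \<bar>f y - f x\<bar> < e / 2"
        using c x e unfolding continuous_map_real_iff by (metis half_gt_zero)
      \<comment> \<open>At distance at least \<open>r\<close> the penalty \<open>j * r\<close> is at
        least \<open>2 * B\<close>, the largest possible drop of \<open>f\<close>, so only points
        near \<open>x\<close> compete in the infimum.\<close>
      obtain j0 :: nat where j0: "real j0 > 2 * B / r" using reals_Archimedean2 by blast
      show "\<exists>no. \<forall>n\<ge>no. norm (g n x - f x) < e"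
      proof (intro exI[of _ j0] allI impI)
        fix j assume j: "j \<ge> j0"
        have "f x - e / 2 \<le> g j x"
        proof (rule ge[OF _ x])
          fix y assume y: "y \<in> M"
          show "f x - e / 2 \<le> f y + real j * d x y"
          proof (cases "d x y < r")
            case True
            then show ?thesis using r(2)[OF y True] mult_nonneg_nonneg[OF of_nat_0_le_iff nonneg, of j x y]
              by linarith
          next
            case False
            have "2 * B \<le> real j0 * r" using j0 r(1) by (simp add: field_simps)
            also have "\<dots> \<le> real j * d x y" using False j r(1) by (intro mult_mono) auto
            finally show ?thesis using B[OF x] B[OF y] e by linarith
          qed
        qed
        then show "norm (g j x - f x) < e" using gf[OF x, of j] e by auto
      qed
    qed
  qed
qed

text \<open>Reduces the main convergence to bounded Lipschitz test functions, for which a uniform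
  bound on path distances turns directly into a bound on expectations. A single minorant
  \<open>g j\<close> whose \<open>\<nu>\<close>-integral is within \<open>e\<close> of that of
  \<open>f\<close> gives the lower bound; \<open>- f\<close> gives the upper one.\<close>

lemma weak_conv_on_Lipschitz:
  assumes \<mu>: "\<forall>\<^sub>F n in sequentially. prob_space (\<mu> n) \<and> sets (\<mu> n) = sets (borel_of mtopology)"
    and \<nu>: "prob_space \<nu>" "sets \<nu> = sets (borel_of mtopology)"
    and L: "\<And>f B K. (\<And>x. x \<in> M \<Longrightarrow> \<bar>f x\<bar> \<le> B) \<Longrightarrow>
      (\<And>x y. x \<in> M \<Longrightarrow> y \<in> M \<Longrightarrow> \<bar>f x - f y\<bar> \<le> K * d x y) \<Longrightarrow>
      (\<lambda>n. LINT x|\<mu> n. f x) \<longlonglongrightarrow> (LINT x|\<nu>. f x)"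
  shows "weak_conv_on mtopology \<mu> \<nu>"
proof -
  interpret \<nu>: prob_space \<nu> by fact
  have sp: "space N = M" if "sets N = sets (borel_of mtopology)" for N
    using sets_eq_imp_space_eq[OF that] by simp
  have meas: "f \<in> borel_measurable N"
    if "sets N = sets (borel_of mtopology)" "continuous_map mtopology euclideanreal f" for f :: "'a \<Rightarrow> real" and N
    using measurable_continuous_map_borel_of[OF that(2)] measurable_cong_sets[OF that(1) refl] by blast
  have low: "\<forall>\<^sub>F n in sequentially. (LINT x|\<mu> n. f x) > (LINT x|\<nu>. f x) - e"
    if c: "continuous_map mtopology euclideanreal f" and B: "\<And>x. x \<in> M \<Longrightarrow> \<bar>f x\<bar> \<le> B" and e: "e > 0"
    for f B e
  proof -
    obtain g :: "nat \<Rightarrow> 'a \<Rightarrow> real" where g: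
      "\<And>j x y. x \<in> M \<Longrightarrow> y \<in> M \<Longrightarrow> \<bar>g j x - g j y\<bar> \<le> real j * d x y"
      "\<And>j x. x \<in> M \<Longrightarrow> \<bar>g j x\<bar> \<le> B"
      "\<And>j x. x \<in> M \<Longrightarrow> g j x \<le> f x"
      "\<And>x. x \<in> M \<Longrightarrow> (\<lambda>j. g j x) \<longlonglongrightarrow> f x"
      using Lipschitz_approx_below[OF c B] by blast
    have gm: "g j \<in> borel_measurable N" if "sets N = sets (borel_of mtopology)" for j N
      using g(1) by (intro meas[OF that] continuous_map_Lipschitz_real) blast
    have "(\<lambda>j. LINT x|\<nu>. g j x) \<longlonglongrightarrow> (LINT x|\<nu>. f x)"
      by (rule integral_dominated_convergence[where w = "\<lambda>_. B"])
        (use g c \<nu> gm meas sp[OF \<nu>(2)] in auto)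
    then have "\<forall>\<^sub>F j in sequentially. (LINT x|\<nu>. g j x) > (LINT x|\<nu>. f x) - e"
      using e by (intro order_tendstoD) auto
    then obtain j where j: "(LINT x|\<nu>. g j x) > (LINT x|\<nu>. f x) - e"
      by (auto simp: eventually_sequentially)
    have "(\<lambda>n. LINT x|\<mu> n. g j x) \<longlonglongrightarrow> (LINT x|\<nu>. g j x)"
      using g by (intro L[of "g j" B "real j"]) auto
    then have "\<forall>\<^sub>F n in sequentially. (LINT x|\<mu> n. g j x) > (LINT x|\<nu>. f x) - e"
      using j by (intro order_tendstoD) auto
    with \<mu> show ?thesis
    proof eventually_elim
      case (elim n)
      then interpret \<mu>: prob_space "\<mu> n" by blast
      have s: "space (\<mu> n) = M" using elim sp by blast
      have "(LINT x|\<mu> n. g j x) \<le> (LINT x|\<mu> n. f x)"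
        by (rule integral_mono)
          (use elim g B s c in \<open>auto intro!: \<mu>.integrable_const_bound[where B = B] AE_I2 gm meas\<close>)
      then show ?case using elim by simp
    qed
  qed
  show ?thesis
    unfolding weak_conv_on_def
  proof (intro allI impI)
    fix f assume f: "continuous_map mtopology euclideanreal f \<and> bounded (f ` topspace mtopology)"
    then obtain B where B: "\<And>x. x \<in> M \<Longrightarrow> \<bar>f x\<bar> \<le> B" by (auto simp: bounded_iff)
    have neg: "continuous_map mtopology euclideanreal (\<lambda>x. - f x)" using f by (auto intro: continuous_map_minus)
    show "(\<lambda>n. LINT x|\<mu> n. f x) \<longlonglongrightarrow> (LINT x|\<nu>. f x)"
    proof (rule tendstoI)
      fix e :: real assume e: "e > 0"
      have "\<forall>\<^sub>F n in sequentially. (LINT x|\<mu> n. f x) > (LINT x|\<nu>. f x) - e"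
        using low[of f B] f B e by blast
      moreover have "\<forall>\<^sub>F n in sequentially. (LINT x|\<mu> n. - f x) > (LINT x|\<nu>. - f x) - e"
        using low[of "\<lambda>x. - f x" B e] neg B e by simp
      ultimately show "\<forall>\<^sub>F n in sequentially. dist (LINT x|\<mu> n. f x) (LINT x|\<nu>. f x) < e"
        by eventually_elim (auto simp: dist_real_def abs_less_iff)
    qed
  qed
qed

text \<open>An open set is \<open>{x. 0 < min 1 (dist x (- U))}\<close>, the infimum below being that distance.\<close>

lemma measurable_borel_of_limit:
  assumes X: "\<And>\<omega>. \<omega> \<in> space N \<Longrightarrow> X \<omega> \<in> M"
    and Xk: "\<And>k \<omega>. \<omega> \<in> space N \<Longrightarrow> Xk k \<omega> \<in> M"
    and lim: "\<And>\<omega>. \<omega> \<in> space N \<Longrightarrow> (\<lambda>k. d (Xk k \<omega>) (X \<omega>)) \<longlonglongrightarrow> 0"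
    and meas: "\<And>f k. (\<And>x y. x \<in> M \<Longrightarrow> y \<in> M \<Longrightarrow> \<bar>f x - f y\<bar> \<le> d x y) \<Longrightarrow>
      (\<lambda>\<omega>. f (Xk k \<omega>)) \<in> borel_measurable N"
  shows "X \<in> N \<rightarrow>\<^sub>M borel_of mtopology"
  unfolding borel_of_def
proof (rule measurable_measure_of)
  show "X \<in> space N \<rightarrow> topspace mtopology" using X by auto
  fix U assume "U \<in> {U. openin mtopology U}"
  then have U: "openin mtopology U" by simp
  \<comment> \<open>\<open>None\<close> contributes the constant 1; it caps the distance and keeps
    the infimum over a nonempty set when \<open>U\<close> is the whole space.\<close>
  define f where "f x = (INF y\<in>insert None (Some ` (M - U)). case y of None \<Rightarrow> 1 | Some y \<Rightarrow> d x y)" for x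
  have bdd: "bdd_below ((\<lambda>y. case y of None \<Rightarrow> 1 | Some y \<Rightarrow> d x y) ` insert None (Some ` (M - U)))" for x
    by (intro bdd_belowI2[of _ 0]) (auto split: option.split)
  have f1: "f x \<le> 1" for x
    unfolding f_def by (rule cINF_lower2[OF bdd, of None]) auto
  have fd: "f x \<le> d x y" if "y \<in> M" "y \<notin> U" for x y
    unfolding f_def by (rule cINF_lower2[OF bdd, of "Some y"]) (use that in auto)
  have fge: "c \<le> f x" if "c \<le> 1" "\<And>y. y \<in> M \<Longrightarrow> y \<notin> U \<Longrightarrow> c \<le> d x y" for c x
    unfolding f_def using that by (intro cINF_greatest) (auto split: option.split)
  have half: "f x - d x z \<le> f z" if "x \<in> M" "z \<in> M" for x z
  proof (rule fge)
    show "f x - d x z \<le> 1" using f1[of x] nonneg[of x z] by linarith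
    fix y assume "y \<in> M" "y \<notin> U"
    then show "f x - d x z \<le> d z y" using fd[of y x] triangle[of x z y] that by linarith
  qed
  have lip: "\<bar>f x - f y\<bar> \<le> d x y" if "x \<in> M" "y \<in> M" for x y
    using half[OF that] half[OF that(2,1)] by (auto simp: commute)
  have pos: "x \<in> U \<longleftrightarrow> f x > 0" if x: "x \<in> M" for x
  proof
    assume "x \<in> U"
    then obtain r where r: "r > 0" "mball x r \<subseteq> U" using U unfolding openin_mtopology by blast
    have "min 1 r \<le> f x" 
    proof (rule fge)
      fix y assume "y \<in> M" "y \<notin> U"
      then have "\<not> d x y < r" using r x by auto
      then show "min 1 r \<le> d x y" by simp
    qed simp
    then show "f x > 0" using r by simp
  next
    assume "f x > 0"
    then show "x \<in> U" using fd[of x x] x by force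
  qed
  have "(\<lambda>k. f (Xk k \<omega>)) \<longlonglongrightarrow> f (X \<omega>)" if "\<omega> \<in> space N" for \<omega>
  proof -
    have "(\<lambda>k. f (Xk k \<omega>) - f (X \<omega>)) \<longlonglongrightarrow> 0"
      by (rule Lim_null_comparison[OF _ lim[OF that]]) (use lip X[OF that] Xk[OF that] in auto)
    then show ?thesis by (simp add: LIM_zero_iff)
  qed
  then have "(\<lambda>\<omega>. f (X \<omega>)) \<in> borel_measurable N"
    by (rule borel_measurable_LIMSEQ_real) (use meas[of f] lip in auto)
  then have "{\<omega> \<in> space N. f (X \<omega>) > 0} \<in> sets N" by measurable
  also have "{\<omega> \<in> space N. f (X \<omega>) > 0} = X -` U \<inter> space N" using pos X by auto
  finally show "X -` U \<inter> space N \<in> sets N" .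
qed (use openin_subset in blast)

end

section \<open>Cadlag paths and step paths\<close>

lemma D01_continuous:
  assumes "continuous_on {0..1} w"
  shows "(\<lambda>t\<in>{0..1}. w t) \<in> D01"
proof -
  define x where "x = (\<lambda>t\<in>{0..1}. w t)"
  have x: "continuous_on {0..1} x"
    using assms by (rule continuous_on_eq) (simp add: x_def)
  have "(x \<longlongrightarrow> x t) (at_right t)" if "0 \<le> t" "t < 1" for t
    using continuous_on_Icc_at_rightD[OF continuous_on_subset[OF x, of "{t..1}"]] that by auto
  moreover have "(x \<longlongrightarrow> x t) (at_left t)" if "0 < t" "t \<le> 1" for t
    using continuous_on_Icc_at_leftD[OF continuous_on_subset[OF x, of "{0..t}"]] that by auto
  ultimately show ?thesis
    unfolding D01_def x_def[symmetric] by (auto simp: x_def)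
qed

text \<open>A common source of the paths of \<open>parts_process\<close> (\<open>g t\<close> a power
  of \<open>n\<close>) and of \<open>step_path\<close> (\<open>g t = k * t\<close>). Just right of
  \<open>t\<close> the floor of \<open>g\<close> is unchanged; just left of \<open>t\<close> it is
  the ceiling of \<open>g t\<close> minus 1, which also covers an integer value
  \<open>g t\<close>.\<close>

lemma D01_floor:
  fixes g u :: "real \<Rightarrow> real" and h :: "int \<Rightarrow> real"
  assumes g: "continuous_on UNIV g" "strict_mono g" and u: "continuous_on UNIV u"
  shows "(\<lambda>t\<in>{0..1}. h \<lfloor>g t\<rfloor> + u t) \<in> D01"
proof -
  have gt: "(g \<longlongrightarrow> g t) (at t within S)" and ut: "(u \<longlongrightarrow> u t) (at t within S)" for t S
    using g(1) u by (auto simp: continuous_on_def intro: tendsto_within_subset)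
  have R: "((\<lambda>t\<in>{0..1}. h \<lfloor>g t\<rfloor> + u t) \<longlongrightarrow> h \<lfloor>g t\<rfloor> + u t) (at_right t)" if t: "0 \<le> t" "t < 1" for t
  proof -
    have "((\<lambda>s. h \<lfloor>g t\<rfloor> + u s) \<longlongrightarrow> h \<lfloor>g t\<rfloor> + u t) (at_right t)" by (intro tendsto_intros ut)
    moreover have "\<forall>\<^sub>F s in at_right t. h \<lfloor>g t\<rfloor> + u s = (\<lambda>t\<in>{0..1}. h \<lfloor>g t\<rfloor> + u t) s"
    proof -
      have "\<forall>\<^sub>F s in at_right t. g s < of_int (\<lfloor>g t\<rfloor> + 1)"
        by (rule order_tendstoD[OF gt]) linarith
      moreover have "\<forall>\<^sub>F s in at_right t. s > t" by (rule eventually_at_right_less)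
      moreover have "\<forall>\<^sub>F s in at_right t. s < 1" 
        unfolding eventually_at_right_field using t by (intro exI[of _ 1]) auto
      ultimately show ?thesis
      proof eventually_elim
        case (elim s)
        then have "\<lfloor>g s\<rfloor> = \<lfloor>g t\<rfloor>" using strict_monoD[OF g(2), of t s] by linarith
        then show ?case using elim t by simp
      qed
    qed
    ultimately show ?thesis by (rule Lim_transform_eventually)
  qed
  have L: "((\<lambda>t\<in>{0..1}. h \<lfloor>g t\<rfloor> + u t) \<longlongrightarrow> h (\<lceil>g t\<rceil> - 1) + u t) (at_left t)" if t: "0 < t" "t \<le> 1" for t
  proof -
    have "((\<lambda>s. h (\<lceil>g t\<rceil> - 1) + u s) \<longlongrightarrow> h (\<lceil>g t\<rceil> - 1) + u t) (at_left t)" by (intro tendsto_intros ut)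
    moreover have "\<forall>\<^sub>F s in at_left t. h (\<lceil>g t\<rceil> - 1) + u s = (\<lambda>t\<in>{0..1}. h \<lfloor>g t\<rfloor> + u t) s"
    proof -
      have "\<forall>\<^sub>F s in at_left t. g s > of_int (\<lceil>g t\<rceil> - 1)"
        by (rule order_tendstoD[OF gt]) linarith
      moreover have "\<forall>\<^sub>F s in at_left t. s < t \<and> s > 0"
        unfolding eventually_at_left_field using t by (intro exI[of _ 0]) auto
      ultimately show ?thesis
      proof eventually_elim
        case (elim s)
        then have "\<lfloor>g s\<rfloor> = \<lceil>g t\<rceil> - 1" using strict_monoD[OF g(2), of s t] by linarith
        then show ?case using elim t by simp
      qed
    qed
    ultimately show ?thesis by (rule Lim_transform_eventually)
  qed
  show ?thesis
    unfolding D01_def using R L by fastforce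
qed

lemma skorohod_dist_le_sup:
  assumes "x \<in> D01" "y \<in> D01" "0 \<le> e" "\<And>t. t \<in> {0..1} \<Longrightarrow> \<bar>x t - y t\<bar> \<le> e"
  shows "skorohod_dist x y \<le> e"
  using skorohod_dist_le[OF assms(1-3) time_changes_id] assms(3,4) by simp

text \<open>\<open>z i\<close> is the value on \<open>[i/k, (i+1)/k)\<close> for
  \<open>i < k\<close>, and \<open>z k\<close> is used only at time 1; hence the
  \<open>k + 1\<close> values in the estimates below.\<close>

definition step_path :: "nat \<Rightarrow> (nat \<Rightarrow> real) \<Rightarrow> real \<Rightarrow> real" where
  "step_path k z = (\<lambda>t\<in>{0..1}. z (nat \<lfloor>real k * t\<rfloor>))"

lemma nat_floor_mult_le:
  assumes "t \<le> 1"
  shows "nat \<lfloor>real k * t\<rfloor> \<le> k"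
proof -
  have "real k * t \<le> real k" using assms by (simp add: mult_left_le)
  then show ?thesis by linarith
qed

lemma step_path_D01:
  assumes "k > 0"
  shows "step_path k z \<in> D01"
  using D01_floor[of "\<lambda>t. real k * t" "\<lambda>_. 0" "\<lambda>j. z (nat j)"] assms
  by (simp add: step_path_def strict_mono_def continuous_intros)

lemma step_path_cong:
  assumes "\<And>i. i \<le> k \<Longrightarrow> z i = z' i"
  shows "step_path k z = step_path k z'"
  using assms nat_floor_mult_le by (auto simp: step_path_def fun_eq_iff)

lemma Lipschitz_step_path:
  assumes k: "k > 0" and f: "\<And>x y. x \<in> D01 \<Longrightarrow> y \<in> D01 \<Longrightarrow> \<bar>f x - f y\<bar> \<le> K * skorohod_dist x y"
    and K: "K \<ge> 0"
  shows "\<bar>f (step_path k z) - f (step_path k z')\<bar> \<le> K * (\<Sum>i\<le>k. \<bar>z i - z' i\<bar>)"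
proof -
  have "\<bar>step_path k z t - step_path k z' t\<bar> \<le> (\<Sum>i\<le>k. \<bar>z i - z' i\<bar>)" if "t \<in> {0..1}" for t
    using that nat_floor_mult_le[of t k]
      member_le_sum[of "nat \<lfloor>real k * t\<rfloor>" "{..k}" "\<lambda>i. \<bar>z i - z' i\<bar>"]
    by (simp add: step_path_def)
  then have "skorohod_dist (step_path k z) (step_path k z') \<le> (\<Sum>i\<le>k. \<bar>z i - z' i\<bar>)"
    by (intro skorohod_dist_le_sup step_path_D01 k sum_nonneg) auto
  then show ?thesis using f[OF step_path_D01[OF k] step_path_D01[OF k], of z z'] K
    by (meson mult_left_mono order_trans)
qed

lemma tendsto_step_path:
  assumes k: "k > 0" and f: "\<And>x y. x \<in> D01 \<Longrightarrow> y \<in> D01 \<Longrightarrow> \<bar>f x - f y\<bar> \<le> K * skorohod_dist x y"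
    and K: "K \<ge> 0" and z: "\<And>i. i \<le> k \<Longrightarrow> ((\<lambda>n. z n i) \<longlongrightarrow> z' i) F"
  shows "((\<lambda>n. f (step_path k (z n))) \<longlongrightarrow> f (step_path k z')) F"
proof -
  have "((\<lambda>n. K * (\<Sum>i\<le>k. \<bar>z n i - z' i\<bar>)) \<longlongrightarrow> K * (\<Sum>i\<le>k. \<bar>z' i - z' i\<bar>)) F"
    by (intro tendsto_intros z) auto
  then have "((\<lambda>n. K * (\<Sum>i\<le>k. \<bar>z n i - z' i\<bar>)) \<longlongrightarrow> 0) F" by simp
  then have "((\<lambda>n. f (step_path k (z n)) - f (step_path k z')) \<longlongrightarrow> 0) F"
    by (rule Lim_null_comparison[rotated])
      (use Lipschitz_step_path[OF k f K] in \<open>auto intro!: always_eventually\<close>)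
  then show ?thesis by (simp add: LIM_zero_iff)
qed

text \<open>For fixed \<open>k\<close>, \<open>f\<close> of a step path is a continuous function of
  finitely many real values, so measurability comes from the product space of reals rather than from
  the Skorohod Borel sets.\<close>

lemma measurable_step_path:
  assumes k: "k > 0" and f: "\<And>x y. x \<in> D01 \<Longrightarrow> y \<in> D01 \<Longrightarrow> \<bar>f x - f y\<bar> \<le> K * skorohod_dist x y"
    and K: "K \<ge> 0" and z: "\<And>i. i \<le> k \<Longrightarrow> (\<lambda>\<omega>. z \<omega> i) \<in> borel_measurable N"
  shows "(\<lambda>\<omega>. f (step_path k (z \<omega>))) \<in> borel_measurable N"
proof -
  have "continuous_on UNIV (\<lambda>z. f (step_path k z))"
    unfolding continuous_on_def
  proof (intro ballI tendsto_step_path[OF k f K])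
    fix z :: "nat \<Rightarrow> real" and i
    have "continuous_on UNIV (\<lambda>z :: nat \<Rightarrow> real. z i)"
      by (rule continuous_on_product_coordinates)
    then show "((\<lambda>z. z i) \<longlongrightarrow> z i) (at z)" by (auto simp: continuous_on_def)
  qed auto
  then have m: "(\<lambda>z. f (step_path k z)) \<in> borel_measurable borel"
    by (rule borel_measurable_continuous_onI)
  \<comment> \<open>Coordinates beyond \<open>k\<close> are set to 0, as nothing is assumed about
    their measurability; the path does not see them.\<close>
  have "(\<lambda>\<omega> i. if i \<le> k then z \<omega> i else 0) \<in> borel_measurable N"
  proof (rule measurable_coordinatewise_then_product)
    fix i show "(\<lambda>\<omega>. if i \<le> k then z \<omega> i else 0) \<in> borel_measurable N"
      by (cases "i \<le> k") (use z in auto)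
  qed
  from measurable_compose[OF this m]
  have "(\<lambda>\<omega>. f (step_path k (\<lambda>i. if i \<le> k then z \<omega> i else 0))) \<in> borel_measurable N" .
  moreover have "step_path k (\<lambda>i. if i \<le> k then z \<omega> i else 0) = step_path k (z \<omega>)" for \<omega>
    by (rule step_path_cong) simp
  ultimately show ?thesis by simp
qed

lemma step_path_tendsto:
  assumes w: "continuous_on {0..1} w"
  shows "(\<lambda>k. skorohod_dist (step_path (Suc k) (\<lambda>i. w (real i / real (Suc k)))) (\<lambda>t\<in>{0..1}. w t)) \<longlonglongrightarrow> 0"
proof (rule LIMSEQ_I)
  fix e :: real assume e: "e > 0"
  have "uniformly_continuous_on {0..1} w" by (rule compact_uniformly_continuous[OF w compact_Icc])
  then obtain r where r: "r > 0" "\<And>s t. s \<in> {0..1} \<Longrightarrow> t \<in> {0..1} \<Longrightarrow> \<bar>s - t\<bar> < r \<Longrightarrow> \<bar>w s - w t\<bar> < e / 2"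
    using e unfolding uniformly_continuous_on_def dist_real_def by (metis half_gt_zero)
  obtain k0 :: nat where k0: "inverse (real (Suc k0)) < r" using reals_Archimedean[OF r(1)] by blast
  show "\<exists>no. \<forall>k\<ge>no. norm (skorohod_dist (step_path (Suc k) (\<lambda>i. w (real i / real (Suc k)))) (\<lambda>t\<in>{0..1}. w t) - 0) < e"
  proof (intro exI[of _ k0] allI impI)
    fix k assume k: "k \<ge> k0"
    let ?z = "\<lambda>i. w (real i / real (Suc k))"
    have kr: "1 / real (Suc k) < r"
    proof -
      have "1 / real (Suc k) \<le> inverse (real (Suc k0))" using k by (simp add: field_simps)
      then show ?thesis using k0 by simp
    qed
    have "skorohod_dist (step_path (Suc k) ?z) (\<lambda>t\<in>{0..1}. w t) \<le> e / 2"
    proof (intro skorohod_dist_le_sup step_path_D01 D01_continuous w)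
      fix t :: real assume t: "t \<in> {0..1}"
      define j where "j = nat \<lfloor>real (Suc k) * t\<rfloor>"
      have "real j = of_int \<lfloor>real (Suc k) * t\<rfloor>" 
        unfolding j_def using t by (intro of_nat_nat) simp
      then have j: "real j \<le> real (Suc k) * t" "real (Suc k) * t < real j + 1"
        by linarith+
      have "real j / real (Suc k) \<le> t" using j by (simp add: field_simps del: of_nat_Suc)
      moreover have "t < (real j + 1) / real (Suc k)"
        using j(2) by (simp add: pos_less_divide_eq mult.commute del: of_nat_Suc)
      then have "t - real j / real (Suc k) < 1 / real (Suc k)"
        by (simp add: add_divide_distrib)
      ultimately have "\<bar>w (real j / real (Suc k)) - w t\<bar> < e / 2"
        using kr t \<open>real j / real (Suc k) \<le> t\<close> nat_floor_mult_le[of t "Suc k"]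
        by (intro r(2)) (auto simp: j_def simp del: of_nat_Suc)
      then show "\<bar>step_path (Suc k) ?z t - (\<lambda>t\<in>{0..1}. w t) t\<bar> \<le> e / 2" 
        using t by (simp add: step_path_def j_def)
    qed (use e in auto)
    then show "norm (skorohod_dist (step_path (Suc k) ?z) (\<lambda>t\<in>{0..1}. w t) - 0) < e"
      using e skorohod_dist_nonneg by simp
  qed
qed

text \<open>A continuous path is the limit of its step paths at the grid times, and these involve
  only finitely many of the variables \<open>W t\<close>.\<close>

lemma measurable_continuous_path:
  assumes m: "\<And>t. t \<in> {0..1} \<Longrightarrow> W t \<in> borel_measurable N"
    and c: "\<And>\<omega>. \<omega> \<in> space N \<Longrightarrow> continuous_on {0..1} (\<lambda>t. W t \<omega>)"
  shows "(\<lambda>\<omega>. \<lambda>t\<in>{0..1}. W t \<omega>) \<in> N \<rightarrow>\<^sub>M borel_of skorohod_topology"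
proof (rule skorohod.measurable_borel_of_limit[where
      Xk = "\<lambda>k \<omega>. step_path (Suc k) (\<lambda>i. W (real i / real (Suc k)) \<omega>)"])
  fix f :: "(real \<Rightarrow> real) \<Rightarrow> real" and k
  assume f: "\<And>x y. x \<in> D01 \<Longrightarrow> y \<in> D01 \<Longrightarrow> \<bar>f x - f y\<bar> \<le> skorohod_dist x y"
  show "(\<lambda>\<omega>. f (step_path (Suc k) (\<lambda>i. W (real i / real (Suc k)) \<omega>))) \<in> borel_measurable N"
    by (rule measurable_step_path[where K = 1]) (use f m in auto)
next
  fix \<omega> assume "\<omega> \<in> space N"
  then show "(\<lambda>k. skorohod_dist (step_path (Suc k) (\<lambda>i. W (real i / real (Suc k)) \<omega>)) (\<lambda>t\<in>{0..1}. W t \<omega>)) \<longlonglongrightarrow> 0"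
    by (intro step_path_tendsto c)
qed (use c step_path_D01 D01_continuous in auto)

section \<open>Gaps between ones\<close>

definition ones :: "(nat \<Rightarrow> bool) \<Rightarrow> nat \<Rightarrow> nat" where
  "ones \<xi> m = (\<Sum>j=1..m. of_bool (\<xi> j))"

definition last_one :: "(nat \<Rightarrow> bool) \<Rightarrow> nat \<Rightarrow> nat \<Rightarrow> bool" where
  "last_one \<xi> n q \<longleftrightarrow> q \<in> {1..n} \<and> \<xi> q \<and> (\<forall>l\<in>{q<..n}. \<not> \<xi> l)"

lemma last_one_exists:
  assumes "\<xi> 1" "n \<ge> 1"
  shows "\<exists>q. last_one \<xi> n q"
proof -
  let ?A = "{j \<in> {1..n}. \<xi> j}"
  have A: "finite ?A" "?A \<noteq> {}" using assms by force+
  have "Max ?A \<in> ?A" using A by (rule Max_in)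
  moreover have "\<not> \<xi> l" if "l \<in> {Max ?A<..n}" for l
  proof
    assume "\<xi> l"
    then have "l \<le> Max ?A" using that by (intro Max_ge[OF A(1)]) auto
    then show False using that by simp
  qed
  ultimately show ?thesis unfolding last_one_def by blast
qed

lemma last_one_unique: "last_one \<xi> n q \<Longrightarrow> last_one \<xi> n q' \<Longrightarrow> q = q'"
  unfolding last_one_def by (cases q q' rule: linorder_cases) auto

text \<open>Removes the last part: it starts at the last one \<open>q\<close>, and the bits before
  \<open>q\<close> form the same situation at \<open>q - 1\<close>.\<close>

lemma last_one_induct [consumes 1, case_names 0 last]:
  assumes "\<xi> 1" "P 0" and step: "\<And>n q. last_one \<xi> n q \<Longrightarrow> P (q - 1) \<Longrightarrow> P n"
  shows "P n"
proof (induction n rule: less_induct)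
  case (less n)
  show ?case
  proof (cases "n = 0")
    case False
    then obtain q where q: "last_one \<xi> n q" using last_one_exists[of \<xi> n] assms(1) by auto
    then have "q - 1 < n" by (auto simp: last_one_def)
    then show ?thesis using step[OF q] less by blast
  qed (use assms in simp)
qed

lemma ones_mono: "m \<le> n \<Longrightarrow> ones \<xi> m \<le> ones \<xi> n"
  unfolding ones_def by (rule sum_mono2) auto

lemma ones_last:
  assumes "last_one \<xi> n q" "q \<le> m" "m \<le> n"
  shows "ones \<xi> m = ones \<xi> (q - 1) + 1"
proof -
  have "ones \<xi> m = (\<Sum>j\<in>{1..q}. of_bool (\<xi> j))"
    unfolding ones_def using assms by (intro sum.mono_neutral_right) (auto simp: last_one_def)
  also have "{1..q} = insert q {1..q-1}" using assms by (auto simp: last_one_def)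
  also have "(\<Sum>j\<in>insert q {1..q-1}. of_bool (\<xi> j) :: nat) = of_bool (\<xi> q) + ones \<xi> (q - 1)"
    unfolding ones_def using assms by (intro sum.insert) (auto simp: last_one_def)
  finally show ?thesis using assms by (simp add: last_one_def)
qed

lemma feller_partition_outside: "i \<notin> {1..n} \<Longrightarrow> feller_partition \<xi> n i = 0"
  unfolding feller_partition_def by (rule if_not_P)

text \<open>For the first \<open>q - 1\<close> bits, the one at \<open>q\<close> plays the role of
  the artificial one that closes the string. Hence the partitions of \<open>q - 1\<close> and
  \<open>n\<close> differ by one part, the run from \<open>q\<close> to the artificial one at
  \<open>n + 1\<close>, of size \<open>n - q + 1\<close>.\<close>

lemma feller_partition_last:
  assumes q: "last_one \<xi> n q"
  shows "feller_partition \<xi> n =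
    (feller_partition \<xi> (q - 1))(n - q + 1 := feller_partition \<xi> (q - 1) (n - q + 1) + 1)"
proof
  fix i
  have q1: "1 \<le> q" "q \<le> n" "\<xi> q" and after: "\<And>l. q < l \<Longrightarrow> l \<le> n \<Longrightarrow> \<not> \<xi> l"
    using q by (auto simp: last_one_def)
  let ?f = "feller_partition \<xi> (q - 1)"
  show "feller_partition \<xi> n i = (?f(n - q + 1 := ?f (n - q + 1) + 1)) i"
  proof (cases "i \<in> {1..n}")
    case False
    then have "i \<noteq> n - q + 1" "i \<notin> {1..q-1}" using q1 by auto
    with False show ?thesis by (simp only: feller_partition_outside fun_upd_other not_False_eq_True)
  next
    case True
    define T where "T j = (of_bool (\<xi> j) * (\<Prod>l=j+1..j+i-1. 1 - of_bool (\<xi> l)) * of_bool (\<xi> (i + j)) :: nat)" for j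
    have T0: "T j = 0" if "i + j > q" "i + j \<le> n" for j
      using after[OF that] by (simp add: T_def)
    \<comment> \<open>The boundary term of size \<open>i\<close> is nonzero exactly when the last
      one stands at \<open>n - i + 1\<close>: a later one spoils the product, and if
      \<open>q\<close> is earlier, position \<open>n - i + 1\<close> is zero.\<close>
    have last: "of_bool (\<xi> (n - i + 1)) * (\<Prod>l=n-i+2..n. 1 - of_bool (\<xi> l)) = (of_bool (i = n - q + 1) :: nat)"
    proof (cases "n - i + 1" q rule: linorder_cases)
      case less
      then have "(\<Prod>l=n-i+2..n. 1 - of_bool (\<xi> l)) = (0::nat)"
        using q1 by (intro prod_zero) (auto intro!: bexI[of _ q])
      then show ?thesis using less q1 True by auto
    next
      case equal
      then have "(\<Prod>l=n-i+2..n. 1 - of_bool (\<xi> l)) = (1::nat)"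
        using after by (intro prod.neutral) auto
      then show ?thesis using equal q1 True by auto
    next
      case greater
      then have "\<not> \<xi> (n - i + 1)" using after True by auto
      then show ?thesis using greater q1 True by auto
    qed
    have "(\<Sum>j=1..n-i. T j) = ?f i"
    proof (cases "i \<le> q - 1")
      case False
      then have "(\<Sum>j=1..n-i. T j) = 0" using q1 True by (intro sum.neutral ballI T0) auto
      then show ?thesis using False by (simp add: feller_partition_outside)
    next
      case i: True
      have "(\<Sum>j=1..n-i. T j) = (\<Sum>j\<in>insert (q - i) {1..q-1-i}. T j)"
      proof (intro sum.mono_neutral_right ballI)
        fix j assume "j \<in> {1..n-i} - insert (q - i) {1..q-1-i}"
        then have "i + j > q" "i + j \<le> n" using i True by auto
        then show "T j = 0" by (rule T0)
      qed (use q1 i True in auto)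
      also have "\<dots> = (\<Sum>j=1..q-1-i. T j) + T (q - i)"
        using q1 i True by (subst sum.insert) auto
      \<comment> \<open>The gap that ends at \<open>q\<close> is an interior gap for
        \<open>n\<close>, but the boundary term for \<open>q - 1\<close>.\<close>
      also have "T (q - i) = of_bool (\<xi> (q - 1 - i + 1)) * (\<Prod>l=q-1-i+2..q-1. 1 - of_bool (\<xi> l))"
      proof -
        have "q - 1 - i + 1 = q - i" "q - 1 - i + 2 = q - i + 1" "q - i + i - 1 = q - 1" "i + (q - i) = q"
          using i q1 by auto
        then show ?thesis using q1 by (simp add: T_def)
      qed
      finally show ?thesis using i True by (simp add: feller_partition_def T_def)
    qed
    then have "feller_partition \<xi> n i = ?f i + of_bool (i = n - q + 1)"
      using True last by (simp add: feller_partition_def T_def)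
    then show ?thesis by auto
  qed
qed

lemma feller_partition_0 [simp]: "feller_partition \<xi> 0 = (\<lambda>_. 0)"
  by (auto simp: feller_partition_def)

lemma add_part_partitions:
  assumes "\<alpha> \<in> partitions m" "i \<in> {1..n}" "m + i = n"
  shows "\<alpha>(i := \<alpha> i + 1) \<in> partitions n"
proof -
  have out: "\<alpha> j = 0" if "j \<notin> {1..m}" for j using assms(1) that by (simp add: partitions_def)
  have "(\<Sum>j=1..n. j * (\<alpha>(i := \<alpha> i + 1)) j) = (\<Sum>j=1..n. j * \<alpha> j + (if j = i then i else 0))"
    by (intro sum.cong) auto
  also have "\<dots> = (\<Sum>j=1..n. j * \<alpha> j) + i" using assms(2) by (simp add: sum.distrib)
  also have "(\<Sum>j=1..n. j * \<alpha> j) = (\<Sum>j=1..m. j * \<alpha> j)"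
    using out assms(3) by (intro sum.mono_neutral_right) auto
  also have "\<dots> = m" using assms(1) by (simp add: partitions_def)
  finally show ?thesis using assms out by (auto simp: partitions_def)
qed

lemma feller_partition_in_partitions:
  assumes "\<xi> 1"
  shows "feller_partition \<xi> n \<in> partitions n"
  using assms
proof (induction n rule: last_one_induct)
  case 0
  then show ?case by (simp add: partitions_def)
next
  case (last n q)
  then show ?case
    unfolding feller_partition_last[OF last(1)]
    by (intro add_part_partitions) (auto simp: last_one_def)
qed

definition parts_upto :: "nat \<Rightarrow> (nat \<Rightarrow> nat) \<Rightarrow> nat" where
  "parts_upto m \<alpha> = (\<Sum>i=1..m. \<alpha> i)"

lemma parts_upto_last:
  assumes "last_one \<xi> n q"
  shows "parts_upto m (feller_partition \<xi> n) =
    parts_upto m (feller_partition \<xi> (q - 1)) + of_bool (n - q + 1 \<le> m)"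
proof -
  have "parts_upto m (feller_partition \<xi> n) =
      (\<Sum>i=1..m. feller_partition \<xi> (q - 1) i + (if i = n - q + 1 then 1 else 0))"
    unfolding feller_partition_last[OF assms] parts_upto_def by (intro sum.cong) auto
  then show ?thesis by (simp add: parts_upto_def sum.distrib)
qed

text \<open>Every one opens exactly one part, and no part exceeds \<open>n\<close>.\<close>

lemma parts_upto_all:
  assumes "\<xi> 1" "n \<le> m"
  shows "parts_upto m (feller_partition \<xi> n) = ones \<xi> n"
  using assms
proof (induction n rule: last_one_induct)
  case 0
  then show ?case by (simp add: parts_upto_def ones_def)
next
  case (last n q)
  then show ?case
    using parts_upto_last[OF last(1), of m] ones_last[OF last(1), of n]
    by (auto simp: last_one_def)
qed

text \<open>A one at position \<open>j \<le> m\<close> that is not the last such is followed by a gap of length at most \<open>m\<close>.\<close>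

lemma ones_le_parts_upto:
  assumes "\<xi> 1" "m \<le> n"
  shows "ones \<xi> m \<le> parts_upto m (feller_partition \<xi> n) + 1"
  using assms
proof (induction n rule: last_one_induct)
  case 0
  then show ?case by (simp add: ones_def)
next
  case (last n q)
  have mono: "parts_upto m (feller_partition \<xi> (q - 1)) \<le> parts_upto m (feller_partition \<xi> n)"
    using parts_upto_last[OF last(1), of m] by simp
  show ?case
  proof (cases "m \<le> q - 1")
    case True
    then show ?thesis using last mono by auto
  next
    case False
    then have "parts_upto m (feller_partition \<xi> (q - 1)) = ones \<xi> (q - 1)"
      using assms(1) by (intro parts_upto_all) auto
    moreover have "ones \<xi> m = ones \<xi> (q - 1) + 1"
      using False last by (intro ones_last[OF last(1)]) auto
    ultimately show ?thesis using mono by simp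
  qed
qed

text \<open>If every gap starting at \<open>j\<close> is longer than \<open>j / c\<close>, gaps of length at most \<open>m\<close> start before \<open>c m\<close>.\<close>

lemma parts_upto_le_ones:
  assumes \<xi>: "\<xi> 1"
    and gap: "\<And>j l. 1 \<le> j \<Longrightarrow> j < l \<Longrightarrow> l \<le> n \<Longrightarrow> \<xi> j \<Longrightarrow> \<xi> l \<Longrightarrow> j < c * (l - j)"
  shows "parts_upto m (feller_partition \<xi> n) \<le> ones \<xi> (min n (c * m)) + 1"
proof (cases "n = 0")
  case True
  then show ?thesis by (simp add: parts_upto_def)
next
  case False
  then obtain q where q: "last_one \<xi> n q" using last_one_exists[of \<xi> n] \<xi> by auto
  \<comment> \<open>The partition of \<open>q - 1\<close> for a one at \<open>q\<close> has only
    gaps that end at genuine ones, so \<open>gap\<close> applies to all of them. The final gap,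
    closed by the artificial one at \<open>n + 1\<close>, is the \<open>+ 1\<close> of the
    conclusion.\<close>
  have A: "q \<in> {1..n} \<Longrightarrow> \<xi> q \<Longrightarrow> parts_upto m (feller_partition \<xi> (q - 1)) \<le> ones \<xi> (min (q - 1) (c * m))" for q
  proof (induction q rule: less_induct)
    case (less q)
    show ?case
    proof (cases "q = 1")
      case True
      then show ?thesis by (simp add: parts_upto_def)
    next
      case False
      then have "\<exists>q'. last_one \<xi> (q - 1) q'"
        using less.prems by (intro last_one_exists \<xi>) auto
      then obtain q' where q': "last_one \<xi> (q - 1) q'" by blast
      then have q'': "q' \<in> {1..n}" "\<xi> q'" "q' < q" using less.prems by (auto simp: last_one_def)
      note IH = less.IH[OF q''(3,1,2)]
      have eq: "parts_upto m (feller_partition \<xi> (q - 1)) =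
          parts_upto m (feller_partition \<xi> (q' - 1)) + of_bool (q - q' \<le> m)"
        using parts_upto_last[OF q', of m] q'' by (simp add: Suc_diff_Suc)
      show ?thesis
      proof (cases "q - q' \<le> m")
        case True
        \<comment> \<open>A counted gap starts below \<open>c * m\<close>, so its starting one is
          counted on the right as well.\<close>
        have "q' < c * (q - q')" using gap[of q' q] q'' less.prems by auto
        also have "\<dots> \<le> c * m" using True by simp
        finally have "q' < c * m" .
        have "ones \<xi> (min (q - 1) (c * m)) = ones \<xi> (q' - 1) + 1"
          using q'' \<open>q' < c * m\<close> by (intro ones_last[OF q']) auto
        moreover have "min (q' - 1) (c * m) = q' - 1" using \<open>q' < c * m\<close> by simp
          ultimately show ?thesis using IH eq True by simp
      next
        case False
        have "ones \<xi> (min (q' - 1) (c * m)) \<le> ones \<xi> (min (q - 1) (c * m))"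
          using q'' by (intro ones_mono) auto
        then show ?thesis using IH eq False by simp
      qed
    qed
  qed
  have "parts_upto m (feller_partition \<xi> (q - 1)) \<le> ones \<xi> (min (q - 1) (c * m))"
    using q by (intro A) (auto simp: last_one_def)
  also have "\<dots> \<le> ones \<xi> (min n (c * m))"
    using q by (intro ones_mono) (auto simp: last_one_def)
  finally show ?thesis using parts_upto_last[OF q, of m] by simp
qed

lemma feller_partition_cong:
  assumes "\<And>i. i \<in> {1..n} \<Longrightarrow> \<xi> i = \<xi>' i"
  shows "feller_partition \<xi> n = feller_partition \<xi>' n"
proof
  fix i
  show "feller_partition \<xi> n i = feller_partition \<xi>' n i"
  proof (cases "i \<in> {1..n}")
    case True
    have "of_bool (\<xi> j) * (\<Prod>l=j+1..j+i-1. 1 - of_bool (\<xi> l)) * of_bool (\<xi> (i + j)) =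
        (of_bool (\<xi>' j) * (\<Prod>l=j+1..j+i-1. 1 - of_bool (\<xi>' l)) * of_bool (\<xi>' (i + j)) :: nat)"
      if "j \<in> {1..n-i}" for j
    proof -
      have "(\<Prod>l=j+1..j+i-1. 1 - of_bool (\<xi> l)) = (\<Prod>l=j+1..j+i-1. 1 - of_bool (\<xi>' l) :: nat)"
        using that True by (intro prod.cong refl) (subst assms, auto)
      moreover have "\<xi> j = \<xi>' j" "\<xi> (i + j) = \<xi>' (i + j)" using that True by (auto intro!: assms)
      ultimately show ?thesis by (simp only:)
    qed
    moreover have "(\<Prod>l=n-i+2..n. 1 - of_bool (\<xi> l)) = (\<Prod>l=n-i+2..n. 1 - of_bool (\<xi>' l) :: nat)"
      by (intro prod.cong refl) (simp add: assms)
    moreover have "\<xi> (n - i + 1) = \<xi>' (n - i + 1)" using True by (auto intro!: assms)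
    ultimately show ?thesis
      using True unfolding feller_partition_def by (simp only: if_True cong: sum.cong)
  next
    case False
    then show ?thesis by (simp only: feller_partition_outside not_False_eq_True)
  qed
qed

section \<open>The Feller coupling and the Ewens measure\<close>

text \<open>Dependence on the coordinates in \<open>A\<close> alone. For finite \<open>A\<close> and
  bits as values this one notion yields finite range, boundedness, measurability and integrability,
  and for disjoint index sets independence.\<close>

definition local_on :: "'i set \<Rightarrow> (('i \<Rightarrow> 'a) \<Rightarrow> 'b) \<Rightarrow> bool" where
  "local_on A g \<longleftrightarrow> (\<forall>\<xi> \<xi>'. (\<forall>i\<in>A. \<xi> i = \<xi>' i) \<longrightarrow> g \<xi> = g \<xi>')"

lemma local_onI: "(\<And>\<xi> \<xi>'. (\<And>i. i \<in> A \<Longrightarrow> \<xi> i = \<xi>' i) \<Longrightarrow> g \<xi> = g \<xi>') \<Longrightarrow> local_on A g"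
  unfolding local_on_def by blast

lemma local_onD: "local_on A g \<Longrightarrow> (\<And>i. i \<in> A \<Longrightarrow> \<xi> i = \<xi>' i) \<Longrightarrow> g \<xi> = g \<xi>'"
  unfolding local_on_def by blast

lemma local_on_restrict: "local_on A g \<Longrightarrow> g (restrict \<xi> A) = g \<xi>"
  by (rule local_onD) auto

lemma local_on_mono: "local_on A g \<Longrightarrow> A \<subseteq> B \<Longrightarrow> local_on B g"
  unfolding local_on_def by blast

lemma local_on_compose: "local_on A g \<Longrightarrow> local_on A (\<lambda>\<xi>. h (g \<xi>))"
  unfolding local_on_def by metis

lemma local_on_compose2: "local_on A f \<Longrightarrow> local_on A g \<Longrightarrow> local_on A (\<lambda>\<xi>. h (f \<xi>) (g \<xi>))"
  unfolding local_on_def by metis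

lemma local_on_coord: "i \<in> A \<Longrightarrow> local_on A (\<lambda>\<xi>. \<xi> i)"
  unfolding local_on_def by blast

lemma local_on_sum:
  fixes f :: "'j \<Rightarrow> ('i \<Rightarrow> 'a) \<Rightarrow> 'b :: comm_monoid_add"
  shows "(\<And>j. j \<in> J \<Longrightarrow> local_on A (f j)) \<Longrightarrow> local_on A (\<lambda>\<xi>. \<Sum>j\<in>J. f j \<xi>)"
  by (rule local_onI, rule sum.cong) (auto dest: local_onD)

lemma local_on_finite_range:
  assumes "local_on A g" "finite A"
  shows "finite (range (g :: (_ \<Rightarrow> 'a :: finite) \<Rightarrow> _))"
proof (rule finite_subset)
  show "range g \<subseteq> g ` (PiE A (\<lambda>_. UNIV))"
  proof
    fix y assume "y \<in> range g"
    then obtain \<xi> where "y = g \<xi>" by blast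
    then have "y = g (restrict \<xi> A)" using local_on_restrict[OF assms(1)] by metis
    then show "y \<in> g ` (PiE A (\<lambda>_. UNIV))" by auto
  qed
  show "finite (g ` (PiE A (\<lambda>_. UNIV)))" using assms(2) by (auto intro!: finite_PiE)
qed

lemma local_on_bounded:
  fixes g :: "(_ \<Rightarrow> 'a :: finite) \<Rightarrow> real"
  assumes "local_on A g" "finite A"
  obtains B where "\<And>\<xi>. \<bar>g \<xi>\<bar> \<le> B"
proof -
  have "bounded (range g)" using local_on_finite_range[OF assms] by (rule finite_imp_bounded)
  then show ?thesis using that by (auto simp: bounded_iff)
qed

lemma local_on_feller_partition: "local_on {1..n} (\<lambda>\<xi>. feller_partition \<xi> n)"
  by (rule local_onI, rule feller_partition_cong)

lemma local_on_last_one: "q \<ge> 1 \<Longrightarrow> local_on {q..n} (\<lambda>\<xi>. last_one \<xi> n q)"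
  unfolding local_on_def last_one_def by auto

section \<open>Independence of the coordinates under the Feller measure\<close>

locale feller =
  fixes \<theta> :: real
  assumes theta: "\<theta> > 0"
begin

definition p :: "nat \<Rightarrow> real" where "p i = \<theta> / (\<theta> + real i - 1)"

abbreviation "F \<equiv> feller_measure \<theta>"

lemma p_bounds: "i \<ge> 1 \<Longrightarrow> 0 < p i" "i \<ge> 1 \<Longrightarrow> p i \<le> 1"
  using theta by (auto simp: p_def)

lemma p_1 [simp]: "p 1 = 1" "p (Suc 0) = 1"
  using theta by (auto simp: p_def)

sublocale prob_space F
  unfolding feller_measure_def by (rule prob_space_PiM) (rule prob_space_measure_pmf)

lemma sets_F: "sets F = sets (PiM {1..} (\<lambda>_. count_space UNIV))"
  unfolding feller_measure_def by (rule sets_PiM_cong) auto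

lemma space_F: "space F = PiE {1..} (\<lambda>_. UNIV)"
  using sets_eq_imp_space_eq[OF sets_F] by (simp add: space_PiM)

lemma measurable_coord: "i \<ge> 1 \<Longrightarrow> (\<lambda>\<xi>. \<xi> i) \<in> F \<rightarrow>\<^sub>M count_space UNIV"
  unfolding measurable_cong_sets[OF sets_F refl] by (rule measurable_component_singleton) auto

lemma distr_coord:
  assumes "i \<ge> 1"
  shows "distr F (count_space UNIV) (\<lambda>\<xi>. \<xi> i) = measure_pmf (bernoulli_pmf (p i))"
proof -
  have "distr F (count_space UNIV) (\<lambda>\<xi>. \<xi> i) =
      distr F (measure_pmf (bernoulli_pmf (p i))) (\<lambda>\<xi>. \<xi> i)"
    by (rule distr_cong) auto
  also have "\<dots> = measure_pmf (bernoulli_pmf (p i))"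
    unfolding feller_measure_def p_def
    using assms by (intro distr_PiM_component) (auto intro: prob_space_measure_pmf)
  finally show ?thesis .
qed

text \<open>Elements of \<open>space F\<close> are extensional, so the joint map is the identity and
  its law is the product of the marginals by construction.\<close>

lemma indep_coords: "indep_vars (\<lambda>_. count_space UNIV) (\<lambda>i \<xi>. \<xi> i) {1..}"
proof (subst indep_vars_iff_distr_eq_PiM')
  have "distr F (PiM {1..} (\<lambda>_. count_space UNIV)) (\<lambda>x. \<lambda>i\<in>{1..}. x i) =
      distr F F (\<lambda>x. x)"
    by (rule distr_cong) (auto simp: sets_F space_F PiE_def extensional_restrict)
  also have "\<dots> = F" by (rule distr_id2) simp
  also have "F = PiM {1..} (\<lambda>i. distr F (count_space UNIV) (\<lambda>x. x i))"
    by (subst feller_measure_def, rule PiM_cong) (auto simp: distr_coord p_def)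
  finally show "distr F (PiM {1..} (\<lambda>_. count_space UNIV)) (\<lambda>x. \<lambda>i\<in>{1..}. x i) =
      PiM {1..} (\<lambda>i. distr F (count_space UNIV) (\<lambda>x. x i))" .
qed (auto intro: measurable_coord)

text \<open>A finite product of discrete \<open>bool\<close> spaces is discrete.\<close>

lemma measurable_PiM_local:
  assumes "finite A" "range g \<subseteq> space N"
  shows "g \<in> PiM A (\<lambda>_. count_space (UNIV :: bool set)) \<rightarrow>\<^sub>M N"
  using assms by (subst count_space_PiM_finite) auto

lemma measurable_local:
  assumes A: "finite A" "A \<subseteq> {1..}" and g: "local_on A g" "range g \<subseteq> space N"
  shows "g \<in> F \<rightarrow>\<^sub>M N"
proof -
  have "(\<lambda>\<xi>. restrict \<xi> A) \<in> F \<rightarrow>\<^sub>M PiM A (\<lambda>_. count_space UNIV)"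
    unfolding measurable_cong_sets[OF sets_F refl] by (rule measurable_restrict_subset) (rule A)
  from measurable_compose[OF this measurable_PiM_local[OF A(1) g(2)]]
  show ?thesis by (simp add: local_on_restrict[OF g(1)])
qed

lemma indep_vars_local:
  assumes K: "\<And>j. j \<in> L \<Longrightarrow> finite (K j)" "\<And>j. j \<in> L \<Longrightarrow> K j \<subseteq> {1..}" "disjoint_family_on K L"
    and g: "\<And>j. j \<in> L \<Longrightarrow> local_on (K j) (g j)" "\<And>j. j \<in> L \<Longrightarrow> range (g j) \<subseteq> space (N j)"
  shows "indep_vars N g L"
proof -
  have "indep_vars N (\<lambda>j \<xi>. g j (restrict \<xi> (K j))) L"
    by (rule indep_vars_compose2[OF indep_vars_restrict[OF indep_coords K(2,3)]])
      (use K g in \<open>auto intro!: measurable_PiM_local simp: image_subset_iff\<close>)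
  then show ?thesis
    by (rule indep_vars_cong[THEN iffD1, rotated -1]) (auto simp: local_on_restrict[OF g(1)])
qed

lemma integrable_local:
  fixes g :: "(nat \<Rightarrow> bool) \<Rightarrow> real"
  assumes "finite A" "A \<subseteq> {1..}" "local_on A g"
  shows "integrable F g"
proof -
  obtain B where "\<And>\<xi>. \<bar>g \<xi>\<bar> \<le> B" using local_on_bounded[OF assms(3,1)] by metis
  then show ?thesis
    by (intro integrable_const_bound[where B = B] AE_I2 measurable_local[OF assms]) auto
qed

lemma expectation_mult_local:
  fixes g h :: "(nat \<Rightarrow> bool) \<Rightarrow> real"
  assumes A: "finite A" "A \<subseteq> {1..}" "local_on A g" and B: "finite B" "B \<subseteq> {1..}" "local_on B h"
    and "A \<inter> B = {}"
  shows "expectation (\<lambda>\<xi>. g \<xi> * h \<xi>) = expectation g * expectation h"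
proof (rule indep_var_lebesgue_integral)
  have "indep_var borel (g \<circ> (\<lambda>\<xi>. restrict (\<lambda>i. \<xi> i) A)) borel (h \<circ> (\<lambda>\<xi>. restrict (\<lambda>i. \<xi> i) B))"
    by (rule indep_var_compose[OF indep_var_restrict[OF indep_coords]])
      (use assms in \<open>auto intro!: measurable_PiM_local\<close>)
  then show "indep_var borel g borel h"
    by (simp add: comp_def local_on_restrict[OF A(3)] local_on_restrict[OF B(3)])
qed (use integrable_local A B in blast)+

lemma sets_local:
  assumes "finite A" "A \<subseteq> {1..}" "local_on A P"
  shows "{\<xi> \<in> space F. P \<xi>} \<in> sets F"
  using measurable_sets[OF measurable_local[OF assms, of "count_space UNIV"], of "{True}"]
  by (simp add: vimage_def Int_def conj_commute)

lemma prob_eq_expectation: "prob {\<xi> \<in> space F. P \<xi>} = expectation (\<lambda>\<xi>. of_bool (P \<xi>))"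
proof -
  have "expectation (\<lambda>\<xi>. of_bool (P \<xi>)) = expectation (indicator {\<xi> \<in> space F. P \<xi>})"
    by (rule Bochner_Integration.integral_cong) auto
  also have "\<dots> = prob ({\<xi> \<in> space F. P \<xi>} \<inter> space F)" by (rule Bochner_Integration.integral_indicator)
  also have "{\<xi> \<in> space F. P \<xi>} \<inter> space F = {\<xi> \<in> space F. P \<xi>}" by auto
  finally show ?thesis by simp
qed

lemma prob_conj_local:
  assumes A: "finite A" "A \<subseteq> {1..}" "local_on A P" and B: "finite B" "B \<subseteq> {1..}" "local_on B Q"
    and "A \<inter> B = {}"
  shows "prob {\<xi> \<in> space F. P \<xi> \<and> Q \<xi>} = prob {\<xi> \<in> space F. P \<xi>} * prob {\<xi> \<in> space F. Q \<xi>}"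
  unfolding prob_eq_expectation of_bool_conj
  by (rule expectation_mult_local[OF A(1,2) _ B(1,2)])
    (use assms in \<open>auto intro: local_on_compose\<close>)

lemma expectation_coord:
  assumes "i \<ge> 1"
  shows "expectation (\<lambda>\<xi>. f (\<xi> i)) = p i * f True + (1 - p i) * (f False :: real)"
proof -
  have "expectation (\<lambda>\<xi>. f (\<xi> i)) = (\<integral>b. f b \<partial>distr F (count_space UNIV) (\<lambda>\<xi>. \<xi> i))"
    by (rule integral_distr[symmetric]) (auto intro: measurable_coord assms)
  also have "\<dots> = p i * f True + (1 - p i) * f False"
    unfolding distr_coord[OF assms]
    using p_bounds[OF assms] by (subst integral_bernoulli_pmf) auto
  finally show ?thesis .
qed

section \<open>The law of the Feller partition\<close>

lemma AE_coord_1: "AE \<xi> in F. \<xi> 1"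
proof -
  have "prob {\<xi> \<in> space F. \<xi> 1} = 1"
    unfolding prob_eq_expectation by (simp add: expectation_coord)
  then show ?thesis by (subst (asm) prob_eq_1) (auto intro!: sets_local[of "{1}"] local_on_coord)
qed

text \<open>The value is \<open>p q\<close> times the product of
  \<open>1 - p l = (l - 1) / (\<theta> + l - 1)\<close> over \<open>q < l \<le> n\<close>, which is
  a quotient of factorials times one of rising factorials.\<close>

lemma prob_last_one:
  assumes "1 \<le> q" "q \<le> n"
  shows "prob {\<xi> \<in> space F. last_one \<xi> n q} =
    \<theta> * (fact (n - 1) / fact (q - 1)) * (pochhammer \<theta> (q - 1) / pochhammer \<theta> n)"
  using assms(2)
proof (induction n rule: dec_induct)
  case base
  have "{\<xi> \<in> space F. last_one \<xi> q q} = {\<xi> \<in> space F. \<xi> q}"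
    using assms(1) by (auto simp: last_one_def)
  then have "prob {\<xi> \<in> space F. last_one \<xi> q q} = p q"
    using assms(1) by (simp add: prob_eq_expectation expectation_coord)
  moreover have "pochhammer \<theta> q = pochhammer \<theta> (q - 1) * (\<theta> + real q - 1)"
    using assms(1) pochhammer_Suc[of \<theta> "q - 1"] by (simp add: of_nat_diff algebra_simps)
  moreover have "pochhammer \<theta> (q - 1) > 0" by (rule pochhammer_pos) (rule theta)
  ultimately show ?case by (simp add: p_def)
next
  case (step n)
  have "{\<xi> \<in> space F. last_one \<xi> (Suc n) q} = {\<xi> \<in> space F. last_one \<xi> n q \<and> \<not> \<xi> (Suc n)}"
    using step assms(1) by (auto simp: last_one_def le_Suc_eq)
  then have "prob {\<xi> \<in> space F. last_one \<xi> (Suc n) q} =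
      prob {\<xi> \<in> space F. last_one \<xi> n q \<and> \<not> \<xi> (Suc n)}"
    by (simp only:)
  also have "\<dots> = prob {\<xi> \<in> space F. last_one \<xi> n q} * prob {\<xi> \<in> space F. \<not> \<xi> (Suc n)}"
    by (rule prob_conj_local[OF _ _ local_on_last_one _ _ local_on_compose[OF local_on_coord, of _ "{Suc n}"]])
      (use assms(1) in auto)
  also have "prob {\<xi> \<in> space F. \<not> \<xi> (Suc n)} = real n / (\<theta> + real n)"
    unfolding prob_eq_expectation using expectation_coord[of "Suc n" "\<lambda>b. of_bool (\<not> b)"] theta
    by (simp add: p_def field_simps)
  also have "fact (Suc n - 1) = (real n * fact (n - 1) :: real)"
    using step assms(1) by (cases n) auto
  ultimately show ?case
    using pochhammer_pos[OF theta, of n] theta by (simp add: step.IH pochhammer_Suc field_simps)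
qed

lemma ewens_weight_extend:
  assumes "\<alpha> \<in> partitions m" "m \<le> n"
  shows "ewens_weight \<theta> n \<alpha> = ewens_weight \<theta> m \<alpha>"
  unfolding ewens_weight_def using assms
  by (intro prod.mono_neutral_right) (auto simp: partitions_def)

text \<open>The weight identity behind the induction on the last part; the factor
  \<open>i * \<alpha> i\<close> is the share of \<open>n\<close> held by parts of size
  \<open>i\<close>, and for a partition of \<open>n\<close> these shares sum to
  \<open>n\<close>.\<close>

lemma ewens_weight_add_part:
  assumes "i \<in> {1..n}" "\<alpha> i \<ge> 1"
  shows "ewens_weight \<theta> n (\<alpha>(i := \<alpha> i - 1)) * \<theta> = ewens_weight \<theta> n \<alpha> * (real i * real (\<alpha> i))"
proof -
  let ?w = "\<lambda>\<alpha> j. \<theta> ^ \<alpha> j / (real j ^ \<alpha> j * fact (\<alpha> j))"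
  let ?\<beta> = "\<alpha>(i := \<alpha> i - 1)"
  have "ewens_weight \<theta> n ?\<beta> = ?w ?\<beta> i * (\<Prod>j\<in>{1..n}-{i}. ?w ?\<beta> j)"
    unfolding ewens_weight_def using assms by (intro prod.remove) auto
  also have "(\<Prod>j\<in>{1..n}-{i}. ?w ?\<beta> j) = (\<Prod>j\<in>{1..n}-{i}. ?w \<alpha> j)"
    by (intro prod.cong) auto
  finally have 1: "ewens_weight \<theta> n ?\<beta> = ?w ?\<beta> i * (\<Prod>j\<in>{1..n}-{i}. ?w \<alpha> j)" .
  have 2: "ewens_weight \<theta> n \<alpha> = ?w \<alpha> i * (\<Prod>j\<in>{1..n}-{i}. ?w \<alpha> j)"
    unfolding ewens_weight_def using assms by (intro prod.remove) auto
  obtain a where a: "\<alpha> i = Suc a" using assms(2) by (cases "\<alpha> i") auto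
  have "?w ?\<beta> i * \<theta> = ?w \<alpha> i * (real i * real (\<alpha> i))"
    using assms a by (simp add: divide_simps del: of_nat_Suc)
  then have "?w ?\<beta> i * \<theta> * (\<Prod>j\<in>{1..n}-{i}. ?w \<alpha> j) =
      ?w \<alpha> i * (real i * real (\<alpha> i)) * (\<Prod>j\<in>{1..n}-{i}. ?w \<alpha> j)" by (simp only:)
  then show ?thesis unfolding 1 2 by (simp only: mult_ac)
qed

lemma remove_part_partitions:
  assumes \<alpha>: "\<alpha> \<in> partitions n" and i: "i \<in> {1..n}" "\<alpha> i \<ge> 1"
  shows "\<alpha>(i := \<alpha> i - 1) \<in> partitions (n - i)"
proof -
  let ?\<beta> = "\<alpha>(i := \<alpha> i - 1)"
  have "n = (\<Sum>j=1..n. j * ?\<beta> j + (if j = i then i else 0))"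
  proof -
    have "n = (\<Sum>j=1..n. j * \<alpha> j)" using \<alpha> by (simp add: partitions_def)
    also have "\<dots> = (\<Sum>j=1..n. j * ?\<beta> j + (if j = i then i else 0))"
      using i by (intro sum.cong) (auto simp: algebra_simps)
    finally show ?thesis .
  qed
  then have S: "(\<Sum>j=1..n. j * ?\<beta> j) = n - i" using i by (simp add: sum.distrib)
  have z: "?\<beta> j = 0" if j: "j \<notin> {1..n-i}" for j
  proof (cases "j \<in> {1..n}")
    case True
    have "j * ?\<beta> j \<le> (\<Sum>j=1..n. j * ?\<beta> j)" using True by (intro member_le_sum) auto
    then have le: "j * ?\<beta> j \<le> n - i" using S by simp
    show ?thesis
    proof (rule ccontr)
      assume "?\<beta> j \<noteq> 0"
      then obtain b where "?\<beta> j = Suc b" using not0_implies_Suc by blast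
      then have "j \<le> n - i" using le by (simp only: mult_Suc_right)
      then show False using j True by auto
    qed
  next
    case False
    then show ?thesis using \<alpha> i by (auto simp: partitions_def)
  qed
  have "(\<Sum>j=1..n-i. j * ?\<beta> j) = (\<Sum>j=1..n. j * ?\<beta> j)"
    using z by (intro sum.mono_neutral_left) auto
  then show ?thesis using S z unfolding partitions_def by simp
qed

text \<open>Split by the last one \<open>q\<close>. The event \<open>last_one \<xi> n q\<close> uses
  bits from \<open>q\<close> on and the partition of \<open>q - 1\<close> uses earlier bits, so the
  probabilities multiply. By \<open>ewens_weight_add_part\<close> each \<open>q\<close> contributes
  in proportion to \<open>i * \<alpha> i\<close> with \<open>i = n - q + 1\<close>, and the sum
  \<open>n\<close> turns \<open>fact (n - 1)\<close> into \<open>fact n\<close>.\<close>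

theorem prob_feller_partition:
  assumes "\<alpha> \<in> partitions n"
  shows "prob {\<xi> \<in> space F. feller_partition \<xi> n = \<alpha>} = fact n / pochhammer \<theta> n * ewens_weight \<theta> n \<alpha>"
  using assms
proof (induction n arbitrary: \<alpha> rule: less_induct)
  case (less n)
  show ?case
  proof (cases "n = 0")
    case True
    then have "\<alpha> = (\<lambda>_. 0)" using less.prems by (auto simp: partitions_def)
    then show ?thesis using True by (simp add: ewens_weight_def prob_space)
  next
    case False
    have pos: "pochhammer \<theta> m > 0" for m using theta by (rule pochhammer_pos)
    let ?E = "\<lambda>q. {\<xi> \<in> space F. last_one \<xi> n q \<and> feller_partition \<xi> n = \<alpha>}"
    have sets: "?E q \<in> sets F" if "q \<ge> 1" for q
    proof (rule sets_local[of "{1..n}"])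
      show "local_on {1..n} (\<lambda>\<xi>. last_one \<xi> n q \<and> feller_partition \<xi> n = \<alpha>)"
        using that by (intro local_on_compose2[of _ _ _ "(\<and>)"] local_on_mono[OF local_on_last_one]
          local_on_compose[OF local_on_feller_partition]) auto
    qed auto
    have "prob {\<xi> \<in> space F. feller_partition \<xi> n = \<alpha>} = prob (\<Union>q\<in>{1..n}. ?E q)"
    proof (rule measure_eq_AE)
      show "AE \<xi> in F. \<xi> \<in> {\<xi> \<in> space F. feller_partition \<xi> n = \<alpha>} \<longleftrightarrow> \<xi> \<in> (\<Union>q\<in>{1..n}. ?E q)"
        using AE_coord_1
      proof eventually_elim
        case (elim \<xi>)
        then obtain q where "last_one \<xi> n q" using last_one_exists[of \<xi> n] False by auto
        then show ?case by (auto simp: last_one_def)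
      qed
    qed (auto intro!: sets sets_local[of "{1..n}"] local_on_compose[OF local_on_feller_partition])
    also have "\<dots> = (\<Sum>q=1..n. prob (?E q))"
      by (rule finite_measure_finite_Union)
        (auto simp: sets disjoint_family_on_def dest: last_one_unique)
    also have "\<dots> = (\<Sum>q=1..n. fact (n - 1) / pochhammer \<theta> n * ewens_weight \<theta> n \<alpha> *
        (real (n - q + 1) * real (\<alpha> (n - q + 1))))"
    proof (rule sum.cong)
      fix q assume "q \<in> {1..n}"
      then have q: "1 \<le> q" "q \<le> n" by auto
      define i where "i = n - q + 1"
      have i: "i \<in> {1..n}" "n - i = q - 1" using q by (auto simp: i_def)
      show "prob (?E q) = fact (n - 1) / pochhammer \<theta> n * ewens_weight \<theta> n \<alpha> *
        (real (n - q + 1) * real (\<alpha> (n - q + 1)))"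
      proof (cases "\<alpha> i = 0")
        case True
        have "feller_partition \<xi> n i \<noteq> 0" if "last_one \<xi> n q" for \<xi>
          by (simp add: feller_partition_last[OF that] i_def)
        then have "feller_partition \<xi> n \<noteq> \<alpha>" if "last_one \<xi> n q" for \<xi>
          using that True by metis
        then have "?E q = {}" by blast
        then have "prob (?E q) = 0" by (simp only: measure_empty)
        then show ?thesis using True by (simp add: i_def)
      next
        case False
        let ?\<beta> = "\<alpha>(i := \<alpha> i - 1)"
        have b: "?\<beta> \<in> partitions (q - 1)"
          using remove_part_partitions[OF less.prems i(1)] False i(2) by simp
        have "\<beta>(i := \<beta> i + 1) = \<alpha> \<longleftrightarrow> \<beta> = ?\<beta>" for \<beta> :: "nat \<Rightarrow> nat"
          using False by (auto simp: fun_eq_iff)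
        then have "feller_partition \<xi> n = \<alpha> \<longleftrightarrow> feller_partition \<xi> (q - 1) = ?\<beta>"
          if "last_one \<xi> n q" for \<xi>
          unfolding feller_partition_last[OF that] i_def by blast
        then have "?E q = {\<xi> \<in> space F. last_one \<xi> n q \<and> feller_partition \<xi> (q - 1) = ?\<beta>}"
          by blast
        then have "prob (?E q) = prob {\<xi> \<in> space F. last_one \<xi> n q \<and> feller_partition \<xi> (q - 1) = ?\<beta>}"
          by (simp only:)
        also have "\<dots> = prob {\<xi> \<in> space F. last_one \<xi> n q} *
            prob {\<xi> \<in> space F. feller_partition \<xi> (q - 1) = ?\<beta>}"
          by (rule prob_conj_local[OF _ _ local_on_last_one _ _
                local_on_compose[OF local_on_feller_partition]]) (use q in auto)
        also have "prob {\<xi> \<in> space F. feller_partition \<xi> (q - 1) = ?\<beta>} =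
            fact (q - 1) / pochhammer \<theta> (q - 1) * ewens_weight \<theta> n ?\<beta>"
        proof -
          have lt: "q - 1 < n" "q - 1 \<le> n" using q by auto
          show ?thesis by (simp only: less.IH[OF lt(1) b] ewens_weight_extend[OF b lt(2)])
        qed
        also have "prob {\<xi> \<in> space F. last_one \<xi> n q} * \<dots> =
            fact (n - 1) / pochhammer \<theta> n * (ewens_weight \<theta> n ?\<beta> * \<theta>)"
          unfolding prob_last_one[OF q] using pos[of "q - 1"] by simp
        also have "ewens_weight \<theta> n ?\<beta> * \<theta> = ewens_weight \<theta> n \<alpha> * (real i * real (\<alpha> i))"
          using False i(1) by (intro ewens_weight_add_part) auto
        finally show ?thesis by (simp add: i_def)
      qed
    qed simp
    also have "\<dots> = fact (n - 1) / pochhammer \<theta> n * ewens_weight \<theta> n \<alpha> *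
        (\<Sum>q=1..n. real (n - q + 1) * real (\<alpha> (n - q + 1)))"
      by (simp only: sum_distrib_left)
    also have "(\<Sum>q=1..n. real (n - q + 1) * real (\<alpha> (n - q + 1))) = (\<Sum>i=1..n. real i * real (\<alpha> i))"
      by (rule sum.reindex_bij_witness[of _ "\<lambda>i. n - i + 1" "\<lambda>q. n - q + 1"]) auto
    also have "\<dots> = real (\<Sum>i=1..n. i * \<alpha> i)" by simp
    also have "\<dots> = real n" using less.prems by (simp add: partitions_def)
    also have "fact (n - 1) / pochhammer \<theta> n * ewens_weight \<theta> n \<alpha> * real n =
        fact n / pochhammer \<theta> n * ewens_weight \<theta> n \<alpha>"
      using False by (subst (2) fact_reduce) auto
    finally show ?thesis .
  qed
qed

lemma expectation_feller_partition:
  fixes g :: "(nat \<Rightarrow> nat) \<Rightarrow> real"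
  shows "expectation (\<lambda>\<xi>. g (feller_partition \<xi> n)) =
    fact n / pochhammer \<theta> n * (\<Sum>\<alpha>\<in>partitions n. g \<alpha> * ewens_weight \<theta> n \<alpha>)"
proof -
  have loc: "local_on {1..n} (\<lambda>\<xi>. of_bool (feller_partition \<xi> n = \<alpha>) :: real)" for \<alpha>
    by (intro local_on_compose[OF local_on_feller_partition])
  have "expectation (\<lambda>\<xi>. g (feller_partition \<xi> n)) =
      expectation (\<lambda>\<xi>. \<Sum>\<alpha>\<in>partitions n. g \<alpha> * of_bool (feller_partition \<xi> n = \<alpha>))"
  proof (rule integral_cong_AE)
    show "AE \<xi> in F. g (feller_partition \<xi> n) = (\<Sum>\<alpha>\<in>partitions n. g \<alpha> * of_bool (feller_partition \<xi> n = \<alpha>))"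
      using AE_coord_1
    proof eventually_elim
      case (elim \<xi>)
      have "(\<Sum>\<alpha>\<in>partitions n. g \<alpha> * of_bool (feller_partition \<xi> n = \<alpha>)) =
          (\<Sum>\<alpha>\<in>{feller_partition \<xi> n}. g \<alpha> * of_bool (feller_partition \<xi> n = \<alpha>))"
        using feller_partition_in_partitions[of \<xi> n] elim finite_partitions
        by (intro sum.mono_neutral_right) auto
      then show ?case by simp
    qed
  qed (auto intro!: measurable_local[of "{1..n}"] local_on_compose[OF local_on_feller_partition])
  also have "\<dots> = (\<Sum>\<alpha>\<in>partitions n. expectation (\<lambda>\<xi>. g \<alpha> * of_bool (feller_partition \<xi> n = \<alpha>)))"
    by (intro Bochner_Integration.integral_sum integrable_mult_right integrable_local[of "{1..n}"] loc) auto
  also have "\<dots> = (\<Sum>\<alpha>\<in>partitions n. g \<alpha> * prob {\<xi> \<in> space F. feller_partition \<xi> n = \<alpha>})"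
    by (simp add: prob_eq_expectation)
  also have "\<dots> = (\<Sum>\<alpha>\<in>partitions n. g \<alpha> * (fact n / pochhammer \<theta> n * ewens_weight \<theta> n \<alpha>))"
    by (intro sum.cong) (auto simp: prob_feller_partition)
  finally show ?thesis by (simp add: sum_distrib_left mult_ac)
qed

text \<open>The coupling replaces sums over partitions by expectations; the Ewens factor
  \<open>fact n / pochhammer \<theta> n\<close> occurs in numerator and denominator and
  cancels.\<close>

lemma integral_perturbed_ewens:
  fixes h :: "(nat \<Rightarrow> nat) \<Rightarrow> real"
  assumes \<eta>: "\<And>\<alpha>. \<alpha> \<in> partitions n \<Longrightarrow> 0 \<le> \<eta> \<alpha>" and Z: "perturbed_norm \<theta> \<eta> n > 0"
  shows "(LINT \<alpha>|perturbed_ewens \<theta> \<eta> n. h \<alpha>) =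
    expectation (\<lambda>\<xi>. \<eta> (feller_partition \<xi> n) * h (feller_partition \<xi> n)) /
    expectation (\<lambda>\<xi>. \<eta> (feller_partition \<xi> n))"
proof -
  have w: "ewens_weight \<theta> n \<alpha> \<ge> 0" for \<alpha>
    using theta by (auto simp: ewens_weight_def intro!: prod_nonneg)
  have "(LINT \<alpha>|perturbed_ewens \<theta> \<eta> n. h \<alpha>) =
      (\<Sum>\<alpha>\<in>partitions n. (\<eta> \<alpha> / perturbed_norm \<theta> \<eta> n * ewens_weight \<theta> n \<alpha>) * h \<alpha>)"
    unfolding perturbed_ewens_def using \<eta> Z w
    by (subst lebesgue_integral_point_measure_finite) (auto simp: finite_partitions)
  also have "\<dots> = (\<Sum>\<alpha>\<in>partitions n. \<eta> \<alpha> * h \<alpha> * ewens_weight \<theta> n \<alpha>) / perturbed_norm \<theta> \<eta> n"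
    by (simp add: sum_divide_distrib mult_ac)
  also have "\<dots> = expectation (\<lambda>\<xi>. \<eta> (feller_partition \<xi> n) * h (feller_partition \<xi> n)) /
    expectation (\<lambda>\<xi>. \<eta> (feller_partition \<xi> n))"
    using expectation_feller_partition[of "\<lambda>\<alpha>. \<eta> \<alpha> * h \<alpha>" n] expectation_feller_partition[of \<eta> n]
      pochhammer_pos[OF theta, of n]
    by (simp add: perturbed_norm_def)
  finally show ?thesis .
qed

end

section \<open>Sums of centred indicators\<close>

context feller
begin

lemma p_nonneg: "i \<ge> 1 \<Longrightarrow> 0 \<le> p i" "i \<ge> Suc 0 \<Longrightarrow> 0 \<le> p i"
  using theta by (auto simp: p_def)

lemma p_le_inverse:
  assumes i: "i \<ge> 1"
  shows "p i \<le> max 1 \<theta> / real i"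
proof -
  have "real i * \<theta> \<le> max 1 \<theta> * (\<theta> + real i - 1)"
  proof (cases "\<theta> \<le> 1")
    case True
    have "\<theta> * (real i - 1) \<le> 1 * (real i - 1)" using True i by (intro mult_right_mono) auto
    then show ?thesis using True by (simp add: algebra_simps)
  next
    case False
    then have "\<theta> * real i \<le> \<theta> * (\<theta> + real i - 1)" using theta by (intro mult_left_mono) auto
    then show ?thesis using False by (simp add: mult.commute)
  qed
  then show ?thesis using i theta by (simp add: p_def divide_simps mult.commute)
qed

text \<open>Mean number of ones among the first \<open>m\<close> positions. The variance is smaller
  by a sum of squares that stays bounded, so \<open>H\<close> also serves as the variance.\<close>

definition H :: "nat \<Rightarrow> real" where "H m = (\<Sum>j=1..m. p j)"

lemma H_0 [simp]: "H 0 = 0" and H_Suc: "H (Suc m) = H m + p (Suc m)"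
  by (simp_all add: H_def)

lemma H_nonneg: "0 \<le> H m"
  unfolding H_def by (intro sum_nonneg) (auto intro: p_nonneg)

lemma H_mono: "m \<le> n \<Longrightarrow> H m \<le> H n"
  unfolding H_def by (rule sum_mono2) (auto intro: p_nonneg)

lemma H_le: "H m \<le> real m"
  unfolding H_def using sum_bounded_above[of "{1..m}" p 1] p_bounds(2) by simp

lemma sum_p: "a \<le> b \<Longrightarrow> (\<Sum>j\<in>{a<..b}. p j) = H b - H a"
proof (induction b rule: dec_induct)
  case (step n)
  then have "{a<..Suc n} = insert (Suc n) {a<..n}" by auto
  then show ?case using step by (simp add: H_Suc)
qed simp

text \<open>The 1 is the error at \<open>m = 1\<close>, where \<open>H 1 = 1\<close> and the
  logarithm vanishes. The rest bounds the summed errors of the increments: \<open>\<theta>\<close>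
  from \<open>1/m\<close> against \<open>ln (m+1) - ln m\<close>, and
  \<open>2 * \<theta>\<^sup>2\<close> from \<open>p (Suc m)\<close> against
  \<open>\<theta>/m\<close>.\<close>

definition H_err :: real where "H_err = 1 + \<theta> + 2 * \<theta>\<^sup>2"

lemma H_err_ge: "H_err \<ge> 1"
  using theta by (simp add: H_err_def)

lemma H_approx:
  assumes "m \<ge> 1"
  shows "\<bar>H m - \<theta> * ln (real m)\<bar> \<le> H_err"
proof -
  define K where "K = \<theta> + 2 * \<theta>\<^sup>2"
  have K: "K \<ge> 0" using theta by (simp add: K_def)
  \<comment> \<open>\<open>1 - 1/m\<close> is the sum of \<open>1/(j * (j + 1))\<close> over
    \<open>1 \<le> j < m\<close>; every increment error is at most \<open>K\<close> times such a
    term.\<close>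
  have "\<bar>H m - \<theta> * ln (real m)\<bar> \<le> 1 + K * (1 - 1 / real m)"
    using assms
  proof (induction m rule: dec_induct)
    case base
    then show ?case by (simp add: H_def)
  next
    case (step m)
    then have m: "real m \<ge> 1" by simp
    define l where "l = ln (real (Suc m)) - ln (real m)"
    have "1 + 1 / real m = real (Suc m) / real m" using m by (simp add: field_simps)
    then have l_eq: "l = ln (1 + 1 / real m)"
      using m by (simp add: l_def ln_div del: of_nat_Suc)
    have l1: "l \<le> 1 / real m" unfolding l_eq by (intro ln_add_one_self_le_self) simp
    have "l = - ln (1 - 1 / real (Suc m))"
    proof -
      have "1 - 1 / real (Suc m) = real m / real (Suc m)" by (simp add: field_simps)
      then show ?thesis using m by (simp add: l_def ln_div del: of_nat_Suc)
    qed
    moreover have "ln (1 - 1 / real (Suc m)) \<le> (1 - 1 / real (Suc m)) - 1"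
      using m by (intro ln_le_minus_one) (simp add: field_simps)
    ultimately have l2: "1 / real (Suc m) \<le> l" by simp
    have d: "1 / real m - 1 / real (Suc m) = 1 / (real m * real (Suc m))"
      using m by (simp add: field_simps)
    have "\<bar>1 / real m - l\<bar> \<le> 1 / (real m * real (Suc m))" using l1 l2 d by linarith
    then have "\<theta> * \<bar>1 / real m - l\<bar> \<le> \<theta> * (1 / (real m * real (Suc m)))"
      using theta by (intro mult_left_mono) auto
    moreover have "\<theta> * \<bar>1 / real m - l\<bar> = \<bar>\<theta> / real m - \<theta> * l\<bar>"
      using theta abs_mult[of \<theta> "1 / real m - l"] by (simp add: right_diff_distrib)
    ultimately have e1: "\<bar>\<theta> / real m - \<theta> * l\<bar> \<le> \<theta> * (1 / (real m * real (Suc m)))" by linarith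
    have p: "p (Suc m) = \<theta> / (\<theta> + real m)" by (simp add: p_def)
    have "\<theta> / real m - \<theta> / (\<theta> + real m) = \<theta>\<^sup>2 / (real m * (\<theta> + real m))"
      using m theta by (simp add: field_simps power2_eq_square)
    moreover have "\<theta>\<^sup>2 / (real m * (\<theta> + real m)) \<le> 2 * \<theta>\<^sup>2 * (1 / (real m * real (Suc m)))"
    proof -
      have "\<theta>\<^sup>2 / (real m * (\<theta> + real m)) \<le> \<theta>\<^sup>2 / (real m * (real (Suc m) / 2))"
        using m theta by (intro divide_left_mono mult_left_mono mult_pos_pos) auto
      then show ?thesis by (simp add: mult_ac)
    qed
    moreover have "0 \<le> \<theta>\<^sup>2 / (real m * (\<theta> + real m))" using m theta by simp
    ultimately have e2: "\<bar>p (Suc m) - \<theta> / real m\<bar> \<le> 2 * \<theta>\<^sup>2 * (1 / (real m * real (Suc m)))"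
      unfolding p by linarith
    have "\<bar>p (Suc m) - \<theta> * l\<bar> \<le> K * (1 / (real m * real (Suc m)))"
      using e1 e2 unfolding K_def distrib_right by linarith
    moreover have "H (Suc m) - \<theta> * ln (real (Suc m)) = (H m - \<theta> * ln (real m)) + (p (Suc m) - \<theta> * l)"
      by (simp add: H_Suc l_def algebra_simps)
    moreover have "1 + K * (1 - 1 / real (Suc m)) = 1 + K * (1 - 1 / real m) + K * (1 / (real m * real (Suc m)))"
      unfolding d[symmetric] by (simp add: algebra_simps)
    ultimately show ?case using step.IH by linarith
  qed
  also have "\<dots> \<le> 1 + K * 1" using K by (intro add_left_mono mult_left_mono) auto
  finally show ?thesis by (simp add: H_err_def K_def)
qed

text \<open>Bounds the difference between \<open>H\<close> increments and true variances uniformly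
  in \<open>m\<close>, which makes it negligible against \<open>ln n\<close>. The 2 comes from
  comparing \<open>1/j^2\<close> with the telescoping \<open>1/(j - 1) - 1/j\<close>.\<close>

lemma sum_p_squared: "(\<Sum>j=1..m. (p j)\<^sup>2) \<le> 2 * (max 1 \<theta>)\<^sup>2"
proof -
  have "(\<Sum>j=1..m. (p j)\<^sup>2) \<le> (\<Sum>j=1..m. (max 1 \<theta>)\<^sup>2 * (1 / (real j)\<^sup>2))"
  proof (rule sum_mono)
    fix j assume "j \<in> {1..m}"
    then have "(p j)\<^sup>2 \<le> (max 1 \<theta> / real j)\<^sup>2"
      using p_le_inverse[of j] p_bounds(1)[of j] by (intro power_mono) auto
    then show "(p j)\<^sup>2 \<le> (max 1 \<theta>)\<^sup>2 * (1 / (real j)\<^sup>2)" by (simp add: power_divide)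
  qed
  also have "\<dots> = (max 1 \<theta>)\<^sup>2 * (\<Sum>j=1..m. 1 / (real j)\<^sup>2)" by (simp only: sum_distrib_left)
  also have "\<dots> \<le> (max 1 \<theta>)\<^sup>2 * 2"
  proof (intro mult_left_mono)
    show "(\<Sum>j=1..m. 1 / (real j)\<^sup>2) \<le> 2"
    proof (cases "m = 0")
      case False
      then have "m \<ge> 1" by simp
      then have "(\<Sum>j=1..m. 1 / (real j)\<^sup>2) \<le> 2 - 1 / real m"
      proof (induction m rule: dec_induct)
        case (step m)
        then have m: "real m \<ge> 1" by simp
        have "1 / (real (Suc m))\<^sup>2 \<le> 1 / (real m * real (Suc m))"
          using m by (intro divide_left_mono) (auto simp: power2_eq_square)
        also have "\<dots> = 1 / real m - 1 / real (Suc m)" using m by (simp add: field_simps)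
        finally show ?case using step.IH by simp
      qed simp
      also have "\<dots> \<le> 2" by simp
      finally show ?thesis .
    qed simp
  qed simp
  finally show ?thesis by (simp only: mult.commute)
qed

text \<open>Half-open blocks make adjacent sums add up and depend on disjoint coordinates.\<close>

definition cs :: "(nat \<Rightarrow> bool) \<Rightarrow> nat \<Rightarrow> nat \<Rightarrow> real" where
  "cs \<xi> a b = (\<Sum>j\<in>{a<..b}. of_bool (\<xi> j) - p j)"

lemma cs_trivial [simp]: "b \<le> a \<Longrightarrow> cs \<xi> a b = 0"
  by (simp add: cs_def)

lemma cs_add:
  assumes "a \<le> b" "b \<le> c"
  shows "cs \<xi> a c = cs \<xi> a b + cs \<xi> b c"
proof -
  have "{a<..c} = {a<..b} \<union> {b<..c}" using assms by auto
  then show ?thesis unfolding cs_def by (simp only:) (intro sum.union_disjoint, auto)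
qed

lemma cs_Suc: "a \<le> b \<Longrightarrow> cs \<xi> a (Suc b) = cs \<xi> a b + (of_bool (\<xi> (Suc b)) - p (Suc b))"
proof -
  have "{b<..Suc b} = {Suc b}" by auto
  then have "cs \<xi> b (Suc b) = of_bool (\<xi> (Suc b)) - p (Suc b)" by (simp add: cs_def)
  then show "a \<le> b \<Longrightarrow> ?thesis" using cs_add[of a b "Suc b" \<xi>] by simp
qed

lemma local_on_cs: "local_on {a<..b} (\<lambda>\<xi>. cs \<xi> a b)"
  unfolding cs_def by (intro local_on_sum local_on_compose[OF local_on_coord]) auto

lemma local_on_cs': "local_on {a<..b} (\<lambda>\<xi>. f (cs \<xi> a b))"
  by (rule local_on_compose[OF local_on_cs])

lemma local_on_coord': "local_on {i} (\<lambda>\<xi>. f (\<xi> i))"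
  by (rule local_on_compose[OF local_on_coord]) simp

lemma integrable_cs:
  fixes f :: "real \<Rightarrow> real"
  shows "integrable F (\<lambda>\<xi>. f (cs \<xi> a b))"
  by (rule integrable_local[OF _ _ local_on_cs']) auto

lemma integrable_coord:
  fixes f :: "bool \<Rightarrow> real"
  shows "i \<ge> 1 \<Longrightarrow> integrable F (\<lambda>\<xi>. f (\<xi> i))"
  by (rule integrable_local[OF _ _ local_on_coord']) auto

lemma sets_cs: "{\<xi> \<in> space F. P (cs \<xi> a b)} \<in> sets F"
  by (rule sets_local[OF _ _ local_on_cs']) auto

lemma expectation_centered: "j \<ge> 1 \<Longrightarrow> expectation (\<lambda>\<xi>. of_bool (\<xi> j) - p j) = 0"
  using expectation_coord[of j "\<lambda>b. of_bool b - p j"] by (simp add: algebra_simps)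

lemma expectation_centered_squared:
  "j \<ge> 1 \<Longrightarrow> expectation (\<lambda>\<xi>. (of_bool (\<xi> j) - p j)\<^sup>2) = p j * (1 - p j)"
  using expectation_coord[of j "\<lambda>b. (of_bool b - p j)\<^sup>2"] by (simp add: power2_eq_square algebra_simps)

lemma expectation_cs: "expectation (\<lambda>\<xi>. cs \<xi> a b) = 0"
proof -
  have "expectation (\<lambda>\<xi>. cs \<xi> a b) = (\<Sum>j\<in>{a<..b}. expectation (\<lambda>\<xi>. of_bool (\<xi> j) - p j))"
    unfolding cs_def by (intro Bochner_Integration.integral_sum integrable_coord) auto
  also have "\<dots> = 0" by (intro sum.neutral ballI expectation_centered) auto
  finally show ?thesis .
qed

text \<open>The cross term with the next indicator vanishes by independence, and the variance
  \<open>p * (1 - p)\<close> of that indicator is bounded by \<open>p\<close>.\<close>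

lemma expectation_cs_squared: "a \<le> b \<Longrightarrow> expectation (\<lambda>\<xi>. (cs \<xi> a b)\<^sup>2) \<le> H b - H a"
proof (induction b rule: dec_induct)
  case (step b)
  let ?X = "\<lambda>\<xi>. of_bool (\<xi> (Suc b)) - p (Suc b)"
  have prod: "expectation (\<lambda>\<xi>. cs \<xi> a b * ?X \<xi>) = expectation (\<lambda>\<xi>. cs \<xi> a b) * expectation ?X"
    by (rule expectation_mult_local[OF _ _ local_on_cs _ _ local_on_coord']) auto
  have intp: "integrable F (\<lambda>\<xi>. cs \<xi> a b * ?X \<xi>)"
  proof (rule integrable_local[of "{a<..Suc b}"])
    show "local_on {a<..Suc b} (\<lambda>\<xi>. cs \<xi> a b * ?X \<xi>)"
      using step.hyps
      by (intro local_on_compose2[of _ _ _ "(*)"] local_on_mono[OF local_on_cs] local_on_mono[OF local_on_coord']) auto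
  qed auto
  have "expectation (\<lambda>\<xi>. (cs \<xi> a (Suc b))\<^sup>2) =
      expectation (\<lambda>\<xi>. ((cs \<xi> a b)\<^sup>2 + 2 * (cs \<xi> a b * ?X \<xi>)) + (?X \<xi>)\<^sup>2)"
  proof -
    have "(x + y)\<^sup>2 = (x\<^sup>2 + 2 * (x * y)) + y\<^sup>2" for x y :: real by (simp add: power2_sum)
    then show ?thesis by (simp only: cs_Suc[OF step.hyps(1)])
  qed
  also have "\<dots> = expectation (\<lambda>\<xi>. (cs \<xi> a b)\<^sup>2 + 2 * (cs \<xi> a b * ?X \<xi>)) + expectation (\<lambda>\<xi>. (?X \<xi>)\<^sup>2)"
    by (intro Bochner_Integration.integral_add Bochner_Integration.integrable_add integrable_cs
        integrable_mult_right intp integrable_coord) auto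
  also have "expectation (\<lambda>\<xi>. (cs \<xi> a b)\<^sup>2 + 2 * (cs \<xi> a b * ?X \<xi>)) = expectation (\<lambda>\<xi>. (cs \<xi> a b)\<^sup>2) + expectation (\<lambda>\<xi>. 2 * (cs \<xi> a b * ?X \<xi>))"
    by (intro Bochner_Integration.integral_add integrable_cs integrable_mult_right intp)
  also have "expectation (\<lambda>\<xi>. 2 * (cs \<xi> a b * ?X \<xi>)) = 0"
    unfolding integral_mult_right_zero prod expectation_cs by simp
  also have "expectation (\<lambda>\<xi>. (?X \<xi>)\<^sup>2) = p (Suc b) * (1 - p (Suc b))"
    by (rule expectation_centered_squared) simp
  also have "\<dots> \<le> p (Suc b)" using p_bounds[of "Suc b"] by (simp add: mult_left_le)
  finally show ?case using step.IH by (simp add: H_Suc)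
qed simp

lemma markov_ineq:
  fixes f :: "(nat \<Rightarrow> bool) \<Rightarrow> real"
  assumes "{\<xi> \<in> space F. P \<xi>} \<in> sets F" "integrable F f" "\<And>\<xi>. of_bool (P \<xi>) \<le> f \<xi>"
  shows "prob {\<xi> \<in> space F. P \<xi>} \<le> expectation f"
proof -
  have "prob {\<xi> \<in> space F. P \<xi>} = expectation (indicator {\<xi> \<in> space F. P \<xi>})"
    using assms(1) by (simp add: emeasure_eq_measure)
  also have "\<dots> \<le> expectation f"
  proof (rule integral_mono)
    show "integrable F (indicator {\<xi> \<in> space F. P \<xi>} :: _ \<Rightarrow> real)"
      using assms(1) by (simp add: emeasure_eq_measure)
    fix \<xi>
    have "0 \<le> f \<xi>" using assms(3)[of \<xi>] by (cases "P \<xi>") auto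
    then show "indicator {\<xi> \<in> space F. P \<xi>} \<xi> \<le> f \<xi>"
      using assms(3)[of \<xi>] by (auto simp: indicator_def split: if_splits)
  qed (rule assms)
  finally show ?thesis .
qed

lemma chebyshev_cs:
  assumes "a \<le> b" "r > 0"
  shows "prob {\<xi> \<in> space F. \<bar>cs \<xi> a b\<bar> > r} \<le> (H b - H a) / r\<^sup>2"
proof -
  have "prob {\<xi> \<in> space F. \<bar>cs \<xi> a b\<bar> > r} \<le> expectation (\<lambda>\<xi>. (cs \<xi> a b)\<^sup>2 / r\<^sup>2)"
  proof (rule markov_ineq[OF sets_cs integrable_cs])
    fix \<xi>
    have "\<bar>cs \<xi> a b\<bar> > r \<Longrightarrow> r\<^sup>2 \<le> (cs \<xi> a b)\<^sup>2"
      using assms(2) power_mono[of r "\<bar>cs \<xi> a b\<bar>" 2] by simp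
    then show "of_bool (\<bar>cs \<xi> a b\<bar> > r) \<le> (cs \<xi> a b)\<^sup>2 / r\<^sup>2"
      using assms(2) by simp
  qed
  also have "\<dots> = expectation (\<lambda>\<xi>. (cs \<xi> a b)\<^sup>2) / r\<^sup>2" by simp
  also have "\<dots> \<le> (H b - H a) / r\<^sup>2"
    by (intro divide_right_mono expectation_cs_squared assms) simp
  finally show ?thesis .
qed

text \<open>Consider the first \<open>m\<close> at which the block sum exceeds \<open>2 * r\<close>
  in absolute value. The later block from \<open>m\<close> to \<open>b\<close> is independent of
  this event, and by Chebyshev and \<open>var\<close> it stays within \<open>r\<close> with
  probability at least 1/2; then the full sum exceeds \<open>r\<close>.\<close>

lemma ottaviani:
  assumes ab: "a \<le> b" and r: "r > 0" and var: "H b - H a \<le> r\<^sup>2 / 2"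
  shows "prob {\<xi> \<in> space F. \<exists>m\<in>{a..b}. \<bar>cs \<xi> a m\<bar> > 2 * r} \<le> 2 * prob {\<xi> \<in> space F. \<bar>cs \<xi> a b\<bar> > r}"
proof -
  define T where "T m \<xi> \<longleftrightarrow> \<bar>cs \<xi> a m\<bar> > 2 * r \<and> (\<forall>i\<in>{a..<m}. \<bar>cs \<xi> a i\<bar> \<le> 2 * r)" for m \<xi>
  define G where "G m \<xi> \<longleftrightarrow> \<bar>cs \<xi> m b\<bar> \<le> r" for m \<xi>
  have locT: "local_on {a<..m} (T m)" for m
  proof (rule local_onI)
    fix \<xi> \<xi>' :: "nat \<Rightarrow> bool" assume eq: "\<And>i. i \<in> {a<..m} \<Longrightarrow> \<xi> i = \<xi>' i"
    have "cs \<xi> a i = cs \<xi>' a i" if "i \<le> m" for i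
      using that eq by (intro local_onD[OF local_on_cs]) auto
    then show "T m \<xi> = T m \<xi>'" unfolding T_def by auto
  qed
  have locG: "local_on {m<..b} (G m)" for m
    unfolding G_def by (rule local_on_cs')
  have sT: "{\<xi> \<in> space F. T m \<xi>} \<in> sets F" for m
    by (rule sets_local[OF _ _ locT]) auto
  have sG: "{\<xi> \<in> space F. G m \<xi>} \<in> sets F" for m
    by (rule sets_local[OF _ _ locG]) auto
  have sTG: "{\<xi> \<in> space F. T m \<xi> \<and> G m \<xi>} \<in> sets F" for m
  proof -
    have "{\<xi> \<in> space F. T m \<xi> \<and> G m \<xi>} = {\<xi> \<in> space F. T m \<xi>} \<inter> {\<xi> \<in> space F. G m \<xi>}" by auto
    then show ?thesis using sT sG by simp
  qed
  have half: "prob {\<xi> \<in> space F. G m \<xi>} \<ge> 1 / 2" if m: "m \<in> {a..b}" for m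
  proof -
    have "prob {\<xi> \<in> space F. \<bar>cs \<xi> m b\<bar> > r} \<le> (H b - H m) / r\<^sup>2"
      using m r by (intro chebyshev_cs) auto
    also have "\<dots> \<le> (r\<^sup>2 / 2) / r\<^sup>2"
      using var H_mono[of a m] m by (intro divide_right_mono) auto
    also have "\<dots> = 1 / 2" using r by simp
    finally have "prob {\<xi> \<in> space F. \<not> G m \<xi>} \<le> 1 / 2" by (simp add: G_def not_le)
    moreover have "prob {\<xi> \<in> space F. \<not> G m \<xi>} = 1 - prob {\<xi> \<in> space F. G m \<xi>}"
      by (rule prob_neg[OF sG])
    ultimately show ?thesis by simp
  qed
  have first: "\<exists>m\<in>{a..b}. T m \<xi>" if "m \<in> {a..b}" "\<bar>cs \<xi> a m\<bar> > 2 * r" for m \<xi>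
    using that
  proof (induction m rule: less_induct)
    case (less m)
    show ?case
    proof (cases "T m \<xi>")
      case False
      then obtain i where "i \<in> {a..<m}" "\<bar>cs \<xi> a i\<bar> > 2 * r" using less.prems by (force simp: T_def)
      then show ?thesis using less.IH[of i] less.prems by auto
    qed (use less.prems in blast)
  qed
  have eq: "{\<xi> \<in> space F. \<exists>m\<in>{a..b}. \<bar>cs \<xi> a m\<bar> > 2 * r} = (\<Union>m\<in>{a..b}. {\<xi> \<in> space F. T m \<xi>})"
    using first by (auto simp: T_def)
  have T_unique: "m = n" if "T m \<xi>" "T n \<xi>" "m \<in> {a..b}" "n \<in> {a..b}" for m n \<xi>
    using that by (cases m n rule: linorder_cases) (force simp: T_def)+
  have disj: "disjoint_family_on (\<lambda>m. {\<xi> \<in> space F. T m \<xi>}) {a..b}"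
    "disjoint_family_on (\<lambda>m. {\<xi> \<in> space F. T m \<xi> \<and> G m \<xi>}) {a..b}"
    unfolding disjoint_family_on_def using T_unique by blast+
  have "prob {\<xi> \<in> space F. \<exists>m\<in>{a..b}. \<bar>cs \<xi> a m\<bar> > 2 * r} = (\<Sum>m\<in>{a..b}. prob {\<xi> \<in> space F. T m \<xi>})"
    unfolding eq using disj(1) sT by (intro finite_measure_finite_Union) auto
  also have "\<dots> \<le> (\<Sum>m\<in>{a..b}. 2 * prob {\<xi> \<in> space F. T m \<xi> \<and> G m \<xi>})"
  proof (rule sum_mono)
    fix m assume m: "m \<in> {a..b}"
    have "prob {\<xi> \<in> space F. T m \<xi> \<and> G m \<xi>} = prob {\<xi> \<in> space F. T m \<xi>} * prob {\<xi> \<in> space F. G m \<xi>}"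
      by (rule prob_conj_local[OF _ _ locT _ _ locG]) auto
    moreover have "prob {\<xi> \<in> space F. T m \<xi>} * prob {\<xi> \<in> space F. G m \<xi>} \<ge> prob {\<xi> \<in> space F. T m \<xi>} * (1 / 2)"
      by (intro mult_left_mono half m) auto
    ultimately show "prob {\<xi> \<in> space F. T m \<xi>} \<le> 2 * prob {\<xi> \<in> space F. T m \<xi> \<and> G m \<xi>}" by simp
  qed
  also have "\<dots> = 2 * (\<Sum>m\<in>{a..b}. prob {\<xi> \<in> space F. T m \<xi> \<and> G m \<xi>})"
    by (simp only: sum_distrib_left)
  also have "(\<Sum>m\<in>{a..b}. prob {\<xi> \<in> space F. T m \<xi> \<and> G m \<xi>}) = prob (\<Union>m\<in>{a..b}. {\<xi> \<in> space F. T m \<xi> \<and> G m \<xi>})"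
    using disj(2) sTG by (intro finite_measure_finite_Union[symmetric]) auto
  also have "2 * \<dots> \<le> 2 * prob {\<xi> \<in> space F. \<bar>cs \<xi> a b\<bar> > r}"
  proof (intro mult_left_mono finite_measure_mono sets_cs)
    show "(\<Union>m\<in>{a..b}. {\<xi> \<in> space F. T m \<xi> \<and> G m \<xi>}) \<subseteq> {\<xi> \<in> space F. \<bar>cs \<xi> a b\<bar> > r}"
    proof safe
      fix m \<xi> assume "m \<in> {a..b}" "T m \<xi>" "G m \<xi>"
      then show "\<bar>cs \<xi> a b\<bar> > r" using cs_add[of a m b \<xi>] by (auto simp: T_def G_def)
    qed
  qed simp
  finally show ?thesis .
qed

text \<open>The bad event: a gap of length at most \<open>j / c\<close> starting at
  \<open>j\<close>. Its negation is the gap hypothesis of \<open>parts_upto_le_ones\<close>; ranging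
  over all pairs of ones, not just consecutive ones, makes a first-moment bound immediate.\<close>

definition close_ones :: "nat \<Rightarrow> nat \<Rightarrow> (nat \<Rightarrow> bool) \<Rightarrow> bool" where
  "close_ones n c \<xi> \<longleftrightarrow> (\<exists>j l. 1 \<le> j \<and> j < l \<and> l \<le> n \<and> \<xi> j \<and> \<xi> l \<and> c * (l - j) \<le> j)"

lemma local_on_close_ones: "local_on {1..n} (close_ones n c)"
proof (rule local_onI)
  fix \<xi> \<xi>' :: "nat \<Rightarrow> bool" assume eq: "\<And>i. i \<in> {1..n} \<Longrightarrow> \<xi> i = \<xi>' i"
  have "1 \<le> j \<and> j < l \<and> l \<le> n \<and> \<xi> j \<and> \<xi> l \<and> c * (l - j) \<le> j \<longleftrightarrow>
      1 \<le> j \<and> j < l \<and> l \<le> n \<and> \<xi>' j \<and> \<xi>' l \<and> c * (l - j) \<le> j" for j l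
    using eq[of j] eq[of l] by auto
  then show "close_ones n c \<xi> = close_ones n c \<xi>'" unfolding close_ones_def by (simp only:)
qed

text \<open>First-moment bound: each \<open>j\<close> has at most \<open>j / c\<close> partners
  \<open>l\<close>, and each is a one with probability at most \<open>max 1 \<theta> / j\<close>.
  The factors \<open>j\<close> cancel, and summing \<open>p j\<close> leaves
  \<open>H n / c\<close>.\<close>

lemma prob_close_ones:
  assumes c: "c \<ge> 1"
  shows "prob {\<xi> \<in> space F. close_ones n c \<xi>} \<le> max 1 \<theta> * H n / real c"
proof -
  define g where "g j l \<xi> = (of_bool (\<xi> j) * of_bool (\<xi> l) :: real)" for j l and \<xi> :: "nat \<Rightarrow> bool"
  \<comment> \<open>The inner range may exceed \<open>n\<close>; the extra terms are nonnegative and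
    only weaken the bound.\<close>
  define f where "f \<xi> = (\<Sum>j=1..n. \<Sum>l\<in>{j<..j + j div c}. g j l \<xi>)" for \<xi>
  have g0: "g j l \<xi> \<ge> 0" for j l \<xi> by (simp add: g_def)
  have loc: "local_on {j, l} (g j l)" for j l
    unfolding g_def by (intro local_on_compose2[of _ _ _ "(*)"] local_on_compose[OF local_on_coord]) auto
  have int: "integrable F (g j l)" if "j \<ge> 1" "l \<ge> 1" for j l
    using that by (intro integrable_local[OF _ _ loc]) auto
  have "prob {\<xi> \<in> space F. close_ones n c \<xi>} \<le> expectation f"
  proof (rule markov_ineq)
    show "{\<xi> \<in> space F. close_ones n c \<xi>} \<in> sets F"
      by (rule sets_local[OF _ _ local_on_close_ones]) auto
    show "integrable F f" unfolding f_def by (intro Bochner_Integration.integrable_sum int) auto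
    fix \<xi>
    show "of_bool (close_ones n c \<xi>) \<le> f \<xi>"
    proof (cases "close_ones n c \<xi>")
      case True
      then obtain j l where jl: "1 \<le> j" "j < l" "l \<le> n" "\<xi> j" "\<xi> l" "c * (l - j) \<le> j"
        unfolding close_ones_def by blast
      have "l - j \<le> j div c" using jl(6) c by (simp add: less_eq_div_iff_mult_less_eq mult.commute)
      then have l: "l \<in> {j<..j + j div c}" using jl(2) by auto
      have "1 = g j l \<xi>" using jl by (simp add: g_def)
      also have "\<dots> \<le> (\<Sum>l\<in>{j<..j + j div c}. g j l \<xi>)"
        by (intro member_le_sum l g0) auto
      also have "\<dots> \<le> f \<xi>"
        unfolding f_def using jl by (intro member_le_sum sum_nonneg g0) auto
      finally show ?thesis using True by simp
    next
      case False
      have "0 \<le> f \<xi>" unfolding f_def by (intro sum_nonneg g0)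
      then show ?thesis using False by simp
    qed
  qed
  also have "expectation f = (\<Sum>j=1..n. expectation (\<lambda>\<xi>. \<Sum>l\<in>{j<..j + j div c}. g j l \<xi>))"
    unfolding f_def
    by (intro Bochner_Integration.integral_sum Bochner_Integration.integrable_sum int) auto
  also have "\<dots> = (\<Sum>j=1..n. \<Sum>l\<in>{j<..j + j div c}. expectation (g j l))"
    by (intro sum.cong refl Bochner_Integration.integral_sum int) auto
  also have "\<dots> = (\<Sum>j=1..n. \<Sum>l\<in>{j<..j + j div c}. p j * p l)"
  proof (intro sum.cong refl)
    fix j l assume jl: "j \<in> {1..n}" "l \<in> {j<..j + j div c}"
    then have "expectation (g j l) =
        expectation (\<lambda>\<xi>. of_bool (\<xi> j)) * expectation (\<lambda>\<xi>. of_bool (\<xi> l) :: real)"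
      unfolding g_def by (intro expectation_mult_local[OF _ _ local_on_coord' _ _ local_on_coord']) auto
    then show "expectation (g j l) = p j * p l"
      using jl expectation_coord[of j of_bool] expectation_coord[of l of_bool] by simp
  qed
  also have "\<dots> \<le> (\<Sum>j=1..n. p j * (max 1 \<theta> / real c))"
  proof (rule sum_mono)
    fix j assume j: "j \<in> {1..n}"
    then have pj: "0 \<le> p j" by (auto intro: p_nonneg)
    have "(\<Sum>l\<in>{j<..j + j div c}. p j * p l) \<le> (\<Sum>l\<in>{j<..j + j div c}. p j * (max 1 \<theta> / real j))"
    proof (intro sum_mono mult_left_mono pj)
      fix l assume l: "l \<in> {j<..j + j div c}"
      have "p l \<le> max 1 \<theta> / real l" using j l by (intro p_le_inverse) auto
      also have "\<dots> \<le> max 1 \<theta> / real j" using j l by (intro divide_left_mono) auto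
      finally show "p l \<le> max 1 \<theta> / real j" .
    qed
    also have "\<dots> = p j * (real (j div c) * (max 1 \<theta> / real j))" by simp
    also have "\<dots> \<le> p j * ((real j / real c) * (max 1 \<theta> / real j))"
      by (intro mult_left_mono mult_right_mono of_nat_div_le_of_nat pj) auto
    also have "\<dots> = p j * (max 1 \<theta> / real c)" using j by simp
    finally show "(\<Sum>l\<in>{j<..j + j div c}. p j * p l) \<le> p j * (max 1 \<theta> / real c)" .
  qed
  also have "\<dots> = H n * (max 1 \<theta> / real c)" by (simp only: H_def sum_distrib_right[symmetric])
  finally show ?thesis by (simp add: mult.commute)
qed

end

section \<open>Central limit theorem\<close>

text \<open>The centred normal law of variance \<open>v\<close> as a rescaled standard one, so that
  its characteristic function and moments follow by substitution.\<close>

definition gauss :: "real \<Rightarrow> real measure" where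
  "gauss v = distr std_normal_distribution borel (\<lambda>x. sqrt v * x)"

lemma real_distribution_gauss: "real_distribution (gauss v)"
proof -
  interpret real_distribution std_normal_distribution by (rule real_dist_normal_dist)
  show ?thesis unfolding gauss_def by (rule real_distribution_distr) simp
qed

lemma char_gauss:
  assumes "v \<ge> 0"
  shows "char (gauss v) t = complex_of_real (exp (- (v * t\<^sup>2) / 2))"
proof -
  have "char (gauss v) t = char std_normal_distribution (sqrt v * t)"
    unfolding char_def gauss_def by (subst integral_distr) (auto simp: mult_ac)
  then show ?thesis using assms by (simp add: char_std_normal_distribution power_mult_distrib)
qed

lemma gauss_fourth_moment:
  assumes "v \<ge> 0"
  shows "(LINT x|gauss v. x ^ 4) = 3 * v\<^sup>2" "integrable (gauss v) (\<lambda>x. x ^ 4)"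
proof -
  have sq: "(sqrt v) ^ 4 = v\<^sup>2"
    using assms power_mult[of "sqrt v" 2 2] by simp
  have "(LINT x|gauss v. x ^ 4) = (LINT x|std_normal_distribution. v\<^sup>2 * x ^ 4)"
    unfolding gauss_def by (subst integral_distr) (auto simp: power_mult_distrib sq)
  also have "\<dots> = v\<^sup>2 * (LINT x|std_normal_distribution. x ^ (2 * 2))" by simp
  also have "(LINT x|std_normal_distribution. x ^ (2 * 2)) = 3"
    unfolding std_normal_distribution_even_moments by (simp add: fact_numeral)
  finally show "(LINT x|gauss v. x ^ 4) = 3 * v\<^sup>2" by simp
  show "integrable (gauss v) (\<lambda>x. x ^ 4)"
    unfolding gauss_def
    by (subst integrable_distr_eq) (auto simp: power_mult_distrib integrable_std_normal_distribution_moment)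
qed

lemma distr_normal_gauss:
  assumes M: "prob_space M" and D: "distributed M lborel X (normal_density 0 (sqrt v))" and v: "v > 0"
  shows "distr M borel X = gauss v"
proof -
  interpret prob_space M by fact
  have "distributed M lborel (\<lambda>x. (X x - 0) / sqrt v) std_normal_density"
    using D normal_standard_normal_convert[of "sqrt v" X 0] v by simp
  then have std: "distr M lborel (\<lambda>x. X x / sqrt v) = std_normal_distribution" 
    and [measurable]: "(\<lambda>x. X x / sqrt v) \<in> borel_measurable M"
    using distributed_distr_eq_density distributed_measurable by fastforce+
  have [measurable]: "X \<in> borel_measurable M" using distributed_measurable[OF D] by simp
  have "gauss v = distr (distr M lborel (\<lambda>x. X x / sqrt v)) borel (\<lambda>x. sqrt v * x)"
    unfolding gauss_def std ..
  also have "\<dots> = distr M borel ((\<lambda>x. sqrt v * x) \<circ> (\<lambda>x. X x / sqrt v))"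
    by (rule distr_distr) auto
  also have "\<dots> = distr M borel X" using v by (simp add: comp_def)
  finally show ?thesis ..
qed

lemma exp_minus_quadratic:
  assumes "(x::real) \<ge> 0"
  shows "\<bar>(1 - x) - exp (- x)\<bar> \<le> x\<^sup>2"
proof -
  have "exp (- x) \<le> 1 / (1 + x)"
    using exp_ge_add_one_self[of x] assms by (simp add: exp_minus divide_simps)
  also have "\<dots> \<le> 1 - x + x\<^sup>2"
  proof -
    have "(1 - x + x\<^sup>2) * (1 + x) = 1 + x ^ 3" by (simp add: algebra_simps power2_eq_square power3_eq_cube)
    then show ?thesis using assms by (simp add: divide_le_eq)
  qed
  finally show ?thesis using exp_ge_add_one_self[of "- x"] by simp
qed

context feller
begin

lemma borel_measurable_cs [measurable]: "(\<lambda>\<xi>. cs \<xi> a b) \<in> borel_measurable F"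
  by (rule measurable_local[OF _ _ local_on_cs]) auto

text \<open>The error must be linear in \<open>p j\<close> so that it sums to an \<open>H\<close>
  increment. Since the centred indicator is bounded by 1, its third absolute moment is at most its
  variance, and the variance is at most \<open>p j\<close>.\<close>

lemma char_centered:
  assumes j: "j \<ge> 1"
  shows "cmod (char (distr F borel (\<lambda>\<xi>. of_bool (\<xi> j) - p j)) u - exp (- (u\<^sup>2 * (p j * (1 - p j)) / 2)))
    \<le> (\<bar>u\<bar> ^ 3 + u ^ 4) * p j"
proof -
  let ?X = "\<lambda>\<xi>. of_bool (\<xi> j) - p j"
  define v where "v = p j * (1 - p j)"
  have v: "0 \<le> v" "v \<le> p j" "v \<le> 1"
    using p_bounds[OF j] by (auto simp: v_def mult_left_le mult_le_one)
  have meas: "?X \<in> borel_measurable F"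
    by (rule measurable_local[OF _ _ local_on_coord']) (use j in auto)
  have var: "variance ?X = v"
    using expectation_centered[OF j] expectation_centered_squared[OF j] by (simp add: v_def)
  have "cmod (char (distr F borel ?X) u - (1 - u\<^sup>2 * v / 2)) \<le>
      (u\<^sup>2 / 6) * expectation (\<lambda>\<xi>. min (6 * (?X \<xi>)\<^sup>2) (\<bar>u\<bar> * \<bar>?X \<xi>\<bar> ^ 3))"
    by (rule char_approx3'[OF meas _ _ expectation_centered[OF j] var refl])
      (use j integrable_coord[of j "\<lambda>b. of_bool b - p j"] integrable_coord[of j "\<lambda>b. (of_bool b - p j)\<^sup>2"] in auto)
  also have "\<dots> \<le> (u\<^sup>2 / 6) * expectation (\<lambda>\<xi>. \<bar>u\<bar> * (?X \<xi>)\<^sup>2)"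
  proof (intro mult_left_mono integral_mono)
    fix \<xi>
    have "\<bar>?X \<xi>\<bar> \<le> 1" using p_bounds[OF j] by (cases "\<xi> j") auto
    then have "\<bar>?X \<xi>\<bar> ^ 3 \<le> \<bar>?X \<xi>\<bar> ^ 2" by (intro power_decreasing) auto
    then have "\<bar>u\<bar> * \<bar>?X \<xi>\<bar> ^ 3 \<le> \<bar>u\<bar> * (?X \<xi>)\<^sup>2" by (intro mult_left_mono) auto
    then show "min (6 * (?X \<xi>)\<^sup>2) (\<bar>u\<bar> * \<bar>?X \<xi>\<bar> ^ 3) \<le> \<bar>u\<bar> * (?X \<xi>)\<^sup>2" by (rule min.coboundedI2)
  next
    show "integrable F (\<lambda>\<xi>. min (6 * (?X \<xi>)\<^sup>2) (\<bar>u\<bar> * \<bar>?X \<xi>\<bar> ^ 3))"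
      by (rule integrable_coord[OF j, of "\<lambda>b. min (6 * (of_bool b - p j)\<^sup>2) (\<bar>u\<bar> * \<bar>of_bool b - p j\<bar> ^ 3)"])
    show "integrable F (\<lambda>\<xi>. \<bar>u\<bar> * (?X \<xi>)\<^sup>2)"
      by (rule integrable_coord[OF j, of "\<lambda>b. \<bar>u\<bar> * (of_bool b - p j)\<^sup>2"])
  qed simp
  also have "expectation (\<lambda>\<xi>. \<bar>u\<bar> * (?X \<xi>)\<^sup>2) = \<bar>u\<bar> * v"
    unfolding integral_mult_right_zero expectation_centered_squared[OF j] v_def ..
  also have "(u\<^sup>2 / 6) * (\<bar>u\<bar> * v) = (\<bar>u\<bar> ^ 3 / 6) * v"
    by (simp add: power3_eq_cube power2_eq_square)
  also have "\<dots> \<le> \<bar>u\<bar> ^ 3 * p j" using v by (intro mult_mono) auto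
  finally have 1: "cmod (char (distr F borel ?X) u - (1 - u\<^sup>2 * v / 2)) \<le> \<bar>u\<bar> ^ 3 * p j" .
  have "\<bar>(1 - u\<^sup>2 * v / 2) - exp (- (u\<^sup>2 * v / 2))\<bar> \<le> (u\<^sup>2 * v / 2)\<^sup>2"
    using v by (intro exp_minus_quadratic) auto
  also have "\<dots> = u ^ 4 * (v * (v / 4))" by (simp add: power2_eq_square power4_eq_xxxx)
  also have "\<dots> \<le> u ^ 4 * (p j * 1)" using v p_bounds[OF j] by (intro mult_left_mono mult_mono) auto
  finally have 2: "cmod (complex_of_real (1 - u\<^sup>2 * v / 2) - complex_of_real (exp (- (u\<^sup>2 * v / 2)))) \<le> u ^ 4 * p j"
    by (simp only: of_real_diff[symmetric] norm_of_real mult_1_right real_norm_def)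
  show ?thesis
    unfolding v_def[symmetric]
    using norm_triangle_ineq[of "char (distr F borel ?X) u - complex_of_real (1 - u\<^sup>2 * v / 2)"
      "complex_of_real (1 - u\<^sup>2 * v / 2) - complex_of_real (exp (- (u\<^sup>2 * v / 2)))"] 1 2
    by (simp add: distrib_right)
qed

text \<open>Both products have factors in the closed unit disc, so their difference is at most the
  sum of the differences of factors.\<close>

lemma char_cs:
  assumes ab: "a \<le> b"
  shows "cmod (char (distr F borel (\<lambda>\<xi>. cs \<xi> a b)) u - exp (- (u\<^sup>2 * (\<Sum>j\<in>{a<..b}. p j * (1 - p j)) / 2)))
    \<le> (\<bar>u\<bar> ^ 3 + u ^ 4) * (H b - H a)"
proof -
  let ?X = "\<lambda>j \<xi>. of_bool (\<xi> j) - p j"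
  let ?e = "\<lambda>j. complex_of_real (exp (- (u\<^sup>2 * (p j * (1 - p j)) / 2)))"
  have meas: "?X j \<in> borel_measurable F" if "j \<in> {a<..b}" for j
    by (rule measurable_local[OF _ _ local_on_coord']) (use that in auto)
  have "indep_vars (\<lambda>_. borel) ?X {a<..b}"
    by (rule indep_vars_local[where K = "\<lambda>j. {j}"])
      (auto simp: disjoint_family_on_def intro: local_on_coord')
  then have eq: "char (distr F borel (\<lambda>\<xi>. cs \<xi> a b)) u = (\<Prod>j\<in>{a<..b}. char (distr F borel (?X j)) u)"
    unfolding cs_def by (rule char_distr_sum)
  have "(\<Prod>j\<in>{a<..b}. ?e j) = complex_of_real (exp (- (u\<^sup>2 * (\<Sum>j\<in>{a<..b}. p j * (1 - p j)) / 2)))"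
    by (simp add: exp_sum[symmetric] sum_negf sum_distrib_left sum_divide_distrib flip: of_real_prod)
  then have "cmod (char (distr F borel (\<lambda>\<xi>. cs \<xi> a b)) u - exp (- (u\<^sup>2 * (\<Sum>j\<in>{a<..b}. p j * (1 - p j)) / 2)))
      = cmod ((\<Prod>j\<in>{a<..b}. char (distr F borel (?X j)) u) - (\<Prod>j\<in>{a<..b}. ?e j))"
    unfolding eq by simp
  also have "\<dots> \<le> (\<Sum>j\<in>{a<..b}. cmod (char (distr F borel (?X j)) u - ?e j))"
  proof (rule norm_prod_diff)
    fix j assume j: "j \<in> {a<..b}"
    interpret D: real_distribution "distr F borel (?X j)"
      by (rule real_distribution_distr) (rule meas[OF j])
    show "cmod (char (distr F borel (?X j)) u) \<le> 1" by (rule D.cmod_char_le_1)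
    show "cmod (?e j) \<le> 1" using p_bounds[of j] j by (simp add: norm_of_real)
  qed
  also have "\<dots> \<le> (\<Sum>j\<in>{a<..b}. (\<bar>u\<bar> ^ 3 + u ^ 4) * p j)"
    by (intro sum_mono char_centered) auto
  also have "\<dots> = (\<bar>u\<bar> ^ 3 + u ^ 4) * (H b - H a)"
    by (simp only: sum_distrib_left[symmetric] sum_p[OF ab])
  finally show ?thesis .
qed

text \<open>Evaluating \<open>char_cs\<close> at \<open>t / s n\<close> leaves an error of order
  \<open>1 / s n\<close>, because the \<open>H\<close> increment is at most of order
  \<open>(s n)\<^sup>2\<close>. The exponent contains the true variance \<open>V n\<close>, whose
  distance from the \<open>H\<close> increment is bounded by \<open>sum_p_squared\<close>.\<close>

lemma clt_cs:
  assumes ab: "\<forall>\<^sub>F n in sequentially. a n \<le> b n" and s: "filterlim s at_top sequentially"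
    and lim: "(\<lambda>n. (H (b n) - H (a n)) / (s n)\<^sup>2) \<longlonglongrightarrow> v" and v: "v \<ge> 0"
  shows "weak_conv_m (\<lambda>n. distr F borel (\<lambda>\<xi>. cs \<xi> (a n) (b n) / s n)) (gauss v)"
proof (rule levy_continuity)
  show "real_distribution (distr F borel (\<lambda>\<xi>. cs \<xi> (a n) (b n) / s n))" for n
    by (rule real_distribution_distr) simp
  show "real_distribution (gauss v)" by (rule real_distribution_gauss)
  fix t
  define V where "V n = (\<Sum>j\<in>{a n<..b n}. p j * (1 - p j))" for n
  have s_pos: "\<forall>\<^sub>F n in sequentially. s n > 0" using s by (simp add: filterlim_at_top_dense)
  have inv: "(\<lambda>n. 1 / s n) \<longlonglongrightarrow> 0"
    using tendsto_inverse_0_at_top[OF s] by (simp add: inverse_eq_divide)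
  have char_scale: "char (distr F borel (\<lambda>\<xi>. cs \<xi> (a n) (b n) / s n)) t =
      char (distr F borel (\<lambda>\<xi>. cs \<xi> (a n) (b n))) (t / s n)" for n
    unfolding char_def by (subst (1 2) integral_distr) auto
  have V_lim: "(\<lambda>n. V n / (s n)\<^sup>2) \<longlonglongrightarrow> v"
  proof -
    have "(\<lambda>n. 2 * (max 1 \<theta>)\<^sup>2 * (1 / s n * (1 / s n))) \<longlonglongrightarrow> 2 * (max 1 \<theta>)\<^sup>2 * (0 * 0)"
      by (intro tendsto_intros inv)
    then have z: "(\<lambda>n. 2 * (max 1 \<theta>)\<^sup>2 / (s n)\<^sup>2) \<longlonglongrightarrow> 0" by (simp add: power2_eq_square)
    have "(\<lambda>n. V n / (s n)\<^sup>2 - (H (b n) - H (a n)) / (s n)\<^sup>2) \<longlonglongrightarrow> 0"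
    proof (rule Lim_null_comparison[OF _ z])
      show "\<forall>\<^sub>F n in sequentially. norm (V n / (s n)\<^sup>2 - (H (b n) - H (a n)) / (s n)\<^sup>2) \<le> 2 * (max 1 \<theta>)\<^sup>2 / (s n)\<^sup>2"
        using ab
      proof eventually_elim
        case (elim n)
        have "H (b n) - H (a n) - V n = (\<Sum>j\<in>{a n<..b n}. (p j)\<^sup>2)"
          unfolding V_def sum_p[OF elim, symmetric] sum_subtractf[symmetric]
          by (intro sum.cong) (auto simp: power2_eq_square algebra_simps)
        moreover have "(\<Sum>j\<in>{a n<..b n}. (p j)\<^sup>2) \<le> (\<Sum>j=1..b n. (p j)\<^sup>2)" by (intro sum_mono2) auto
        moreover have "0 \<le> (\<Sum>j\<in>{a n<..b n}. (p j)\<^sup>2)" by (intro sum_nonneg) auto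
        ultimately have "\<bar>V n - (H (b n) - H (a n))\<bar> \<le> 2 * (max 1 \<theta>)\<^sup>2"
          using sum_p_squared[of "b n"] by linarith
        then show ?case unfolding diff_divide_distrib[symmetric] by (simp add: divide_right_mono)
      qed
    qed
    from tendsto_add[OF this lim] show ?thesis by simp
  qed
  have "(\<lambda>n. (\<bar>t\<bar> ^ 3 * (1 / s n) + t ^ 4 * (1 / s n * (1 / s n))) * ((H (b n) - H (a n)) / (s n)\<^sup>2)) \<longlonglongrightarrow>
      (\<bar>t\<bar> ^ 3 * 0 + t ^ 4 * (0 * 0)) * v"
    by (intro tendsto_intros inv lim)
  then have err: "(\<lambda>n. (\<bar>t\<bar> ^ 3 * (1 / s n) + t ^ 4 * (1 / s n * (1 / s n))) * ((H (b n) - H (a n)) / (s n)\<^sup>2)) \<longlonglongrightarrow> 0"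
    by simp
  have "(\<lambda>n. char (distr F borel (\<lambda>\<xi>. cs \<xi> (a n) (b n) / s n)) t -
      complex_of_real (exp (- (V n / (s n)\<^sup>2 * t\<^sup>2) / 2))) \<longlonglongrightarrow> 0"
  proof (rule Lim_null_comparison[OF _ err])
    show "\<forall>\<^sub>F n in sequentially. norm (char (distr F borel (\<lambda>\<xi>. cs \<xi> (a n) (b n) / s n)) t -
      complex_of_real (exp (- (V n / (s n)\<^sup>2 * t\<^sup>2) / 2))) \<le>
      (\<bar>t\<bar> ^ 3 * (1 / s n) + t ^ 4 * (1 / s n * (1 / s n))) * ((H (b n) - H (a n)) / (s n)\<^sup>2)"
      using ab s_pos
    proof eventually_elim
      case (elim n)
      have "(\<bar>t / s n\<bar> ^ 3 + (t / s n) ^ 4) * (H (b n) - H (a n)) =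
          (\<bar>t\<bar> ^ 3 * (1 / s n) + t ^ 4 * (1 / s n * (1 / s n))) * ((H (b n) - H (a n)) / (s n)\<^sup>2)"
        using elim(2) by (simp add: field_simps power_divide power2_eq_square power3_eq_cube power4_eq_xxxx)
      moreover have "- ((t / s n)\<^sup>2 * V n / 2) = - (V n / (s n)\<^sup>2 * t\<^sup>2) / 2"
        by (simp add: power_divide)
      ultimately show ?case
        using char_cs[OF elim(1), of "t / s n"] unfolding char_scale V_def[symmetric] by simp
    qed
  qed
  moreover have "(\<lambda>n. complex_of_real (exp (- (V n / (s n)\<^sup>2 * t\<^sup>2) / 2))) \<longlonglongrightarrow> complex_of_real (exp (- (v * t\<^sup>2) / 2))"
    by (intro tendsto_intros V_lim) auto
  ultimately have "(\<lambda>n. (char (distr F borel (\<lambda>\<xi>. cs \<xi> (a n) (b n) / s n)) t -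
      complex_of_real (exp (- (V n / (s n)\<^sup>2 * t\<^sup>2) / 2))) + complex_of_real (exp (- (V n / (s n)\<^sup>2 * t\<^sup>2) / 2)))
      \<longlonglongrightarrow> 0 + complex_of_real (exp (- (v * t\<^sup>2) / 2))"
    by (rule tendsto_add)
  then show "(\<lambda>n. char (distr F borel (\<lambda>\<xi>. cs \<xi> (a n) (b n) / s n)) t) \<longlonglongrightarrow> char (gauss v) t"
    by (simp add: char_gauss[OF v])
qed

end

section \<open>Weak convergence of independent families\<close>

lemma indep_vars_PiM_coordinates:
  assumes M: "\<And>i. i \<in> I \<Longrightarrow> prob_space (M i)" and "I \<noteq> {}"
  shows "prob_space.indep_vars (PiM I M) M (\<lambda>i \<omega>. \<omega> i) I"
proof -
  interpret P: prob_space "PiM I M" using M by (rule prob_space_PiM)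
  show ?thesis
  proof (subst P.indep_vars_iff_distr_eq_PiM'[OF assms(2)])
    have "distr (PiM I M) (PiM I M) (\<lambda>x. \<lambda>i\<in>I. x i) = distr (PiM I M) (PiM I M) (\<lambda>x. x)"
      by (rule distr_cong) (auto simp: space_PiM PiE_def extensional_restrict)
    also have "\<dots> = PiM I M" by (rule distr_id2) simp
    also have "\<dots> = PiM I (\<lambda>i. distr (PiM I M) (M i) (\<lambda>\<omega>. \<omega> i))"
      using M by (intro PiM_cong) (simp_all add: distr_PiM_component)
    finally show "distr (PiM I M) (PiM I M) (\<lambda>x. \<lambda>i\<in>I. x i) =
        PiM I (\<lambda>i. distr (PiM I M) (M i) (\<lambda>\<omega>. \<omega> i))" .
  qed simp
qed

text \<open>Allows the almost sure representations of the single coordinates to be put together on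
  the product of their spaces without changing the product law.\<close>

lemma distr_PiM_components:
  assumes \<Omega>: "\<And>i. i \<in> I \<Longrightarrow> prob_space (\<Omega> i)" and I: "I \<noteq> {}"
    and Y: "\<And>i. i \<in> I \<Longrightarrow> Y i \<in> \<Omega> i \<rightarrow>\<^sub>M N i"
  shows "distr (PiM I \<Omega>) (PiM I N) (\<lambda>\<omega>. \<lambda>i\<in>I. Y i (\<omega> i)) = PiM I (\<lambda>i. distr (\<Omega> i) (N i) (Y i))"
proof -
  interpret P: prob_space "PiM I \<Omega>" using \<Omega> by (rule prob_space_PiM)
  have comp: "(\<lambda>\<omega>. Y i (\<omega> i)) \<in> PiM I \<Omega> \<rightarrow>\<^sub>M N i" if "i \<in> I" for i
    by (rule measurable_compose[where f = "\<lambda>\<omega>. \<omega> i" and N = "\<Omega> i"]) (use that Y in auto)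
  have "P.indep_vars N (\<lambda>i \<omega>. Y i (\<omega> i)) I"
    by (rule P.indep_vars_compose2[OF indep_vars_PiM_coordinates[OF \<Omega> I]]) (use Y in auto)
  then have "distr (PiM I \<Omega>) (PiM I N) (\<lambda>\<omega>. \<lambda>i\<in>I. Y i (\<omega> i)) =
      PiM I (\<lambda>i. distr (PiM I \<Omega>) (N i) (\<lambda>\<omega>. Y i (\<omega> i)))"
    using P.indep_vars_iff_distr_eq_PiM'[OF I, where M' = N and X = "\<lambda>i \<omega>. Y i (\<omega> i)"] comp by simp
  also have "\<dots> = PiM I (\<lambda>i. distr (\<Omega> i) (N i) (Y i))"
  proof (intro PiM_cong refl)
    fix i assume i: "i \<in> I"
    have "distr (PiM I \<Omega>) (N i) (\<lambda>\<omega>. Y i (\<omega> i)) = distr (distr (PiM I \<Omega>) (\<Omega> i) (\<lambda>\<omega>. \<omega> i)) (N i) (Y i)"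
      using i Y by (subst distr_distr) (auto simp: comp_def)
    also have "\<dots> = distr (\<Omega> i) (N i) (Y i)"
      using distr_PiM_component[of I \<Omega> i] \<Omega> i by simp
    finally show "distr (PiM I \<Omega>) (N i) (\<lambda>\<omega>. Y i (\<omega> i)) = distr (\<Omega> i) (N i) (Y i)" .
  qed
  finally show ?thesis .
qed

text \<open>Skorohod's almost sure representation, applied to every coordinate, turns weak convergence
  of product measures into dominated convergence.\<close>

lemma weak_conv_PiM:
  fixes \<mu> :: "nat \<Rightarrow> 'i \<Rightarrow> real measure" and g :: "('i \<Rightarrow> real) \<Rightarrow> real"
  assumes I: "I \<noteq> {}" "countable I"
    and \<mu>: "\<And>n i. i \<in> I \<Longrightarrow> real_distribution (\<mu> n i)" and \<nu>: "\<And>i. i \<in> I \<Longrightarrow> real_distribution (\<nu> i)"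
    and conv: "\<And>i. i \<in> I \<Longrightarrow> weak_conv_m (\<lambda>n. \<mu> n i) (\<nu> i)"
    and g: "g \<in> borel_measurable (PiM I (\<lambda>_. borel))" "\<And>z. \<bar>g z\<bar> \<le> B"
    and cont: "\<And>z z'. (\<And>i. i \<in> I \<Longrightarrow> (\<lambda>n. z n i) \<longlonglongrightarrow> z' i) \<Longrightarrow> (\<lambda>n. g (z n)) \<longlonglongrightarrow> g z'"
  shows "(\<lambda>n. LINT z|PiM I (\<mu> n). g z) \<longlonglongrightarrow> (LINT z|PiM I \<nu>. g z)"
proof -
  define R where "R i \<Omega> Y Y' \<longleftrightarrow> prob_space \<Omega> \<and> (\<forall>n. Y n \<in> borel_measurable \<Omega>) \<and> (\<forall>n. distr \<Omega> borel (Y n) = \<mu> n i) \<and>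
      Y' \<in> borel_measurable \<Omega> \<and> distr \<Omega> borel Y' = \<nu> i \<and> (\<forall>x\<in>space \<Omega>. (\<lambda>n. Y n x) \<longlonglongrightarrow> Y' x)"
    for i and \<Omega> :: "real measure" and Y Y'
  have "\<exists>\<Omega> Y Y'. R i \<Omega> Y Y'" if "i \<in> I" for i
    using Skorohod[of "\<lambda>n. \<mu> n i" "\<nu> i", OF \<mu>[OF that] \<nu>[OF that] conv[OF that]] by (simp add: R_def)
  then obtain \<Omega> Y Y' where "\<And>i. i \<in> I \<Longrightarrow> R i (\<Omega> i) (Y i) (Y' i)" by metis
  then have \<Omega>: "\<And>i. i \<in> I \<Longrightarrow> prob_space (\<Omega> i)"
    and Y: "\<And>i n. i \<in> I \<Longrightarrow> Y i n \<in> borel_measurable (\<Omega> i)" "\<And>i n. i \<in> I \<Longrightarrow> distr (\<Omega> i) borel (Y i n) = \<mu> n i"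
    and Y': "\<And>i. i \<in> I \<Longrightarrow> Y' i \<in> borel_measurable (\<Omega> i)" "\<And>i. i \<in> I \<Longrightarrow> distr (\<Omega> i) borel (Y' i) = \<nu> i"
    and lim: "\<And>i x. i \<in> I \<Longrightarrow> x \<in> space (\<Omega> i) \<Longrightarrow> (\<lambda>n. Y i n x) \<longlonglongrightarrow> Y' i x"
    unfolding R_def by blast+
  interpret P: prob_space "PiM I \<Omega>" using \<Omega> by (rule prob_space_PiM)
  let ?Y = "\<lambda>n \<omega>. \<lambda>i\<in>I. Y i n (\<omega> i)" and ?Y' = "\<lambda>\<omega>. \<lambda>i\<in>I. Y' i (\<omega> i)"
  have m: "?Y n \<in> PiM I \<Omega> \<rightarrow>\<^sub>M PiM I (\<lambda>_. borel)" "?Y' \<in> PiM I \<Omega> \<rightarrow>\<^sub>M PiM I (\<lambda>_. borel)" for n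
    by (intro measurable_restrict measurable_compose[OF measurable_component_singleton] Y Y'; assumption)+
  have "PiM I (\<mu> n) = distr (PiM I \<Omega>) (PiM I (\<lambda>_. borel)) (?Y n)" for n
    by (subst distr_PiM_components[OF \<Omega> I(1) Y(1)]) (auto intro!: PiM_cong simp: Y)
  then have eq: "(LINT z|PiM I (\<mu> n). g z) = (LINT \<omega>|PiM I \<Omega>. g (?Y n \<omega>))" for n
    using integral_distr[OF m(1) g(1)] by simp
  have "PiM I \<nu> = distr (PiM I \<Omega>) (PiM I (\<lambda>_. borel)) ?Y'"
    by (subst distr_PiM_components[OF \<Omega> I(1) Y'(1)]) (auto intro!: PiM_cong simp: Y')
  then have eq': "(LINT z|PiM I \<nu>. g z) = (LINT \<omega>|PiM I \<Omega>. g (?Y' \<omega>))"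
    using integral_distr[OF m(2) g(1)] by simp
  show ?thesis
    unfolding eq eq'
  proof (rule integral_dominated_convergence[where w = "\<lambda>_. B"])
    show "AE \<omega> in PiM I \<Omega>. (\<lambda>n. g (?Y n \<omega>)) \<longlonglongrightarrow> g (?Y' \<omega>)"
      by (intro AE_I2 cont) (auto simp: space_PiM intro!: lim)
    show "(\<lambda>\<omega>. g (?Y' \<omega>)) \<in> borel_measurable (PiM I \<Omega>)" "(\<lambda>\<omega>. g (?Y n \<omega>)) \<in> borel_measurable (PiM I \<Omega>)" for n
      using measurable_compose[OF m(1) g(1)] measurable_compose[OF m(2) g(1)] by auto
  qed (use g in auto)
qed

text \<open>The families may live on different probability spaces, since independence reduces both
  sides to product laws.\<close>

lemma weak_conv_indep_vars:
  fixes X :: "nat \<Rightarrow> 'i \<Rightarrow> 'a \<Rightarrow> real" and Y :: "'i \<Rightarrow> 'b \<Rightarrow> real" and g :: "('i \<Rightarrow> real) \<Rightarrow> real"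
  assumes N: "prob_space N" and M: "prob_space M" and I: "I \<noteq> {}" "countable I"
    and X: "\<And>n. prob_space.indep_vars N (\<lambda>_. borel) (X n) I"
    and Y: "prob_space.indep_vars M (\<lambda>_. borel) Y I"
    and conv: "\<And>i. i \<in> I \<Longrightarrow> weak_conv_m (\<lambda>n. distr N borel (X n i)) (distr M borel (Y i))"
    and g: "g \<in> borel_measurable (PiM I (\<lambda>_. borel))" "\<And>z. \<bar>g z\<bar> \<le> B"
    and cont: "\<And>z z'. (\<And>i. i \<in> I \<Longrightarrow> (\<lambda>n. z n i) \<longlonglongrightarrow> z' i) \<Longrightarrow> (\<lambda>n. g (z n)) \<longlonglongrightarrow> g z'"
  shows "(\<lambda>n. LINT \<omega>|N. g (\<lambda>i. X n i \<omega>)) \<longlonglongrightarrow> (LINT \<omega>|M. g (\<lambda>i. Y i \<omega>))"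
proof -
  interpret N: prob_space N by fact
  interpret M: prob_space M by fact
  have rv: "X n i \<in> borel_measurable N" "Y i \<in> borel_measurable M" if "i \<in> I" for n i
    using X Y that unfolding N.indep_vars_def M.indep_vars_def by auto
  \<comment> \<open>A constant sequence \<open>z\<close> converges on \<open>I\<close> to its
    restriction, so \<open>cont\<close> forces \<open>g\<close> to ignore coordinates outside
    \<open>I\<close>.\<close>
  have restrict: "g (\<lambda>i\<in>I. z i) = g z" for z
    by (rule LIMSEQ_unique[OF cont[where z = "\<lambda>_. z"]]) auto
  have rd: "real_distribution (distr N borel (X n i))" "real_distribution (distr M borel (Y i))" if "i \<in> I" for n i
    using rv that by auto
  have "(LINT \<omega>|N. g (\<lambda>i. X n i \<omega>)) = (LINT z|distr N (PiM I (\<lambda>_. borel)) (\<lambda>\<omega>. \<lambda>i\<in>I. X n i \<omega>). g z)" for n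
    by (subst integral_distr) (use rv g in \<open>auto simp: restrict intro!: measurable_restrict\<close>)
  then have 1: "(LINT \<omega>|N. g (\<lambda>i. X n i \<omega>)) = (LINT z|PiM I (\<lambda>i. distr N borel (X n i)). g z)" for n
    using N.indep_vars_iff_distr_eq_PiM'[OF I(1), where M' = "\<lambda>_. borel" and X = "X n"] rv X by simp
  have "(LINT \<omega>|M. g (\<lambda>i. Y i \<omega>)) = (LINT z|distr M (PiM I (\<lambda>_. borel)) (\<lambda>\<omega>. \<lambda>i\<in>I. Y i \<omega>). g z)"
    by (subst integral_distr) (use rv g in \<open>auto simp: restrict intro!: measurable_restrict\<close>)
  then have 2: "(LINT \<omega>|M. g (\<lambda>i. Y i \<omega>)) = (LINT z|PiM I (\<lambda>i. distr M borel (Y i)). g z)"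
    using M.indep_vars_iff_distr_eq_PiM'[OF I(1), where M' = "\<lambda>_. borel" and X = Y] rv Y by simp
  show ?thesis
    unfolding 1 2 by (rule weak_conv_PiM[OF I rd conv g cont]) auto
qed

section \<open>Approximation by a step process\<close>

text \<open>\<open>n \<ge> 2\<close> makes \<open>n powr t\<close> strictly increasing in
  \<open>t\<close>, as \<open>D01_floor\<close> requires.\<close>

lemma parts_process_D01:
  assumes "n \<ge> 2"
  shows "parts_process \<theta> n \<alpha> \<in> D01"
proof -
  let ?s = "sqrt (\<theta> * ln (real n))"
  have "(\<lambda>t\<in>{0..1}. real (\<Sum>i=1..nat \<lfloor>real n powr t\<rfloor>. \<alpha> i) / ?s + (- \<theta> * t * ln (real n) / ?s)) \<in> D01"
  proof (rule D01_floor[where h = "\<lambda>z. real (\<Sum>i=1..nat z. \<alpha> i) / ?s"])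
    show "continuous_on UNIV (\<lambda>t. real n powr t)"
      using assms by (intro continuous_intros) auto
    show "strict_mono (\<lambda>t. real n powr t)"
      using assms by (intro strict_monoI powr_less_mono) auto
    have "continuous_on UNIV (\<lambda>t. t * (- \<theta> * ln (real n) / ?s))" by (intro continuous_intros)
    then show "continuous_on UNIV (\<lambda>t. - \<theta> * t * ln (real n) / ?s)" by (simp add: mult_ac)
  qed
  moreover have "parts_process \<theta> n \<alpha> = (\<lambda>t\<in>{0..1}. real (\<Sum>i=1..nat \<lfloor>real n powr t\<rfloor>. \<alpha> i) / ?s + (- \<theta> * t * ln (real n) / ?s))"
    by (auto simp: parts_process_def num_parts_upto_def fun_eq_iff diff_divide_distrib)
  ultimately show ?thesis by simp
qed

lemma nat_floor_powr:
  fixes s :: real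
  assumes n: "n \<ge> 1" and s: "s \<ge> 0"
  shows "1 \<le> nat \<lfloor>real n powr s\<rfloor>" "real (nat \<lfloor>real n powr s\<rfloor>) \<le> real n powr s"
    "ln (real (nat \<lfloor>real n powr s\<rfloor>)) \<le> s * ln (real n)"
    "s * ln (real n) - ln 2 \<le> ln (real (nat \<lfloor>real n powr s\<rfloor>))"
proof -
  let ?m = "nat \<lfloor>real n powr s\<rfloor>"
  have ge: "1 \<le> real n powr s" using n s by (simp add: ge_one_powr_ge_zero)
  then show 1: "1 \<le> ?m" by (simp add: le_nat_floor)
  have m: "real ?m = of_int \<lfloor>real n powr s\<rfloor>" by simp
  show 2: "real ?m \<le> real n powr s" unfolding m by (rule of_int_floor_le)
  have ln: "ln (real n powr s) = s * ln (real n)" using n by (simp add: ln_powr)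
  have "ln (real ?m) \<le> ln (real n powr s)" using 1 2 ge n by (subst ln_le_cancel_iff) auto
  then show "ln (real ?m) \<le> s * ln (real n)" using ln by simp
  have "real n powr s < real ?m + 1" unfolding m by linarith
  then have "real n powr s \<le> 2 * real ?m" using 1 by linarith
  then have "ln (real n powr s) \<le> ln (2 * real ?m)" using 1 ge n by (subst ln_le_cancel_iff) auto
  also have "\<dots> = ln 2 + ln (real ?m)" using 1 by (simp add: ln_mult)
  finally show "s * ln (real n) - ln 2 \<le> ln (real ?m)" using ln by simp
qed

lemma nat_floor_powr_mono: "n \<ge> 1 \<Longrightarrow> s \<le> t \<Longrightarrow> nat \<lfloor>real n powr s\<rfloor> \<le> nat \<lfloor>real n powr t\<rfloor>"
  by (intro nat_mono floor_mono powr_mono) auto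

text \<open>Equally spaced times \<open>i/k\<close> become positions \<open>n^(i/k)\<close>, so that
  all cells carry asymptotically the same variance.\<close>

definition grid :: "nat \<Rightarrow> nat \<Rightarrow> nat \<Rightarrow> nat" where
  "grid k n i = nat \<lfloor>real n powr (real i / real k)\<rfloor>"

lemma grid_0: "n \<ge> 1 \<Longrightarrow> grid k n 0 = 1"
  by (simp add: grid_def)

lemma grid_last: "k > 0 \<Longrightarrow> n \<ge> 1 \<Longrightarrow> grid k n k = n"
  by (simp add: grid_def)

lemma grid_mono: "n \<ge> 1 \<Longrightarrow> i \<le> j \<Longrightarrow> grid k n i \<le> grid k n j"
  unfolding grid_def by (intro nat_floor_powr_mono divide_right_mono) auto

section \<open>The normalised process and its increments over grid cells\<close>

context feller
begin

definition sig :: "nat \<Rightarrow> real" where "sig n = sqrt (\<theta> * ln (real n))"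

lemma sig_pos: "n \<ge> 2 \<Longrightarrow> sig n > 0"
  using theta by (simp add: sig_def)

lemma sig_squared: "n \<ge> 1 \<Longrightarrow> (sig n)\<^sup>2 = \<theta> * ln (real n)"
  using theta by (simp add: sig_def)

lemma sig_at_top: "filterlim sig at_top sequentially"
  unfolding sig_def[abs_def] using theta by real_asymp

lemma cs_diff: "g \<le> m \<Longrightarrow> cs \<xi> N m - cs \<xi> N g = cs \<xi> (max N g) m"
  using cs_add[of N g m \<xi>] by (cases "N \<le> g") (auto simp: max_def)

lemma abs_cs_le: "\<bar>cs \<xi> 0 m\<bar> \<le> real m"
proof -
  have "\<bar>cs \<xi> 0 m\<bar> \<le> (\<Sum>j\<in>{0<..m}. \<bar>of_bool (\<xi> j) - p j\<bar>)" unfolding cs_def by (rule sum_abs)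
  also have "\<dots> \<le> (\<Sum>j\<in>{0<..m}. 1)"
  proof (rule sum_mono)
    fix j assume "j \<in> {0<..m}"
    then show "\<bar>of_bool (\<xi> j) - p j\<bar> \<le> 1" using p_bounds[of j] by (cases "\<xi> j") auto
  qed
  finally show ?thesis by simp
qed

text \<open>Each centred indicator is bounded by 1, so starting the sum after \<open>N\<close> costs
  at most \<open>N\<close>; the remaining sum \<open>cs \<xi> N m\<close> does not involve the first
  \<open>N\<close> coordinates.\<close>

lemma ones_approx: "\<bar>real (ones \<xi> m) - H m - cs \<xi> N m\<bar> \<le> real N"
proof -
  have "{0<..m} = {1..m}" by auto
  then have eq: "real (ones \<xi> m) - H m = cs \<xi> 0 m"
    unfolding cs_def ones_def H_def by (simp only: of_nat_sum of_nat_of_bool sum_subtractf)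
  show ?thesis
  proof (cases "m \<le> N")
    case True
    then show ?thesis unfolding eq using abs_cs_le[of \<xi> m] by simp
  next
    case False
    then show ?thesis unfolding eq using abs_cs_le[of \<xi> N] cs_add[of 0 N m \<xi>] by simp
  qed
qed

text \<open>The number of parts of size at most \<open>m\<close> lies between the numbers of ones up to \<open>m\<close> and up to
  \<open>c m\<close>; the factor \<open>c\<close> shifts the time by at most one grid cell.\<close>

lemma parts_process_approx:
  assumes n: "n \<ge> 2" and k: "k > 0" and t: "t \<in> {0..1}" and \<xi>: "\<xi> 1" "\<not> close_ones n c \<xi>"
    and c: "c \<ge> 1" "real c \<le> real n powr (1 / real k)" and r: "r \<ge> 0"
    and good: "\<And>i m. i < k \<Longrightarrow> m \<in> {max N (grid k n i)..grid k n (Suc i)} \<Longrightarrow> \<bar>cs \<xi> (max N (grid k n i)) m\<bar> \<le> 2 * r"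
  shows "\<bar>parts_process \<theta> n (feller_partition \<xi> n) t - step_path k (\<lambda>i. cs \<xi> N (grid k n i) / sig n) t\<bar>
    \<le> (4 * r + (real N + 1 + H_err + \<theta> * ln 2 + \<theta> * ln (real c))) / sig n"
proof -
  have n1: "n \<ge> 1" using n by simp
  define m where "m = nat \<lfloor>real n powr t\<rfloor>"
  define m' where "m' = min n (c * m)"
  define i where "i = nat \<lfloor>real k * t\<rfloor>"
  define g where "g = grid k n i"
  define A where "A = real (parts_upto m (feller_partition \<xi> n)) - \<theta> * t * ln (real n)"
  have t0: "t \<ge> 0" "t \<le> 1" using t by auto
  have ik: "i \<le> k" unfolding i_def using t0 by (intro nat_floor_mult_le)
  have ri: "real i = of_int \<lfloor>real k * t\<rfloor>" unfolding i_def using t0 by (intro of_nat_nat) simp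
  have i1: "real i / real k \<le> t" using k ri by (simp add: divide_le_eq mult.commute)
  have i2: "t \<le> real (Suc i) / real k"
  proof -
    have "real k * t \<le> real (Suc i)" using ri by simp linarith
    then show ?thesis using k by (simp add: le_divide_eq mult.commute)
  qed
  have m1: "m \<ge> 1" and mle: "real m \<le> real n powr t"
    and lnm: "ln (real m) \<le> t * ln (real n)" "t * ln (real n) - ln 2 \<le> ln (real m)"
    unfolding m_def using nat_floor_powr[OF n1 t0(1)] by auto
  have gm: "g \<le> m" unfolding g_def m_def grid_def by (rule nat_floor_powr_mono[OF n1 i1])
  have mn: "m \<le> n" unfolding m_def using nat_floor_powr_mono[OF n1 t0(2)] by simp
  have m_next: "m \<le> grid k n (Suc i)"
    unfolding m_def grid_def by (rule nat_floor_powr_mono[OF n1 i2])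
  have mm': "m \<le> m'" using mn c(1) m1 by (simp add: m'_def)
  have m'_next: "m' \<le> grid k n (Suc (Suc i))"
  proof -
    have "real (c * m) \<le> real n powr (1 / real k) * real n powr (real (Suc i) / real k)"
      unfolding of_nat_mult using c mle i2 n1
      by (intro mult_mono order_trans[OF mle] powr_mono) auto
    also have "\<dots> = real n powr (real (Suc (Suc i)) / real k)"
      by (simp add: powr_add[symmetric] add_divide_distrib[symmetric] add.commute)
    finally have "c * m \<le> grid k n (Suc (Suc i))" unfolding grid_def by (rule le_nat_floor)
    then show ?thesis by (simp add: m'_def)
  qed
  have step: "\<bar>cs \<xi> N q - cs \<xi> N (grid k n j)\<bar> \<le> 2 * r"
    if "j < k" "grid k n j \<le> q" "q \<le> grid k n (Suc j)" for j q
  proof (cases "max N (grid k n j) \<le> q")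
    case True
    then show ?thesis unfolding cs_diff[OF that(2)] using good[of j q] that by auto
  next
    case False
    then have "cs \<xi> (max N (grid k n j)) q = 0" by (intro cs_trivial) (simp only: not_le less_imp_le)
    then show ?thesis unfolding cs_diff[OF that(2)] using r by simp
  qed
  \<comment> \<open>Both \<open>m\<close> and \<open>m'\<close> lie at most two cells beyond
    \<open>g\<close>, at \<open>2 * r\<close> per cell. If \<open>i = k\<close> then
    \<open>t = 1\<close> and \<open>g = n\<close>, so no room is left.\<close>
  have osc: "\<bar>cs \<xi> N q - cs \<xi> N g\<bar> \<le> 4 * r" if q: "g \<le> q" "q \<le> n" "q \<le> grid k n (Suc (Suc i))" for q
  proof (cases "i < k")
    case False
    then have "g = n" using ik grid_last[OF k n1] by (simp add: g_def)
    then show ?thesis using q r by simp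
  next
    case i: True
    show ?thesis
    proof (cases "q \<le> grid k n (Suc i)")
      case True
      then show ?thesis using step[OF i, of q] q r by (simp add: g_def)
    next
      case False
      have "Suc i < k"
      proof (rule ccontr)
        assume "\<not> Suc i < k"
        then have "Suc i = k" using i by simp
        then show False using False q(2) grid_last[OF k n1] by simp
      qed
      then have "\<bar>cs \<xi> N q - cs \<xi> N (grid k n (Suc i))\<bar> \<le> 2 * r"
        using False q by (intro step) auto
      moreover have "\<bar>cs \<xi> N (grid k n (Suc i)) - cs \<xi> N g\<bar> \<le> 2 * r"
        unfolding g_def using i grid_mono[OF n1] by (intro step) auto
      ultimately show ?thesis by linarith
    qed
  qed
  have om: "\<bar>cs \<xi> N m - cs \<xi> N g\<bar> \<le> 4 * r"
    using gm mn m_next grid_mono[OF n1, of "Suc i" "Suc (Suc i)" k] by (intro osc) auto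
  have om': "\<bar>cs \<xi> N m' - cs \<xi> N g\<bar> \<le> 4 * r"
    by (rule osc[OF order_trans[OF gm mm'] _ m'_next]) (simp add: m'_def)
  have lnc: "ln (real m') \<le> ln (real c) + ln (real m)"
  proof -
    have "real m' \<le> real (c * m)" unfolding m'_def of_nat_le_iff by (rule min.cobounded2)
    then have "ln (real m') \<le> ln (real (c * m))"
      using m1 mm' by (intro ln_mono) auto
    also have "\<dots> = ln (real c) + ln (real m)" using m1 c(1) by (simp add: ln_mult)
    finally show ?thesis .
  qed
  have lnc0: "0 \<le> \<theta> * ln (real c)" and ln20: "0 \<le> \<theta> * ln (2::real)" using c(1) theta by auto
  have th: "\<theta> * t * ln (real n) - \<theta> * ln 2 \<le> \<theta> * ln (real m)"
    "\<theta> * ln (real m) \<le> \<theta> * t * ln (real n)" "\<theta> * ln (real m') \<le> \<theta> * ln (real c) + \<theta> * ln (real m)"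
    using mult_left_mono[OF lnm(2), of \<theta>] mult_left_mono[OF lnm(1), of \<theta>] mult_left_mono[OF lnc, of \<theta>] theta
    by (auto simp: algebra_simps)
  have lower: "real (ones \<xi> m) \<le> real (parts_upto m (feller_partition \<xi> n)) + 1"
    using ones_le_parts_upto[of \<xi>, OF \<xi>(1) mn] by simp
  have upper: "real (parts_upto m (feller_partition \<xi> n)) \<le> real (ones \<xi> m') + 1"
  proof -
    have "parts_upto m (feller_partition \<xi> n) \<le> ones \<xi> (min n (c * m)) + 1"
    proof (rule parts_upto_le_ones[of \<xi>, OF \<xi>(1)])
      fix j l assume "1 \<le> j" "j < l" "l \<le> n" "\<xi> j" "\<xi> l"
      then show "j < c * (l - j)" using \<xi>(2) unfolding close_ones_def by (meson not_less)
    qed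
    then show ?thesis unfolding m'_def by linarith
  qed
  have Hm: "\<bar>H m - \<theta> * ln (real m)\<bar> \<le> H_err" using m1 by (rule H_approx)
  have Hm': "\<bar>H m' - \<theta> * ln (real m')\<bar> \<le> H_err" using m1 mm' by (intro H_approx) simp
  \<comment> \<open>\<open>N\<close> comes from starting the sums after \<open>N\<close>,
    \<open>1\<close> from comparing parts with ones, \<open>H_err\<close> from the mean,
    \<open>\<theta> * ln 2\<close> from rounding \<open>n powr t\<close>, and
    \<open>\<theta> * ln c\<close> from passing to \<open>m'\<close>.\<close>
  define E where "E = 4 * r + (real N + 1 + H_err + \<theta> * ln 2 + \<theta> * ln (real c))"
  have "A - cs \<xi> N g \<ge> - E"
    using lower ones_approx[of \<xi> m N] Hm th om lnc0 unfolding A_def E_def by linarith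
  moreover have "A - cs \<xi> N g \<le> E"
    using upper ones_approx[of \<xi> m' N] Hm' th om' ln20 unfolding A_def E_def by linarith
  ultimately have "\<bar>A - cs \<xi> N g\<bar> \<le> E" by linarith
  then have "\<bar>A - cs \<xi> N g\<bar> / sig n \<le> E / sig n"
    using sig_pos[OF n] by (intro divide_right_mono) auto
  moreover have "parts_process \<theta> n (feller_partition \<xi> n) t = A / sig n"
    using t by (simp add: parts_process_def num_parts_upto_def A_def m_def parts_upto_def sig_def)
  moreover have "step_path k (\<lambda>i. cs \<xi> N (grid k n i) / sig n) t = cs \<xi> N g / sig n"
    using t by (simp add: step_path_def g_def i_def)
  ultimately show ?thesis
    using sig_pos[OF n] unfolding E_def by (simp add: diff_divide_distrib[symmetric])
qed

text \<open>The increment over cell \<open>i\<close>, cut off at \<open>N\<close> to leave the first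
  \<open>N\<close> coordinates untouched; cells below \<open>N\<close> give 0.\<close>

definition Delta :: "nat \<Rightarrow> nat \<Rightarrow> nat \<Rightarrow> nat \<Rightarrow> (nat \<Rightarrow> bool) \<Rightarrow> real" where
  "Delta k N n i \<xi> = cs \<xi> (max N (grid k n i)) (grid k n (Suc i)) / sig n"

lemma local_on_Delta: "local_on {max N (grid k n i)<..grid k n (Suc i)} (Delta k N n i)"
  unfolding Delta_def by (rule local_on_cs')

lemma sum_Delta:
  assumes "n \<ge> 1" "N \<ge> 1"
  shows "(\<Sum>j<i. Delta k N n j \<xi>) = cs \<xi> N (grid k n i) / sig n"
proof (induction i)
  case 0
  \<comment> \<open>The sums start at \<open>grid k n 0 = 1\<close>, not 0; \<open>N \<ge> 1\<close>
    makes \<open>cs \<xi> N 1\<close> vanish.\<close>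
  then show ?case using assms by (simp add: grid_0)
next
  case (Suc i)
  have "cs \<xi> N (grid k n (Suc i)) - cs \<xi> N (grid k n i) = cs \<xi> (max N (grid k n i)) (grid k n (Suc i))"
    by (rule cs_diff) (rule grid_mono[OF assms(1)], simp)
  then have "cs \<xi> N (grid k n (Suc i)) = cs \<xi> N (grid k n i) + cs \<xi> (max N (grid k n i)) (grid k n (Suc i))"
    by linarith
  then show ?case using Suc by (simp add: Delta_def add_divide_distrib)
qed

lemma indep_vars_Delta: "n \<ge> 1 \<Longrightarrow> indep_vars (\<lambda>_. borel) (Delta k N n) {..<k}"
proof (rule indep_vars_local[OF _ _ _ local_on_Delta])
  assume n: "n \<ge> 1"
  show "disjoint_family_on (\<lambda>i. {max N (grid k n i)<..grid k n (Suc i)}) {..<k}"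
    unfolding disjoint_family_on_def
  proof (intro ballI impI)
    fix i j :: nat assume "i \<noteq> j"
    then show "{max N (grid k n i)<..grid k n (Suc i)} \<inter> {max N (grid k n j)<..grid k n (Suc j)} = {}"
    proof (cases i j rule: linorder_cases)
      case less
      then have "grid k n (Suc i) \<le> grid k n j" using n by (intro grid_mono) auto
      then show ?thesis by auto
    next
      case greater
      then have "grid k n (Suc j) \<le> grid k n i" using n by (intro grid_mono) auto
      then show ?thesis by auto
    qed simp
  qed
qed auto

lemma eventually_grid_ge:
  assumes "k > 0"
  shows "\<forall>\<^sub>F n in sequentially. N \<le> grid k n (Suc i)"
proof -
  have e: "real (Suc i) / real k > 0" using assms by simp
  have "\<forall>\<^sub>F n in sequentially. real N \<le> real n powr e" if "e > 0" for e
    using that by real_asymp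
  from this[OF e] show ?thesis
    unfolding grid_def by eventually_elim (rule le_nat_floor)
qed

lemma eventually_grid_increasing:
  assumes "k > 0"
  shows "\<forall>\<^sub>F n in sequentially. max N (grid k n i) \<le> grid k n (Suc i)"
  using eventually_grid_ge[OF assms, of N i] eventually_ge_at_top[of 1]
  by eventually_elim (simp add: grid_mono)

text \<open>On the logarithmic scale consecutive grid points are about \<open>ln n / k\<close>
  apart. The constant \<open>C\<close> collects two errors of \<open>H_approx\<close>, one rounding
  error \<open>\<theta> * ln 2\<close>, and the positions cut off by \<open>N\<close>.\<close>

lemma H_grid:
  assumes k: "k > 0"
  shows "(\<lambda>n. (H (grid k n (Suc i)) - H (max N (grid k n i))) / (sig n)\<^sup>2) \<longlonglongrightarrow> 1 / real k"
proof -
  define C where "C = 2 * H_err + \<theta> * ln 2 + real N"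
  have "(\<lambda>n. C / (\<theta> * ln (real n))) \<longlonglongrightarrow> 0" using theta by real_asymp
  then have "(\<lambda>n. (H (grid k n (Suc i)) - H (max N (grid k n i))) / (sig n)\<^sup>2 - 1 / real k) \<longlonglongrightarrow> 0"
  proof (rule Lim_null_comparison[rotated])
    show "\<forall>\<^sub>F n in sequentially. norm ((H (grid k n (Suc i)) - H (max N (grid k n i))) / (sig n)\<^sup>2 - 1 / real k)
        \<le> C / (\<theta> * ln (real n))"
      using eventually_ge_at_top[of 2]
    proof eventually_elim
      case (elim n)
      then have n: "n \<ge> 1" by simp
      let ?a = "grid k n i" and ?b = "grid k n (Suc i)"
      have a: "?a \<ge> 1" "ln (real ?a) \<le> real i / real k * ln (real n)" "real i / real k * ln (real n) - ln 2 \<le> ln (real ?a)"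
        and b: "?b \<ge> 1" "ln (real ?b) \<le> real (Suc i) / real k * ln (real n)"
          "real (Suc i) / real k * ln (real n) - ln 2 \<le> ln (real ?b)"
        unfolding grid_def using nat_floor_powr[OF n, of "real i / real k"] nat_floor_powr[OF n, of "real (Suc i) / real k"]
        by auto
      have Ha: "\<bar>H ?a - \<theta> * ln (real ?a)\<bar> \<le> H_err" and Hb: "\<bar>H ?b - \<theta> * ln (real ?b)\<bar> \<le> H_err"
        using a b by (auto intro!: H_approx)
      have Hm: "H ?a \<le> H (max N ?a)" "H (max N ?a) \<le> H ?a + real N"
        using H_mono[of ?a "max N ?a"] H_le[of N] H_nonneg[of ?a] by (auto simp: max_def)
      have eq: "real (Suc i) / real k * ln (real n) = real i / real k * ln (real n) + ln (real n) / real k"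
        by (simp add: add_divide_distrib distrib_right)
      have "\<theta> * ln (real ?b) - \<theta> * ln (real ?a) \<le> \<theta> * (ln (real n) / real k + ln 2)"
        "\<theta> * (ln (real n) / real k - ln 2) \<le> \<theta> * ln (real ?b) - \<theta> * ln (real ?a)"
        unfolding right_diff_distrib[symmetric] using a b eq theta by (intro mult_left_mono; linarith)+
      then have "\<bar>H ?b - H (max N ?a) - \<theta> * (ln (real n) / real k)\<bar> \<le> C"
        using Ha Hb Hm unfolding C_def distrib_left right_diff_distrib by linarith
      moreover have pos: "\<theta> * ln (real n) > 0" using theta elim by simp
      ultimately have "\<bar>H ?b - H (max N ?a) - \<theta> * (ln (real n) / real k)\<bar> / (\<theta> * ln (real n)) \<le> C / (\<theta> * ln (real n))"
        by (intro divide_right_mono) auto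
      moreover have "(H ?b - H (max N ?a)) / (\<theta> * ln (real n)) - 1 / real k =
          (H ?b - H (max N ?a) - \<theta> * (ln (real n) / real k)) / (\<theta> * ln (real n))"
      proof -
        have "\<theta> * (ln (real n) / real k) / (\<theta> * ln (real n)) = 1 / real k"
          using elim theta by simp
        then show ?thesis by (simp only: diff_divide_distrib)
      qed
      ultimately show ?case using pos by (simp add: sig_squared[OF n])
    qed
  qed
  then show ?thesis by (simp add: LIM_zero_iff)
qed

lemma weak_conv_Delta:
  assumes "k > 0"
  shows "weak_conv_m (\<lambda>n. distr F borel (Delta k N n i)) (gauss (1 / real k))"
  unfolding Delta_def[abs_def]
  by (rule clt_cs[OF eventually_grid_increasing[OF assms] sig_at_top H_grid[OF assms]]) simp

text \<open>The threshold is that of \<open>ottaviani\<close> with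
  \<open>r = \<delta> * sig n\<close>.\<close>

definition large_osc :: "nat \<Rightarrow> nat \<Rightarrow> real \<Rightarrow> nat \<Rightarrow> (nat \<Rightarrow> bool) \<Rightarrow> bool" where
  "large_osc k N \<delta> n \<xi> \<longleftrightarrow> (\<exists>i<k. \<exists>m\<in>{max N (grid k n i)..grid k n (Suc i)}. \<bar>cs \<xi> (max N (grid k n i)) m\<bar> > 2 * (\<delta> * sig n))"

lemma sets_large_osc: "{\<xi> \<in> space F. large_osc k N \<delta> n \<xi>} \<in> sets F"
  unfolding large_osc_def by measurable

text \<open>\<open>2 < k * \<delta>\<^sup>2\<close> yields the variance condition of
  \<open>ottaviani\<close> for large \<open>n\<close>, as a cell has normalised variance near
  \<open>1/k\<close>. The indicator of a large end value is dominated by a bounded continuous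
  function, to whose expectation weak convergence applies.\<close>

lemma prob_large_osc_cell:
  assumes k: "k > 0" and \<delta>: "\<delta> > 0" "2 < real k * \<delta>\<^sup>2"
  shows "\<forall>\<^sub>F n in sequentially. prob {\<xi> \<in> space F. \<exists>m\<in>{max N (grid k n i)..grid k n (Suc i)}.
      \<bar>cs \<xi> (max N (grid k n i)) m\<bar> > 2 * (\<delta> * sig n)} \<le> 2 * expectation (\<lambda>\<xi>. min 1 ((Delta k N n i \<xi> / \<delta>) ^ 4))"
proof -
  have "1 / real k < \<delta>\<^sup>2 / 2" using assms by (simp add: field_simps)
  then have "\<forall>\<^sub>F n in sequentially. (H (grid k n (Suc i)) - H (max N (grid k n i))) / (sig n)\<^sup>2 < \<delta>\<^sup>2 / 2"
    using H_grid[OF k] by (intro order_tendstoD)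
  with eventually_grid_increasing[OF k, of N i] eventually_ge_at_top[of 2] show ?thesis
  proof eventually_elim
    case (elim n)
    let ?a = "max N (grid k n i)" and ?b = "grid k n (Suc i)"
    have s: "sig n > 0" using sig_pos[OF elim(2)] .
    have "prob {\<xi> \<in> space F. \<exists>m\<in>{?a..?b}. \<bar>cs \<xi> ?a m\<bar> > 2 * (\<delta> * sig n)} \<le>
        2 * prob {\<xi> \<in> space F. \<bar>cs \<xi> ?a ?b\<bar> > \<delta> * sig n}"
    proof (rule ottaviani[OF elim(1)])
      have "H ?b - H ?a \<le> \<delta>\<^sup>2 / 2 * (sig n)\<^sup>2" using elim(3) s by (simp add: divide_less_eq)
      then show "H ?b - H ?a \<le> (\<delta> * sig n)\<^sup>2 / 2" by (simp add: power_mult_distrib)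
    qed (use \<delta> s in simp)
    also have "prob {\<xi> \<in> space F. \<bar>cs \<xi> ?a ?b\<bar> > \<delta> * sig n} \<le> expectation (\<lambda>\<xi>. min 1 ((Delta k N n i \<xi> / \<delta>) ^ 4))"
    proof (rule markov_ineq[OF sets_cs])
      show "integrable F (\<lambda>\<xi>. min 1 ((Delta k N n i \<xi> / \<delta>) ^ 4))"
        unfolding Delta_def by (rule integrable_cs)
      fix \<xi>
      have "1 \<le> (Delta k N n i \<xi> / \<delta>) ^ 4" if "\<bar>cs \<xi> ?a ?b\<bar> > \<delta> * sig n"
      proof -
        have "1 \<le> \<bar>Delta k N n i \<xi> / \<delta>\<bar>"
          using that \<delta> s by (simp add: Delta_def abs_divide abs_mult field_simps)
        then have "1 \<le> \<bar>Delta k N n i \<xi> / \<delta>\<bar> ^ 4" by (rule one_le_power)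
        then show ?thesis by (simp only: power_even_abs_numeral even_numeral)
      qed
      then show "of_bool (\<bar>cs \<xi> ?a ?b\<bar> > \<delta> * sig n) \<le> min 1 ((Delta k N n i \<xi> / \<delta>) ^ 4)" by simp
    qed
    finally show ?case by simp
  qed
qed

text \<open>In the limit a cell contributes at most twice
  \<open>3 / (k\<^sup>2 * \<delta>^4)\<close> by the Gaussian fourth moment; the union over
  \<open>k\<close> cells leaves \<open>6 / (k * \<delta>^4)\<close>, small for large
  \<open>k\<close>. Second moments would leave a bound that does not decrease in
  \<open>k\<close>.\<close>

lemma prob_large_osc:
  assumes k: "k > 0" and \<delta>: "\<delta> > 0" "2 < real k * \<delta>\<^sup>2" and e: "6 / (real k * \<delta> ^ 4) < e"
  shows "\<forall>\<^sub>F n in sequentially. prob {\<xi> \<in> space F. large_osc k N \<delta> n \<xi>} < e"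
proof -
  define q where "q n i = expectation (\<lambda>\<xi>. min 1 ((Delta k N n i \<xi> / \<delta>) ^ 4))" for n i
  define q' where "q' = (LINT x|gauss (1 / real k). min 1 ((x / \<delta>) ^ 4))"
  interpret G: real_distribution "gauss (1 / real k)" by (rule real_distribution_gauss)
  have lim: "(\<lambda>n. q n i) \<longlonglongrightarrow> q'" for i
  proof -
    have [measurable]: "Delta k N n i \<in> borel_measurable F" for n
      unfolding Delta_def[abs_def] by measurable
    have "(\<lambda>n. LINT x|distr F borel (Delta k N n i). min 1 ((x / \<delta>) ^ 4)) \<longlonglongrightarrow> q'"
      unfolding q'_def
      by (rule weak_conv_imp_integral_bdd_continuous_conv[OF _ real_distribution_gauss weak_conv_Delta[OF k], where B = 1])
        (use \<delta> in \<open>auto intro!: continuous_intros\<close>)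
    then show ?thesis unfolding q_def by (simp add: integral_distr)
  qed
  have "q' \<le> (LINT x|gauss (1 / real k). x ^ 4 / \<delta> ^ 4)"
    unfolding q'_def
  proof (rule integral_mono)
    show "integrable (gauss (1 / real k)) (\<lambda>x. min 1 ((x / \<delta>) ^ 4))"
      by (rule G.integrable_const_bound[where B = 1]) (auto simp: min_def)
  qed (use gauss_fourth_moment(2)[of "1 / real k"] in \<open>auto simp: power_divide\<close>)
  also have "\<dots> = 3 / ((real k)\<^sup>2 * \<delta> ^ 4)"
    using gauss_fourth_moment(1)[of "1 / real k"] by (simp add: power_divide)
  finally have "(\<Sum>i<k. 2 * q') \<le> (\<Sum>i<k. 2 * (3 / ((real k)\<^sup>2 * \<delta> ^ 4)))" by (intro sum_mono) simp
  also have "\<dots> = 6 / (real k * \<delta> ^ 4)" using k by (simp add: power2_eq_square)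
  also note e
  finally have "\<forall>\<^sub>F n in sequentially. (\<Sum>i<k. 2 * q n i) < e"
    by (intro order_tendstoD(2)[where y = "\<Sum>i<k. 2 * q'"] tendsto_intros lim)
  moreover have "\<forall>\<^sub>F n in sequentially. \<forall>i\<in>{..<k}. prob {\<xi> \<in> space F. \<exists>m\<in>{max N (grid k n i)..grid k n (Suc i)}.
      \<bar>cs \<xi> (max N (grid k n i)) m\<bar> > 2 * (\<delta> * sig n)} \<le> 2 * q n i"
    unfolding q_def by (intro eventually_ball_finite ballI prob_large_osc_cell k \<delta>) simp
  ultimately show ?thesis
  proof eventually_elim
    case (elim n)
    let ?E = "\<lambda>i. {\<xi> \<in> space F. \<exists>m\<in>{max N (grid k n i)..grid k n (Suc i)}. \<bar>cs \<xi> (max N (grid k n i)) m\<bar> > 2 * (\<delta> * sig n)}"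
    have E: "?E i \<in> sets F" for i by measurable
    have "{\<xi> \<in> space F. large_osc k N \<delta> n \<xi>} = (\<Union>i\<in>{..<k}. ?E i)" by (auto simp: large_osc_def)
    then have "prob {\<xi> \<in> space F. large_osc k N \<delta> n \<xi>} \<le> (\<Sum>i<k. prob (?E i))"
      using E by (simp only:) (intro finite_measure_subadditive_finite, auto)
    also have "\<dots> \<le> (\<Sum>i<k. 2 * q n i)" using elim by (intro sum_mono) auto
    finally show ?case using elim by simp
  qed
qed

text \<open>Any \<open>c\<close> with \<open>ln n \<lless> c\<close> and \<open>ln c \<lless> sqrt (ln n)\<close> would do.\<close>

definition gap_factor :: "nat \<Rightarrow> nat" where
  "gap_factor n = nat \<lceil>(ln (real n))\<^sup>2\<rceil> + 1"

lemma gap_factor_bounds: "gap_factor n \<ge> 1" "(ln (real n))\<^sup>2 \<le> real (gap_factor n)" "real (gap_factor n) \<le> (ln (real n))\<^sup>2 + 2"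
proof -
  have "real (nat \<lceil>(ln (real n))\<^sup>2\<rceil>) = of_int \<lceil>(ln (real n))\<^sup>2\<rceil>"
    using order_trans[OF zero_le_power2 le_of_int_ceiling, of "ln (real n)"] by (intro of_nat_nat) simp
  then show "(ln (real n))\<^sup>2 \<le> real (gap_factor n)" "real (gap_factor n) \<le> (ln (real n))\<^sup>2 + 2"
    unfolding gap_factor_def using ceiling_correct[of "(ln (real n))\<^sup>2"] by simp_all linarith
qed (simp add: gap_factor_def)

lemma prob_close_ones_tendsto: "(\<lambda>n. prob {\<xi> \<in> space F. close_ones n (gap_factor n) \<xi>}) \<longlonglongrightarrow> 0"
proof (rule Lim_null_comparison)
  show "(\<lambda>n. max 1 \<theta> * (\<theta> * ln (real n) + H_err) / (ln (real n))\<^sup>2) \<longlonglongrightarrow> 0"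
    by real_asymp
  show "\<forall>\<^sub>F n in sequentially. norm (prob {\<xi> \<in> space F. close_ones n (gap_factor n) \<xi>})
      \<le> max 1 \<theta> * (\<theta> * ln (real n) + H_err) / (ln (real n))\<^sup>2"
    using eventually_ge_at_top[of 2]
  proof eventually_elim
    case (elim n)
    have "prob {\<xi> \<in> space F. close_ones n (gap_factor n) \<xi>} \<le> max 1 \<theta> * H n / real (gap_factor n)"
      by (rule prob_close_ones) (rule gap_factor_bounds)
    also have "\<dots> \<le> max 1 \<theta> * (\<theta> * ln (real n) + H_err) / (ln (real n))\<^sup>2"
    proof (rule frac_le)
      have "H n \<le> \<theta> * ln (real n) + H_err" using H_approx[of n] elim by linarith
      then show "max 1 \<theta> * H n \<le> max 1 \<theta> * (\<theta> * ln (real n) + H_err)" by (intro mult_left_mono) auto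
      show "0 \<le> max 1 \<theta> * (\<theta> * ln (real n) + H_err)"
        using theta elim H_err_ge by (intro mult_nonneg_nonneg add_nonneg_nonneg) auto
    qed (use elim gap_factor_bounds(2) in auto)
    finally show ?case by simp
  qed
qed

lemma error_tendsto:
  "(\<lambda>n. (C + \<theta> * ln (real (gap_factor n))) / sig n) \<longlonglongrightarrow> 0"
proof (rule Lim_null_comparison)
  show "(\<lambda>n. (\<bar>C\<bar> + \<theta> * ln ((ln (real n))\<^sup>2 + 2)) / sqrt (\<theta> * ln (real n))) \<longlonglongrightarrow> 0"
    using theta by real_asymp
  show "\<forall>\<^sub>F n in sequentially. norm ((C + \<theta> * ln (real (gap_factor n))) / sig n)
      \<le> (\<bar>C\<bar> + \<theta> * ln ((ln (real n))\<^sup>2 + 2)) / sqrt (\<theta> * ln (real n))"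
    using eventually_ge_at_top[of 2]
  proof eventually_elim
    case (elim n)
    have "0 \<le> ln (real (gap_factor n))" using gap_factor_bounds(1)[of n] by simp
    moreover have "ln (real (gap_factor n)) \<le> ln ((ln (real n))\<^sup>2 + 2)"
      using gap_factor_bounds(1,3)[of n] by (subst ln_le_cancel_iff) (auto intro: add_nonneg_pos)
    ultimately have "0 \<le> \<theta> * ln (real (gap_factor n))" "\<theta> * ln (real (gap_factor n)) \<le> \<theta> * ln ((ln (real n))\<^sup>2 + 2)"
      using theta by auto
    then have "\<bar>C + \<theta> * ln (real (gap_factor n))\<bar> \<le> \<bar>C\<bar> + \<theta> * ln ((ln (real n))\<^sup>2 + 2)" by linarith
    then show ?case
      using sig_pos[OF elim] unfolding sig_def[symmetric] by (simp add: divide_right_mono)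
  qed
qed

lemma eventually_gap_factor_le:
  assumes "k > 0"
  shows "\<forall>\<^sub>F n in sequentially. real (gap_factor n) \<le> real n powr (1 / real k)"
proof -
  have "\<forall>\<^sub>F n in sequentially. (ln (real n))\<^sup>2 + 2 \<le> real n powr e" if "e > 0" for e
    using that by real_asymp
  from this[of "1 / real k"] assms have "\<forall>\<^sub>F n in sequentially. (ln (real n))\<^sup>2 + 2 \<le> real n powr (1 / real k)"
    by simp
  then show ?thesis by eventually_elim (use gap_factor_bounds(3) in \<open>rule order_trans\<close>)
qed

end

section \<open>Convergence to Brownian motion\<close>

lemma brownian_increments:
  assumes W: "standard_brownian_motion M W" and k: "k > 0"
  shows "prob_space.indep_vars M (\<lambda>_. borel) (\<lambda>i \<omega>. W (real (Suc i) / real k) \<omega> - W (real i / real k) \<omega>) {..<k}"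
    and "\<And>i. i < k \<Longrightarrow> distr M borel (\<lambda>\<omega>. W (real (Suc i) / real k) \<omega> - W (real i / real k) \<omega>) = gauss (1 / real k)"
proof -
  have M: "prob_space M"
    and indep: "\<And>k t. 0 \<le> t 0 \<Longrightarrow> (\<forall>i<k. t i < t (Suc i)) \<Longrightarrow> t k \<le> 1 \<Longrightarrow>
      prob_space.indep_vars M (\<lambda>_. borel) (\<lambda>i \<omega>. W (t (Suc i)) \<omega> - W (t i) \<omega>) {..<k}"
    and normal: "\<And>s t. 0 \<le> s \<Longrightarrow> s < t \<Longrightarrow> t \<le> 1 \<Longrightarrow>
      distributed M lborel (\<lambda>\<omega>. W t \<omega> - W s \<omega>) (normal_density 0 (sqrt (t - s)))"
    using W unfolding standard_brownian_motion_def by blast+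
  show "prob_space.indep_vars M (\<lambda>_. borel) (\<lambda>i \<omega>. W (real (Suc i) / real k) \<omega> - W (real i / real k) \<omega>) {..<k}"
    using k by (intro indep[where t = "\<lambda>i. real i / real k"]) (auto simp: divide_strict_right_mono)
  fix i assume i: "i < k"
  have d: "real (Suc i) / real k - real i / real k = 1 / real k"
    by (simp add: diff_divide_distrib[symmetric])
  have "distributed M lborel (\<lambda>\<omega>. W (real (Suc i) / real k) \<omega> - W (real i / real k) \<omega>)
      (normal_density 0 (sqrt (real (Suc i) / real k - real i / real k)))"
    using i k by (intro normal) (auto simp: divide_strict_right_mono)
  then show "distr M borel (\<lambda>\<omega>. W (real (Suc i) / real k) \<omega> - W (real i / real k) \<omega>) = gauss (1 / real k)"
    unfolding d using k by (intro distr_normal_gauss M) auto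
qed

context feller
begin

text \<open>The step path is a continuous function of \<open>k\<close> independent increments, each
  of them asymptotically \<open>gauss (1 / k)\<close> like the increments of \<open>W\<close>; this
  is where convergence of finite-dimensional laws enters.\<close>

lemma expectation_step_path_tendsto:
  assumes W: "standard_brownian_motion M W" and k: "k > 0" and N: "N \<ge> 1"
    and f: "\<And>x y. x \<in> D01 \<Longrightarrow> y \<in> D01 \<Longrightarrow> \<bar>f x - f y\<bar> \<le> K * skorohod_dist x y" "K \<ge> 0"
    and B: "\<And>x. x \<in> D01 \<Longrightarrow> \<bar>f x\<bar> \<le> B"
  shows "(\<lambda>n. expectation (\<lambda>\<xi>. f (step_path k (\<lambda>i. \<Sum>j<i. Delta k N n j \<xi>)))) \<longlonglongrightarrow>
    (LINT \<omega>|M. f (step_path k (\<lambda>i. W (real i / real k) \<omega>)))"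
proof -
  have M: "prob_space M" and W0: "AE \<omega> in M. W 0 \<omega> = 0"
    and mW: "\<And>t. t \<in> {0..1} \<Longrightarrow> W t \<in> borel_measurable M"
    using W unfolding standard_brownian_motion_def by blast+
  define Y where "Y i \<omega> = W (real (Suc i) / real k) \<omega> - W (real i / real k) \<omega>" for i \<omega>
  define g where "g z = f (step_path k (\<lambda>i. \<Sum>j<i. z j))" for z :: "nat \<Rightarrow> real"
  \<comment> \<open>Shifted to \<open>Suc n\<close> because the increments are known to be
    independent only for \<open>n \<ge> 1\<close>.\<close>
  have "(\<lambda>n. expectation (\<lambda>\<xi>. g (\<lambda>j. Delta k N (Suc n) j \<xi>))) \<longlonglongrightarrow> (LINT \<omega>|M. g (\<lambda>i. Y i \<omega>))"
  proof (rule weak_conv_indep_vars[OF prob_space_axioms M, where I = "{..<k}" and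
        X = "\<lambda>n. Delta k N (Suc n)" and Y = Y and g = g and B = B])
    show "indep_vars (\<lambda>_. borel) (Delta k N (Suc n)) {..<k}" for n
      by (rule indep_vars_Delta) simp
    show "prob_space.indep_vars M (\<lambda>_. borel) Y {..<k}"
      unfolding Y_def[abs_def] by (rule brownian_increments[OF W k])
    fix i assume "i \<in> {..<k}"
    then have "distr M borel (Y i) = gauss (1 / real k)"
      unfolding Y_def[abs_def] by (intro brownian_increments[OF W k]) simp
    then show "weak_conv_m (\<lambda>n. distr F borel (Delta k N (Suc n) i)) (distr M borel (Y i))"
      using weak_conv_Delta[OF k, of N i] unfolding weak_conv_m_def weak_conv_def
      by (simp only:) (auto intro: LIMSEQ_Suc)
  next
    show "g \<in> borel_measurable (PiM {..<k} (\<lambda>_. borel))"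
      unfolding g_def[abs_def]
    proof (rule measurable_step_path[OF k f])
      fix i assume "i \<le> k"
      then have "(\<lambda>z. z j :: real) \<in> borel_measurable (PiM {..<k} (\<lambda>_. borel))" if "j \<in> {..<i}" for j
        using that by (intro measurable_component_singleton) auto
      then show "(\<lambda>z. \<Sum>j<i. z j :: real) \<in> borel_measurable (PiM {..<k} (\<lambda>_. borel))"
        by (rule borel_measurable_sum)
    qed
    show "\<bar>g z\<bar> \<le> B" for z unfolding g_def by (rule B) (rule step_path_D01[OF k])
    show "(\<lambda>n. g (z n)) \<longlonglongrightarrow> g z'" if "\<And>i. i \<in> {..<k} \<Longrightarrow> (\<lambda>n. z n i) \<longlonglongrightarrow> z' i" for z z'
      unfolding g_def by (rule tendsto_step_path[OF k f]) (auto intro!: tendsto_sum that)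
  qed (use k in auto)
  then have "(\<lambda>n. expectation (\<lambda>\<xi>. g (\<lambda>j. Delta k N n j \<xi>))) \<longlonglongrightarrow> (LINT \<omega>|M. g (\<lambda>i. Y i \<omega>))"
    by (rule LIMSEQ_imp_Suc)
  also have "(LINT \<omega>|M. g (\<lambda>i. Y i \<omega>)) = (LINT \<omega>|M. f (step_path k (\<lambda>i. W (real i / real k) \<omega>)))"
  proof (rule integral_cong_AE)
    have mw: "W (real i / real k) \<in> borel_measurable M" if "i \<le> k" for i
      using that k by (intro mW) auto
    show "(\<lambda>\<omega>. f (step_path k (\<lambda>i. W (real i / real k) \<omega>))) \<in> borel_measurable M"
      by (rule measurable_step_path[OF k f]) (use mw in auto)
    show "(\<lambda>\<omega>. g (\<lambda>i. Y i \<omega>)) \<in> borel_measurable M"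
      unfolding g_def
    proof (rule measurable_step_path[OF k f])
      fix i assume "i \<le> k"
      then show "(\<lambda>\<omega>. \<Sum>j<i. Y j \<omega>) \<in> borel_measurable M"
        unfolding Y_def by (intro borel_measurable_sum borel_measurable_diff mw) auto
    qed
    show "AE \<omega> in M. g (\<lambda>i. Y i \<omega>) = f (step_path k (\<lambda>i. W (real i / real k) \<omega>))"
      using W0
    proof eventually_elim
      case (elim \<omega>)
      have "(\<Sum>j<i. Y j \<omega>) = W (real i / real k) \<omega>" for i
        unfolding Y_def by (subst sum_lessThan_telescope) (simp add: elim)
      then show ?case by (simp add: g_def)
    qed
  qed
  finally show ?thesis unfolding g_def .
qed

lemma local_on_step_path_Delta:
  assumes "n \<ge> 1" "k > 0"
  shows "local_on {N<..n} (\<lambda>\<xi>. f (step_path k (\<lambda>i. \<Sum>j<i. Delta k N n j \<xi>)))"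
proof (rule local_onI)
  fix \<xi> \<xi>' :: "nat \<Rightarrow> bool" assume eq: "\<And>i. i \<in> {N<..n} \<Longrightarrow> \<xi> i = \<xi>' i"
  have "step_path k (\<lambda>i. \<Sum>j<i. Delta k N n j \<xi>) = step_path k (\<lambda>i. \<Sum>j<i. Delta k N n j \<xi>')"
  proof (intro step_path_cong sum.cong refl)
    fix i j assume "i \<le> k" "j \<in> {..<i}"
    then have "grid k n (Suc j) \<le> n"
      using grid_mono[OF assms(1), of "Suc j" k k] grid_last[OF assms(2,1)] by simp
    then show "Delta k N n j \<xi> = Delta k N n j \<xi>'"
      by (intro local_onD[OF local_on_Delta] eq) auto
  qed
  then show "f (step_path k (\<lambda>i. \<Sum>j<i. Delta k N n j \<xi>)) = f (step_path k (\<lambda>i. \<Sum>j<i. Delta k N n j \<xi>'))"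
    by simp
qed

lemma local_on_parts_process: "local_on {1..n} (\<lambda>\<xi>. f (parts_process \<theta> n (feller_partition \<xi> n)))"
  by (rule local_on_compose[OF local_on_feller_partition])

text \<open>Since the increments \<open>Delta\<close> only involve coordinates beyond \<open>N\<close>, the limit is mixing: it is
  not affected by a density \<open>h\<close> that depends on the first \<open>N\<close> coordinates.\<close>

lemma mixing_limit:
  assumes W: "standard_brownian_motion M W" and N: "N \<ge> 1" and h: "local_on {1..N} (h :: _ \<Rightarrow> real)"
    and f: "\<And>x y. x \<in> D01 \<Longrightarrow> y \<in> D01 \<Longrightarrow> \<bar>f x - f y\<bar> \<le> K * skorohod_dist x y" "K \<ge> 0"
    and B: "\<And>x. x \<in> D01 \<Longrightarrow> \<bar>f x\<bar> \<le> B"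
  shows "(\<lambda>n. expectation (\<lambda>\<xi>. h \<xi> * f (parts_process \<theta> n (feller_partition \<xi> n)))) \<longlonglongrightarrow>
    expectation h * (LINT \<omega>|M. f (\<lambda>t\<in>{0..1}. W t \<omega>))"
proof -
  interpret M: prob_space M using W unfolding standard_brownian_motion_def by blast
  have mW: "\<And>t. t \<in> {0..1} \<Longrightarrow> W t \<in> borel_measurable M"
    and cW: "\<And>\<omega>. \<omega> \<in> space M \<Longrightarrow> continuous_on {0..1} (\<lambda>t. W t \<omega>)"
    using W unfolding standard_brownian_motion_def by blast+
  obtain D where D: "\<And>\<xi>. \<bar>h \<xi>\<bar> \<le> D" using local_on_bounded[OF h] by auto
  have D0: "D \<ge> 0" using D[of undefined] by linarith
  have B0: "B \<ge> 0" using B[OF step_path_D01[of 1 undefined]] by linarith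
  have inth: "integrable F h" by (rule integrable_local[OF _ _ h]) auto
  let ?w = "LINT \<omega>|M. f (\<lambda>t\<in>{0..1}. W t \<omega>)"
  let ?X = "\<lambda>n \<xi>. parts_process \<theta> n (feller_partition \<xi> n)"
  let ?S = "\<lambda>k n \<xi>. step_path k (\<lambda>i. \<Sum>j<i. Delta k N n j \<xi>)"
  let ?wk = "\<lambda>k. LINT \<omega>|M. f (step_path k (\<lambda>i. W (real i / real k) \<omega>))"
  have wk: "(\<lambda>k. ?wk (Suc k)) \<longlonglongrightarrow> ?w"
  proof (rule integral_dominated_convergence[where w = "\<lambda>_. B"])
    have "f \<in> borel_measurable (borel_of skorohod_topology)"
      by (rule measurable_continuous_map_borel_of, rule skorohod.continuous_map_Lipschitz_real, rule f(1))
    from measurable_compose[OF measurable_continuous_path[OF mW cW] this]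
    show "(\<lambda>\<omega>. f (\<lambda>t\<in>{0..1}. W t \<omega>)) \<in> borel_measurable M" .
    show "(\<lambda>\<omega>. f (step_path (Suc k) (\<lambda>i. W (real i / real (Suc k)) \<omega>))) \<in> borel_measurable M" for k
      by (rule measurable_step_path[OF _ f]) (auto intro!: mW)
    show "AE \<omega> in M. (\<lambda>k. f (step_path (Suc k) (\<lambda>i. W (real i / real (Suc k)) \<omega>))) \<longlonglongrightarrow> f (\<lambda>t\<in>{0..1}. W t \<omega>)"
    proof (rule AE_I2)
      fix \<omega> assume \<omega>: "\<omega> \<in> space M"
      have "(\<lambda>k. K * skorohod_dist (step_path (Suc k) (\<lambda>i. W (real i / real (Suc k)) \<omega>)) (\<lambda>t\<in>{0..1}. W t \<omega>)) \<longlonglongrightarrow> K * 0"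
        by (intro tendsto_mult_left step_path_tendsto cW[OF \<omega>])
      then have "(\<lambda>k. K * skorohod_dist (step_path (Suc k) (\<lambda>i. W (real i / real (Suc k)) \<omega>)) (\<lambda>t\<in>{0..1}. W t \<omega>)) \<longlonglongrightarrow> 0"
        by simp
      then have "(\<lambda>k. f (step_path (Suc k) (\<lambda>i. W (real i / real (Suc k)) \<omega>)) - f (\<lambda>t\<in>{0..1}. W t \<omega>)) \<longlonglongrightarrow> 0"
        by (rule Lim_null_comparison[rotated])
          (auto intro!: always_eventually f(1) step_path_D01 D01_continuous cW[OF \<omega>] simp del: of_nat_Suc)
      then show "(\<lambda>k. f (step_path (Suc k) (\<lambda>i. W (real i / real (Suc k)) \<omega>))) \<longlonglongrightarrow> f (\<lambda>t\<in>{0..1}. W t \<omega>)"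
        by (simp only: LIM_zero_iff)
    qed
  qed (auto intro!: AE_I2 B step_path_D01 simp del: of_nat_Suc)
  \<comment> \<open>Coefficients of \<open>e\<close> in the final estimate: \<open>5 * K\<close> for
    good sequences and \<open>4 * B\<close> for the two bad events (difference at most
    \<open>2 * B\<close>, total probability at most \<open>2 * e\<close>), both times
    \<open>D\<close>; 1 for the limit at fixed \<open>k\<close>; \<open>D\<close> for replacing
    \<open>W\<close> by its step path.\<close>
  define C where "C = D * (K * 5 + 4 * B) + 1 + D"
  have C: "C > 0" unfolding C_def using D0 B0 f(2) by (intro add_pos_nonneg add_nonneg_pos mult_nonneg_nonneg add_nonneg_nonneg) auto
  have main: "\<forall>\<^sub>F n in sequentially. \<bar>expectation (\<lambda>\<xi>. h \<xi> * f (?X n \<xi>)) - expectation h * ?w\<bar> \<le> C * e"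
    if e: "e > 0" for e
  proof -
    have "\<forall>\<^sub>F k in sequentially. \<bar>?wk (Suc k) - ?w\<bar> < e"
      using tendstoD[OF wk e] by (simp add: dist_real_def)
    moreover have "\<forall>\<^sub>F k in sequentially. 2 < real (Suc k) * e\<^sup>2"
      using e by real_asymp
    moreover have "\<forall>\<^sub>F k in sequentially. 6 / (real (Suc k) * e ^ 4) < e"
      using e by real_asymp
    ultimately have "\<forall>\<^sub>F k in sequentially. \<bar>?wk (Suc k) - ?w\<bar> < e \<and> 2 < real (Suc k) * e\<^sup>2 \<and> 6 / (real (Suc k) * e ^ 4) < e"
      by eventually_elim blast
    then obtain k' where k': "\<bar>?wk (Suc k') - ?w\<bar> < e" "2 < real (Suc k') * e\<^sup>2" "6 / (real (Suc k') * e ^ 4) < e"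
      unfolding eventually_sequentially by blast
    \<comment> \<open>Chosen before \<open>n\<close>: fine enough for the step paths of
      \<open>W\<close>, and so large that \<open>prob_large_osc\<close> gives a probability below
      \<open>e\<close>.\<close>
    define k where "k = Suc k'"
    have k: "k > 0" "\<bar>?wk k - ?w\<bar> < e" "2 < real k * e\<^sup>2" "6 / (real k * e ^ 4) < e"
      using k' by (simp_all only: k_def zero_less_Suc)
    have "\<forall>\<^sub>F n in sequentially. prob {\<xi> \<in> space F. large_osc k N e n \<xi>} < e"
      by (rule prob_large_osc[OF k(1) e k(3,4)])
    moreover have "\<forall>\<^sub>F n in sequentially. prob {\<xi> \<in> space F. close_ones n (gap_factor n) \<xi>} < e"
      using prob_close_ones_tendsto e by (intro order_tendstoD)
    moreover have "\<forall>\<^sub>F n in sequentially. (real N + 1 + H_err + \<theta> * ln 2 + \<theta> * ln (real (gap_factor n))) / sig n < e"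
      using error_tendsto e by (intro order_tendstoD)
    moreover have "\<forall>\<^sub>F n in sequentially. \<bar>expectation h * (expectation (\<lambda>\<xi>. f (?S k n \<xi>)) - ?wk k)\<bar> < e"
    proof -
      have "(\<lambda>n. expectation h * (expectation (\<lambda>\<xi>. f (?S k n \<xi>)) - ?wk k)) \<longlonglongrightarrow> expectation h * (?wk k - ?wk k)"
        by (intro tendsto_intros expectation_step_path_tendsto[OF W k(1) N f B])
      from tendstoD[OF this e] show ?thesis by (simp add: dist_real_def)
    qed
    ultimately show ?thesis
      using eventually_gap_factor_le[OF k(1)] eventually_ge_at_top[of "max 2 N"]
    proof eventually_elim
      case (elim n)
      then have n: "n \<ge> 2" "n \<ge> 1" "N \<le> n" by auto
      \<comment> \<open>Counts bad events, so that \<open>2 * B * b \<xi>\<close> bounds the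
        difference at the sequences which \<open>parts_process_approx\<close> does not
        reach.\<close>
      define b where "b \<xi> = (of_bool (large_osc k N e n \<xi>) + of_bool (close_ones n (gap_factor n) \<xi>) :: real)" for \<xi>
      have m1: "{\<xi> \<in> space F. large_osc k N e n \<xi>} \<in> sets F" by (rule sets_large_osc)
      have m2: "{\<xi> \<in> space F. close_ones n (gap_factor n) \<xi>} \<in> sets F"
        by (rule sets_local[OF _ _ local_on_close_ones]) auto
      have intb: "integrable F b"
        unfolding b_def using m1 m2
        by (intro Bochner_Integration.integrable_add integrable_const_bound[where B = 1]) auto
      have eb: "expectation b \<le> 2 * e"
      proof -
        have "expectation b = prob {\<xi> \<in> space F. large_osc k N e n \<xi>} + prob {\<xi> \<in> space F. close_ones n (gap_factor n) \<xi>}"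
          unfolding b_def prob_eq_expectation using m1 m2
          by (intro Bochner_Integration.integral_add integrable_const_bound[where B = 1]) auto
        then show ?thesis using elim by linarith
      qed
      have XD: "?X n \<xi> \<in> D01" for \<xi> by (rule parts_process_D01[OF n(1)])
      have SD: "?S k n \<xi> \<in> D01" for \<xi> by (rule step_path_D01[OF k(1)])
      have fX: "integrable F (\<lambda>\<xi>. h \<xi> * f (?X n \<xi>))"
      proof (rule integrable_local[of "{1..n}"])
        show "local_on {1..n} (\<lambda>\<xi>. h \<xi> * f (?X n \<xi>))"
          using n by (intro local_on_compose2[of _ _ _ "(*)"] local_on_mono[OF h] local_on_parts_process) auto
      qed auto
      have fS: "integrable F (\<lambda>\<xi>. h \<xi> * f (?S k n \<xi>))"
      proof (rule integrable_local[of "{1..n}"])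
        show "local_on {1..n} (\<lambda>\<xi>. h \<xi> * f (?S k n \<xi>))"
          using n k by (intro local_on_compose2[of _ _ _ "(*)"] local_on_mono[OF h]
            local_on_mono[OF local_on_step_path_Delta]) auto
      qed auto
      have close: "AE \<xi> in F. \<bar>h \<xi> * f (?X n \<xi>) - h \<xi> * f (?S k n \<xi>)\<bar> \<le> D * (K * (5 * e)) + D * (2 * B) * b \<xi>"
        using AE_coord_1
      proof eventually_elim
        fix \<xi> :: "nat \<Rightarrow> bool" assume \<xi>: "\<xi> 1"
        have "\<bar>f (?X n \<xi>) - f (?S k n \<xi>)\<bar> \<le> K * (5 * e) + 2 * B * b \<xi>"
        proof (cases "large_osc k N e n \<xi> \<or> close_ones n (gap_factor n) \<xi>")
          case True
          have "1 \<le> b \<xi>" using True by (auto simp: b_def)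
          then have "2 * B * 1 \<le> 2 * B * b \<xi>" using B0 by (intro mult_left_mono) auto
          moreover have "\<bar>f (?X n \<xi>) - f (?S k n \<xi>)\<bar> \<le> 2 * B" using B[OF XD[of \<xi>]] B[OF SD[of \<xi>]] by linarith
          moreover have "0 \<le> K * (5 * e)" using f(2) e by simp
          ultimately show ?thesis by linarith
        next
          case False
          have S: "?S k n \<xi> = step_path k (\<lambda>i. cs \<xi> N (grid k n i) / sig n)"
            by (simp only: sum_Delta[OF n(2) N])
          have "skorohod_dist (?X n \<xi>) (?S k n \<xi>) \<le> 5 * e"
          proof (rule skorohod_dist_le_sup[OF XD SD])
            fix t :: real assume t: "t \<in> {0..1}"
            have "\<bar>?X n \<xi> t - ?S k n \<xi> t\<bar> \<le>
                (4 * (e * sig n) + (real N + 1 + H_err + \<theta> * ln 2 + \<theta> * ln (real (gap_factor n)))) / sig n"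
              unfolding S
            proof (rule parts_process_approx[where \<xi> = \<xi>, OF n(1) k(1) t \<xi>])
              show "\<not> close_ones n (gap_factor n) \<xi>" using False by simp
              show "\<bar>cs \<xi> (max N (grid k n i)) m\<bar> \<le> 2 * (e * sig n)"
                if "i < k" "m \<in> {max N (grid k n i)..grid k n (Suc i)}" for i m
                using False that unfolding large_osc_def by (meson not_less)
              show "0 \<le> e * sig n" using e sig_pos[OF n(1)] by simp
            qed (use elim gap_factor_bounds(1) in auto)
            also have "\<dots> = 4 * e + (real N + 1 + H_err + \<theta> * ln 2 + \<theta> * ln (real (gap_factor n))) / sig n"
              using sig_pos[OF n(1)] by (simp add: add_divide_distrib)
            also have "\<dots> \<le> 5 * e" using elim by linarith
            finally show "\<bar>?X n \<xi> t - ?S k n \<xi> t\<bar> \<le> 5 * e" .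
          qed (use e in simp)
          then have "K * skorohod_dist (?X n \<xi>) (?S k n \<xi>) \<le> K * (5 * e)" using f(2) by (rule mult_left_mono)
          then have "\<bar>f (?X n \<xi>) - f (?S k n \<xi>)\<bar> \<le> K * (5 * e)" using f(1)[OF XD SD] by (rule order_trans[rotated])
          moreover have "0 \<le> 2 * B * b \<xi>" using B0 by (simp add: b_def)
          ultimately show ?thesis by linarith
        qed
        then have "\<bar>h \<xi>\<bar> * \<bar>f (?X n \<xi>) - f (?S k n \<xi>)\<bar> \<le> D * (K * (5 * e) + 2 * B * b \<xi>)"
          using D[of \<xi>] D0 by (intro mult_mono) auto
        then show "\<bar>h \<xi> * f (?X n \<xi>) - h \<xi> * f (?S k n \<xi>)\<bar> \<le> D * (K * (5 * e)) + D * (2 * B) * b \<xi>"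
          by (simp add: right_diff_distrib[symmetric] abs_mult distrib_left mult_ac)
      qed
      have "\<bar>expectation (\<lambda>\<xi>. h \<xi> * f (?X n \<xi>)) - expectation (\<lambda>\<xi>. h \<xi> * f (?S k n \<xi>))\<bar> =
          \<bar>expectation (\<lambda>\<xi>. h \<xi> * f (?X n \<xi>) - h \<xi> * f (?S k n \<xi>))\<bar>"
        using fX fS by simp
      also have "\<dots> \<le> expectation (\<lambda>\<xi>. \<bar>h \<xi> * f (?X n \<xi>) - h \<xi> * f (?S k n \<xi>)\<bar>)"
        by (rule integral_abs_bound)
      also have "\<dots> \<le> expectation (\<lambda>\<xi>. D * (K * (5 * e)) + D * (2 * B) * b \<xi>)"
        using close fX fS intb by (intro integral_mono_AE) auto
      also have "\<dots> = D * (K * (5 * e)) + D * (2 * B) * expectation b"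
        using intb by (simp add: prob_space)
      also have "\<dots> \<le> D * (K * (5 * e)) + D * (2 * B) * (2 * e)"
        using D0 B0 eb by (intro add_left_mono mult_left_mono) auto
      finally have 1: "\<bar>expectation (\<lambda>\<xi>. h \<xi> * f (?X n \<xi>)) - expectation (\<lambda>\<xi>. h \<xi> * f (?S k n \<xi>))\<bar>
          \<le> D * (K * (5 * e)) + D * (2 * B) * (2 * e)" .
      have 2: "expectation (\<lambda>\<xi>. h \<xi> * f (?S k n \<xi>)) = expectation h * expectation (\<lambda>\<xi>. f (?S k n \<xi>))"
        by (rule expectation_mult_local[OF _ _ h _ _ local_on_step_path_Delta[OF n(2) k(1)]]) auto
      have "\<bar>expectation h\<bar> \<le> D"
      proof -
        have "\<bar>expectation h\<bar> \<le> expectation (\<lambda>\<xi>. \<bar>h \<xi>\<bar>)" by (rule integral_abs_bound)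
        also have "\<dots> \<le> expectation (\<lambda>_. D)" using inth D by (intro integral_mono) auto
        finally show ?thesis by (simp add: prob_space)
      qed
      then have 3: "\<bar>expectation h * (?wk k - ?w)\<bar> \<le> D * e"
        unfolding abs_mult using k(2) D0 by (intro mult_mono) auto
      have "expectation (\<lambda>\<xi>. h \<xi> * f (?X n \<xi>)) - expectation h * ?w =
          (expectation (\<lambda>\<xi>. h \<xi> * f (?X n \<xi>)) - expectation (\<lambda>\<xi>. h \<xi> * f (?S k n \<xi>))) +
          expectation h * (expectation (\<lambda>\<xi>. f (?S k n \<xi>)) - ?wk k) + expectation h * (?wk k - ?w)"
        unfolding 2 by (simp add: algebra_simps)
      moreover have "C * e = D * (K * (5 * e)) + D * (2 * B) * (2 * e) + e + D * e"
        by (simp add: C_def algebra_simps)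
      ultimately show ?case using 1 3 elim by linarith
    qed
  qed
  show ?thesis
  proof (rule tendstoI)
    fix e :: real assume e: "e > 0"
    have "\<forall>\<^sub>F n in sequentially. \<bar>expectation (\<lambda>\<xi>. h \<xi> * f (?X n \<xi>)) - expectation h * ?w\<bar> \<le> C * (e / (2 * C))"
      by (rule main) (use e C in simp)
    then show "\<forall>\<^sub>F n in sequentially. dist (expectation (\<lambda>\<xi>. h \<xi> * f (?X n \<xi>))) (expectation h * ?w) < e"
      by eventually_elim (use e C in \<open>simp add: dist_real_def\<close>)
  qed
qed

lemma small_parts_feller_partition: "small_parts n (feller_partition \<xi> n) = feller_partition \<xi> n"
  using feller_partition_outside by (auto simp: small_parts_def fun_eq_iff)

text \<open>The density at \<open>n\<close> is replaced by the one at a fixed \<open>N\<close> at a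
  cost uniform in \<open>n\<close>, since \<open>f\<close> is bounded by \<open>B\<close> on paths
  and both densities are \<open>r\<close>-close to \<open>\<eta>_inf\<close> in mean. Then
  \<open>mixing_limit\<close> applies at \<open>N\<close>, and the mean of that density is replaced
  by the mean of \<open>\<eta>_inf\<close>.\<close>

lemma density_limit:
  assumes W: "standard_brownian_motion M W"
    and \<eta>: "tendsto_L1 F (\<lambda>n \<xi>. \<eta> (feller_partition \<xi> n)) \<eta>_inf"
    and f: "\<And>x y. x \<in> D01 \<Longrightarrow> y \<in> D01 \<Longrightarrow> \<bar>f x - f y\<bar> \<le> K * skorohod_dist x y" "K \<ge> 0"
    and B: "\<And>x. x \<in> D01 \<Longrightarrow> \<bar>f x\<bar> \<le> B"
  shows "(\<lambda>n. expectation (\<lambda>\<xi>. \<eta> (feller_partition \<xi> n) * f (parts_process \<theta> n (feller_partition \<xi> n))))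
    \<longlonglongrightarrow> expectation \<eta>_inf * (LINT \<omega>|M. f (\<lambda>t\<in>{0..1}. W t \<omega>))"
proof (rule tendstoI)
  fix e :: real assume e: "e > 0"
  interpret M: prob_space M using W unfolding standard_brownian_motion_def by blast
  let ?w = "LINT \<omega>|M. f (\<lambda>t\<in>{0..1}. W t \<omega>)"
  let ?h = "\<lambda>n \<xi>. \<eta> (feller_partition \<xi> n)"
  let ?X = "\<lambda>n \<xi>. parts_process \<theta> n (feller_partition \<xi> n)"
  have cW: "\<And>\<omega>. \<omega> \<in> space M \<Longrightarrow> continuous_on {0..1} (\<lambda>t. W t \<omega>)"
    using W unfolding standard_brownian_motion_def by blast
  have B0: "B \<ge> 0" using B[OF step_path_D01[of 1 undefined]] by linarith
  have int: "integrable F (?h n)" "integrable F \<eta>_inf" and lim: "(\<lambda>n. expectation (\<lambda>\<xi>. \<bar>?h n \<xi> - \<eta>_inf \<xi>\<bar>)) \<longlonglongrightarrow> 0" for n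
    using \<eta> unfolding tendsto_L1_def by auto
  have w: "\<bar>?w\<bar> \<le> B"
  proof -
    have "\<bar>?w\<bar> \<le> (LINT \<omega>|M. \<bar>f (\<lambda>t\<in>{0..1}. W t \<omega>)\<bar>)" by (rule integral_abs_bound)
    also have "\<dots> \<le> (LINT \<omega>|M. B)"
      by (rule integral_mono') (use B0 cW in \<open>auto intro!: B D01_continuous\<close>)
    finally show ?thesis by (simp add: M.prob_space)
  qed
  \<comment> \<open>A cost of \<open>B * r\<close> occurs three times, and
    \<open>e - 4 * (B * r)\<close> is left for \<open>mixing_limit\<close>; \<open>B + 1\<close>
    allows \<open>B = 0\<close>.\<close>
  define r where "r = e / (4 * (B + 1))"
  have r: "r > 0" "4 * (B * r) < e"
  proof -
    show "r > 0" using e B0 by (simp add: r_def)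
    have "r * (4 * (B + 1)) = e" using B0 by (simp add: r_def)
    then have "e = 4 * (B * r) + 4 * r" by (simp add: algebra_simps)
    then show "4 * (B * r) < e" using \<open>r > 0\<close> by linarith
  qed
  have ev: "\<forall>\<^sub>F n in sequentially. expectation (\<lambda>\<xi>. \<bar>?h n \<xi> - \<eta>_inf \<xi>\<bar>) < r"
    using lim r by (intro order_tendstoD)
  then have "\<forall>\<^sub>F n in sequentially. expectation (\<lambda>\<xi>. \<bar>?h n \<xi> - \<eta>_inf \<xi>\<bar>) < r \<and> n \<ge> 1"
    using eventually_ge_at_top[of 1] by eventually_elim simp
  then obtain N where N: "N \<ge> 1" "expectation (\<lambda>\<xi>. \<bar>?h N \<xi> - \<eta>_inf \<xi>\<bar>) < r"
    unfolding eventually_sequentially by blast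
  have "(\<lambda>n. expectation (\<lambda>\<xi>. ?h N \<xi> * f (?X n \<xi>))) \<longlonglongrightarrow> expectation (?h N) * ?w"
    by (rule mixing_limit[OF W N(1) _ f B]) (rule local_on_compose[OF local_on_feller_partition])
  then have "\<forall>\<^sub>F n in sequentially. dist (expectation (\<lambda>\<xi>. ?h N \<xi> * f (?X n \<xi>))) (expectation (?h N) * ?w) < e - 4 * (B * r)"
    by (rule tendstoD) (use r in simp)
  with ev eventually_ge_at_top[of 2]
  show "\<forall>\<^sub>F n in sequentially. dist (expectation (\<lambda>\<xi>. ?h n \<xi> * f (?X n \<xi>))) (expectation \<eta>_inf * ?w) < e"
  proof eventually_elim
    case (elim n)
    have i: "integrable F (\<lambda>\<xi>. ?h j \<xi> * f (?X n \<xi>))" for j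
    proof (rule integrable_local[of "{1..max j n}"])
      show "local_on {1..max j n} (\<lambda>\<xi>. ?h j \<xi> * f (?X n \<xi>))"
        by (intro local_on_compose2[of _ _ _ "(*)"] local_on_mono[OF local_on_parts_process]
            local_on_mono[OF local_on_compose[OF local_on_feller_partition]]) auto
    qed auto
    have "\<bar>expectation (\<lambda>\<xi>. ?h n \<xi> * f (?X n \<xi>)) - expectation (\<lambda>\<xi>. ?h N \<xi> * f (?X n \<xi>))\<bar> =
        \<bar>expectation (\<lambda>\<xi>. ?h n \<xi> * f (?X n \<xi>) - ?h N \<xi> * f (?X n \<xi>))\<bar>"
      using i by simp
    also have "\<dots> \<le> expectation (\<lambda>\<xi>. \<bar>?h n \<xi> * f (?X n \<xi>) - ?h N \<xi> * f (?X n \<xi>)\<bar>)" by (rule integral_abs_bound)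
    also have "\<dots> \<le> expectation (\<lambda>\<xi>. B * \<bar>?h n \<xi> - \<eta>_inf \<xi>\<bar> + B * \<bar>?h N \<xi> - \<eta>_inf \<xi>\<bar>)"
    proof (rule integral_mono)
      fix \<xi>
      have "\<bar>?h n \<xi> * f (?X n \<xi>) - ?h N \<xi> * f (?X n \<xi>)\<bar> = \<bar>f (?X n \<xi>)\<bar> * \<bar>?h n \<xi> - ?h N \<xi>\<bar>"
        by (simp add: left_diff_distrib[symmetric] abs_mult mult.commute)
      also have "\<dots> \<le> B * (\<bar>?h n \<xi> - \<eta>_inf \<xi>\<bar> + \<bar>?h N \<xi> - \<eta>_inf \<xi>\<bar>)"
        using B[OF parts_process_D01[OF elim(2)]] B0 by (intro mult_mono) auto
      finally show "\<bar>?h n \<xi> * f (?X n \<xi>) - ?h N \<xi> * f (?X n \<xi>)\<bar> \<le> B * \<bar>?h n \<xi> - \<eta>_inf \<xi>\<bar> + B * \<bar>?h N \<xi> - \<eta>_inf \<xi>\<bar>"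
        by (simp only: distrib_left)
    qed (use i int in auto)
    also have "\<dots> = B * expectation (\<lambda>\<xi>. \<bar>?h n \<xi> - \<eta>_inf \<xi>\<bar>) + B * expectation (\<lambda>\<xi>. \<bar>?h N \<xi> - \<eta>_inf \<xi>\<bar>)"
      using int by simp
    also have "\<dots> \<le> B * r + B * r" using elim N B0 by (intro add_mono mult_left_mono) auto
    finally have 1: "\<bar>expectation (\<lambda>\<xi>. ?h n \<xi> * f (?X n \<xi>)) - expectation (\<lambda>\<xi>. ?h N \<xi> * f (?X n \<xi>))\<bar> \<le> B * r + B * r" .
    have "\<bar>expectation (?h N) - expectation \<eta>_inf\<bar> = \<bar>expectation (\<lambda>\<xi>. ?h N \<xi> - \<eta>_inf \<xi>)\<bar>" using int by simp
    also have "\<dots> \<le> expectation (\<lambda>\<xi>. \<bar>?h N \<xi> - \<eta>_inf \<xi>\<bar>)" by (rule integral_abs_bound)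
    also have "\<dots> \<le> r" using N by simp
    finally have "\<bar>?w\<bar> * \<bar>expectation (?h N) - expectation \<eta>_inf\<bar> \<le> B * r"
      using w B0 by (intro mult_mono) auto
    then have 2: "\<bar>expectation (?h N) * ?w - expectation \<eta>_inf * ?w\<bar> \<le> B * r"
      by (simp add: left_diff_distrib[symmetric] abs_mult mult.commute)
    have "0 \<le> B * r" using B0 r by simp
    then show ?case using 1 2 elim(3) unfolding dist_real_def by linarith
  qed
qed

end

theorem corollary1p3:
  fixes \<theta> :: real and P :: "nat \<Rightarrow> (nat \<Rightarrow> nat) measure"
    and M :: "'w measure" and W :: "real \<Rightarrow> 'w \<Rightarrow> real"
  assumes "\<theta> > 0"
    and "asymptotically_ewens \<theta> P"
    and "standard_brownian_motion M W"
  shows "converges_in_distribution skorohod_topology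
           P (\<lambda>n. parts_process \<theta> n)
           M (\<lambda>\<omega>. \<lambda>t\<in>{0..1}. W t \<omega>)"
proof -
  interpret feller \<theta> by standard (rule assms(1))
  interpret M: prob_space M using assms(3) unfolding standard_brownian_motion_def by blast
  obtain \<eta> \<eta>_inf where nonneg: "\<And>k \<alpha>. \<alpha> \<in> partitions k \<Longrightarrow> 0 \<le> \<eta> \<alpha>"
    and Z: "\<And>n. n \<ge> 1 \<Longrightarrow> perturbed_norm \<theta> \<eta> n > 0"
    and P: "\<And>n. n \<ge> 1 \<Longrightarrow> P n = perturbed_ewens \<theta> \<eta> n"
    and lim: "tendsto_L1 F (\<lambda>n. eta_trunc \<eta> n n) \<eta>_inf" and pos: "0 < expectation \<eta>_inf"
    using assms(2) unfolding asymptotically_ewens_def by metis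
  have lim': "tendsto_L1 F (\<lambda>n \<xi>. \<eta> (feller_partition \<xi> n)) \<eta>_inf"
    using lim unfolding eta_trunc_def small_parts_feller_partition .
  let ?T = "skorohod_topology" and ?Y = "\<lambda>\<omega>. \<lambda>t\<in>{0..1}. W t \<omega>"
  have Y: "?Y \<in> M \<rightarrow>\<^sub>M borel_of ?T"
    using assms(3) unfolding standard_brownian_motion_def by (intro measurable_continuous_path) auto
  \<comment> \<open>All subsets of the finite set of partitions are measurable for
    \<open>P n\<close>, so only the range of the map has to be checked.\<close>
  have X: "parts_process \<theta> n \<in> P n \<rightarrow>\<^sub>M borel_of ?T" if "n \<ge> 2" for n
    using that P[of n] parts_process_D01[OF that]
    by (auto simp: perturbed_ewens_def measurable_def space_point_measure sets_point_measure)
  have prob: "prob_space (P n)" if "n \<ge> 1" for n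
    unfolding P[OF that] using assms(1) nonneg Z[OF that] by (rule prob_space_perturbed_ewens)
  have "weak_conv_on ?T (\<lambda>n. distr (P n) (borel_of ?T) (parts_process \<theta> n)) (distr M (borel_of ?T) ?Y)"
  proof (rule skorohod.weak_conv_on_Lipschitz)
    show "\<forall>\<^sub>F n in sequentially. prob_space (distr (P n) (borel_of ?T) (parts_process \<theta> n)) \<and>
        sets (distr (P n) (borel_of ?T) (parts_process \<theta> n)) = sets (borel_of ?T)"
      using eventually_ge_at_top[of 2] by eventually_elim (auto intro!: prob_space.prob_space_distr prob X)
    show "prob_space (distr M (borel_of ?T) ?Y)" by (rule M.prob_space_distr[OF Y])
    fix f B K assume B: "\<And>x. x \<in> D01 \<Longrightarrow> \<bar>f x\<bar> \<le> B"
      and f: "\<And>x y. x \<in> D01 \<Longrightarrow> y \<in> D01 \<Longrightarrow> \<bar>f x - f y\<bar> \<le> K * skorohod_dist x y"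
    \<comment> \<open>The Lipschitz constant handed over by \<open>weak_conv_on_Lipschitz\<close>
      has no sign condition, whereas \<open>density_limit\<close> asks for a nonnegative
      one.\<close>
    have f': "\<bar>f x - f y\<bar> \<le> \<bar>K\<bar> * skorohod_dist x y" if "x \<in> D01" "y \<in> D01" for x y
      using order_trans[OF f[OF that] mult_right_mono[OF abs_ge_self skorohod_dist_nonneg]] .
    have fm: "f \<in> borel_measurable (borel_of ?T)"
      by (rule measurable_continuous_map_borel_of, rule skorohod.continuous_map_Lipschitz_real, rule f)
    let ?h = "\<lambda>n \<xi>. \<eta> (feller_partition \<xi> n)"
    have num: "(\<lambda>n. expectation (\<lambda>\<xi>. ?h n \<xi> * f (parts_process \<theta> n (feller_partition \<xi> n))))
        \<longlonglongrightarrow> expectation \<eta>_inf * (LINT \<omega>|M. f (?Y \<omega>))"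
      by (rule density_limit[OF assms(3) lim' f' _ B]) auto
    \<comment> \<open>The same limit with the test function 1 gives the normalising
      denominator.\<close>
    have "(\<lambda>n. expectation (\<lambda>\<xi>. ?h n \<xi> * 1)) \<longlonglongrightarrow> expectation \<eta>_inf * (LINT \<omega>|M. 1)"
      by (rule density_limit[OF assms(3) lim', where f = "\<lambda>_. 1" and K = 0 and B = 1]) auto
    then have den: "(\<lambda>n. expectation (?h n)) \<longlonglongrightarrow> expectation \<eta>_inf" by (simp add: M.prob_space)
    have "(\<lambda>n. expectation (\<lambda>\<xi>. ?h n \<xi> * f (parts_process \<theta> n (feller_partition \<xi> n))) / expectation (?h n))
        \<longlonglongrightarrow> expectation \<eta>_inf * (LINT \<omega>|M. f (?Y \<omega>)) / expectation \<eta>_inf"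
      using pos by (intro tendsto_divide num den) simp
    then have "(\<lambda>n. expectation (\<lambda>\<xi>. ?h n \<xi> * f (parts_process \<theta> n (feller_partition \<xi> n))) / expectation (?h n))
        \<longlonglongrightarrow> (LINT x|distr M (borel_of ?T) ?Y. f x)"
      using pos by (simp add: integral_distr[OF Y fm])
    moreover have "\<forall>\<^sub>F n in sequentially. expectation (\<lambda>\<xi>. ?h n \<xi> * f (parts_process \<theta> n (feller_partition \<xi> n))) / expectation (?h n)
        = (LINT x|distr (P n) (borel_of ?T) (parts_process \<theta> n). f x)"
      using eventually_ge_at_top[of 2]
    proof eventually_elim
      case (elim n)
      then have n: "n \<ge> 1" by simp
      have "(LINT x|distr (P n) (borel_of ?T) (parts_process \<theta> n). f x) = (LINT \<alpha>|P n. f (parts_process \<theta> n \<alpha>))"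
        by (rule integral_distr[OF X[OF elim] fm])
      then show ?case
        unfolding P[OF n] using integral_perturbed_ewens[OF nonneg Z[OF n], where h = "\<lambda>\<alpha>. f (parts_process \<theta> n \<alpha>)"] by simp
    qed
    ultimately show "(\<lambda>n. LINT x|distr (P n) (borel_of ?T) (parts_process \<theta> n). f x) \<longlonglongrightarrow> (LINT x|distr M (borel_of ?T) ?Y. f x)"
      by (rule Lim_transform_eventually)
  qed simp
  moreover have "\<forall>\<^sub>F n in sequentially. parts_process \<theta> n \<in> P n \<rightarrow>\<^sub>M borel_of ?T"
    using eventually_ge_at_top[of 2] by eventually_elim (rule X)
  ultimately show ?thesis unfolding converges_in_distribution_def using Y by blast
qed

end
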